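(* Let $0<q<1$, $\mathcal{H}=\mathbb{C}^2$ with orthonormal vectors $f_0=(1,0)$, $f_1=(0,1)$, and let $X_0=a(f_0)+a(f_0)^*$ and $X_1=a(f_1)+a(f_1)^*$ on $\mathcal{F}_q(\mathbb{C}^2)$. Then there exists a (Borel) function $\gamma\colon\mathbb{R}\to\mathbb{R}$ such that $X_0$ and $\gamma(X_0)$ have the same distribution with respect to the vacuum state, but $X_0+X_1$ and $\gamma(X_0)+X_1$ do not have the same distribution with respect to the vacuum state.
   Context: Fix $q\in(-1,1)$ and a Hilbert space $\mathcal{H}$. On the algebraic full Fock space $\mathcal{F}=\mathbb{C}\Omega\oplus\bigoplus_{n\ge1}\mathcal{H}^{\otimes n}$ (with $\Omega$ the vacuum vector $1\oplus0\oplus0\oplus\cdots$), define the creation operator $a(f)^*h_1\otimes\cdots\otimes h_n=f\otimes h_1\otimes\cdots\otimes h_n$ and the annihilation operator $a(f)\Omega=0$, $a(f)h_1\otimes\cdots\otimes h_n=\sum_{k=1}^n q^{k-1}\langle f,h_k\rangle\, h_1\otimes\cdots\otimes h_{k-1}\otimes h_{k+1}\otimes\cdots\otimes h_n$. The $q$-inner product is defined recursively by $\langle\Omega,\Omega\rangle_q=1$ and $\langle g_1\otimes\cdots\otimes g_m,h_1\otimes\cdots\otimes h_n\rangle_q=\delta_{nm}\sum_{k=1}^n q^{k-1}\langle g_1,h_k\rangle\langle g_2\otimes\cdots\otimes g_m,h_1\otimes\cdots\otimes h_{k-1}\otimes h_{k+1}\otimes\cdots\otimes h_n\rangle_q$ (tensors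 of different degree are orthogonal). For $|q|<1$ this is positive definite; $\mathcal{F}_q(\mathcal{H})$ denotes the completion. The operators $a(f),a(f)^*$ extend to bounded operators, mutually adjoint, satisfying $a(f)a(g)^*-q\,a(g)^*a(f)=\langle f,g\rangle\mathbf{1}$. For a bounded self-adjoint operator $Y$ on $\mathcal{F}_q(\mathcal{H})$, its distribution (with respect to the vacuum state) is the probability measure $\mu_Y$ on $\mathbb{R}$ with $\langle\Omega,g(Y)\Omega\rangle_q=\int g\,d\mu_Y$ for all bounded Borel $g$; in particular its moments are $\langle\Omega,Y^n\Omega\rangle_q$. *)

theory Defs
  imports "HOL-Analysis.Analysis"
begin

text \<open>Concrete model of the q-Fock space over C^2 with orthonormal basis f_0, f_1.
  A basis word is a bool list: False stands for f_0, True for f_1; the list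
  [h1,...,hn] stands for h1 \<otimes> ... \<otimes> hn, and [] for the vacuum.
  A vector is given by its coefficient function on words.\<close>

primrec qgram :: "real \<Rightarrow> bool list \<Rightarrow> bool list \<Rightarrow> real" where
  "qgram q [] bs = (if bs = [] then 1 else 0)"
| "qgram q (a # as) bs =
     (if length bs = Suc (length as)
      then (\<Sum>k<length bs. (if bs ! k = a
                              then q ^ k * qgram q as (take k bs @ drop (Suc k) bs)
                              else 0))
      else 0)"

definition qip_deg :: "real \<Rightarrow> (bool list \<Rightarrow> complex) \<Rightarrow> (bool list \<Rightarrow> complex) \<Rightarrow> nat \<Rightarrow> complex" where
  "qip_deg q u v n =
     (\<Sum>w\<in>{w. length w = n}. \<Sum>w'\<in>{w. length w = n}.
        cnj (u w) * v w' * complex_of_real (qgram q w w'))"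

definition qip :: "real \<Rightarrow> (bool list \<Rightarrow> complex) \<Rightarrow> (bool list \<Rightarrow> complex) \<Rightarrow> complex" where
  "qip q u v = (\<Sum>n. qip_deg q u v n)"

text \<open>The completion F_q(C^2): orthogonal sum of the finite-dimensional degree-n spaces.\<close>
definition fock :: "real \<Rightarrow> (bool list \<Rightarrow> complex) set" where
  "fock q = {v. summable (\<lambda>n. Re (qip_deg q v v n))}"

definition vac :: "bool list \<Rightarrow> complex" where
  "vac = (\<lambda>w. if w = [] then 1 else 0)"

definition cre :: "bool \<Rightarrow> (bool list \<Rightarrow> complex) \<Rightarrow> (bool list \<Rightarrow> complex)" where
  "cre i v = (\<lambda>w. case w of [] \<Rightarrow> 0 | a # u \<Rightarrow> (if a = i then v u else 0))"

definition ann :: "real \<Rightarrow> bool \<Rightarrow> (bool list \<Rightarrow> complex) \<Rightarrow> (bool list \<Rightarrow> complex)" where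
  "ann q i v = (\<lambda>u. \<Sum>k\<le>length u. complex_of_real (q ^ k) * v (take k u @ i # drop k u))"

definition Xop :: "real \<Rightarrow> bool \<Rightarrow> (bool list \<Rightarrow> complex) \<Rightarrow> (bool list \<Rightarrow> complex)" where
  "Xop q i v = (\<lambda>w. ann q i v w + cre i v w)"

definition spectral_measure ::
  "real \<Rightarrow> ((bool list \<Rightarrow> complex) \<Rightarrow> (bool list \<Rightarrow> complex)) \<Rightarrow> (bool list \<Rightarrow> complex) \<Rightarrow> real measure \<Rightarrow> bool" where
  "spectral_measure q Y z mu \<longleftrightarrow>
     sets mu = sets borel \<and> finite_measure mu \<and>
     (\<forall>n. integrable mu (\<lambda>t. t ^ n) \<and>
          complex_of_real (\<integral>t. t ^ n \<partial>mu) = qip q z ((Y ^^ n) z))"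

definition vac_distribution ::
  "real \<Rightarrow> ((bool list \<Rightarrow> complex) \<Rightarrow> (bool list \<Rightarrow> complex)) \<Rightarrow> real measure \<Rightarrow> bool" where
  "vac_distribution q Y mu \<longleftrightarrow> spectral_measure q Y vac mu"

definition same_distribution ::
  "real \<Rightarrow> ((bool list \<Rightarrow> complex) \<Rightarrow> (bool list \<Rightarrow> complex)) \<Rightarrow> ((bool list \<Rightarrow> complex) \<Rightarrow> (bool list \<Rightarrow> complex)) \<Rightarrow> bool" where
  "same_distribution q A B \<longleftrightarrow> (\<forall>mu. vac_distribution q A mu \<longleftrightarrow> vac_distribution q B mu)"

text \<open>T = g(Y) (Borel functional calculus): T is a linear map of F_q into itself whose
  quadratic form is given by integrating g against the spectral measures of Y.
  On the complex Hilbert space this determines T uniquely.\<close>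
definition is_fcalc ::
  "real \<Rightarrow> ((bool list \<Rightarrow> complex) \<Rightarrow> (bool list \<Rightarrow> complex)) \<Rightarrow> (real \<Rightarrow> real)
    \<Rightarrow> ((bool list \<Rightarrow> complex) \<Rightarrow> (bool list \<Rightarrow> complex)) \<Rightarrow> bool" where
  "is_fcalc q Y g T \<longleftrightarrow>
     (\<forall>v\<in>fock q. T v \<in> fock q) \<and>
     (\<forall>u\<in>fock q. \<forall>v\<in>fock q. \<forall>a b. T (\<lambda>w. a * u w + b * v w) = (\<lambda>w. a * T u w + b * T v w)) \<and>
     (\<forall>z\<in>fock q. \<forall>mu. spectral_measure q Y z mu \<longrightarrow>
        qip q z (T z) = complex_of_real (\<integral>t. g t \<partial>mu))"

end

theory Submission
  imports Defs "HOL-Combinatorics.Multiset_Permutations" "HOL-Probability.Probability"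
begin

text \<open>
  The function \<open>\<gamma>\<close> flips the sign of \<open>t\<close> where \<open>t\<^sup>2 \<ge> 2 + q\<close>.  As the vacuum distribution of \<open>X\<^sub>0\<close> is
  symmetric, \<open>\<gamma>(X\<^sub>0)\<close> and \<open>X\<^sub>0\<close> have the same distribution.  In the fourth moment of \<open>\<gamma>(X\<^sub>0) + X\<^sub>1\<close> the only
  term that is not a moment of \<open>\<gamma>(X\<^sub>0)\<close> comes from \<open>\<langle>\<Omega>, Y X\<^sub>1 Y X\<^sub>1 \<Omega>\<rangle> = \<Sum>\<^sub>n q\<^sup>n \<parallel>\<xi>\<^sub>n\<parallel>\<^sup>2\<close> with
  \<open>Y = \<gamma>(X\<^sub>0)\<close> and \<open>\<xi>\<^sub>n\<close> the degree \<open>n\<close> part of the unit vector \<open>Y \<Omega>\<close>.  Since \<open>\<xi>\<^sub>0 = 0\<close>, this is at most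
  \<open>q\<close>, the value for \<open>X\<^sub>0\<close>, with equality only if \<open>Y \<Omega> = \<plusminus> f\<^sub>0\<close>; the threshold \<open>2 + q\<close> is the
  mean of \<open>t\<^sup>2\<close> under the weight \<open>t\<^sup>2\<close>, so both signs really occur and equality fails.

  The operator \<open>\<gamma>(X\<^sub>0)\<close> is a strong limit of polynomials in \<open>X\<^sub>0\<close>.  The spectral measures come from
  the Hausdorff moment problem, solved with Bernstein weights and Helly's selection theorem.
  Positivity of the \<open>q\<close>-inner product follows by labelling the letters of a word: the kernel
  \<open>q\<close> to the number of inversions is a product of \<open>2 \<times> 2\<close> positive definite kernels, one for each
  pair of labels.
\<close>

subsection \<open>Kernels counting inversions\<close>

text \<open>The effect comes from a mismatch of sides. All operators act on the left end of a
  tensor, so polynomials in \<open>X\<^sub>0\<close>, and hence their limit \<open>Y\<close>,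
  commute with appending \<open>f\<^sub>1\<close> on the right: \<open>Y f\<^sub>1\<close> is
  \<open>Y \<Omega>\<close> followed by \<open>f\<^sub>1\<close>. The operator
  \<open>X\<^sub>1\<close>, however, puts \<open>f\<^sub>1\<close> to the left of
  \<open>Y \<Omega>\<close>. Pairing the two vectors moves \<open>f\<^sub>1\<close> past all
  \<open>n\<close> factors, at the cost \<open>q ^ n\<close>. Every other term of the fourth moment
  is an even moment of \<open>Y\<close>, and these agree with those of \<open>X\<^sub>0\<close>
  because \<open>\<gamma>(t)\<^sup>2 = t\<^sup>2\<close> on the supports. Distributions and
  functional calculus are specified through moments, so each integral formula has to hold for every
  measure with the right moments; the compact support of such a measure is derived from the growth
  of its moments. The Gram matrices need a positive lower bound in each degree, not only
  nonnegativity: it makes every single coefficient continuous in the norm. This gives completeness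
  of the space of coefficient functions and lets limits of operators be computed word by
  word.\<close>

fun precedes :: "'a list \<Rightarrow> 'a \<Rightarrow> 'a \<Rightarrow> bool" where
  "precedes [] i j = False"
| "precedes (x # xs) i j = (if x = i then j \<in> set xs else precedes xs i j)"

lemma precedes_in_set: "precedes xs i j \<Longrightarrow> j \<in> set xs"
  by (induction xs) (auto split: if_splits)

lemma precedes_insert:
  "i \<noteq> x \<Longrightarrow> j \<noteq> x \<Longrightarrow> precedes (us @ x # vs) i j = precedes (us @ vs) i j"
  by (induction us) auto

lemma precedes_from_inserted:
  "x \<notin> set us \<Longrightarrow> precedes (us @ x # vs) x a \<longleftrightarrow> a \<in> set vs"
  by (induction us) auto

lemma precedes_to_inserted:
  "a \<noteq> x \<Longrightarrow> x \<notin> set vs \<Longrightarrow> precedes (us @ x # vs) a x \<longleftrightarrow> a \<in> set us"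
  by (induction us) (auto dest: precedes_in_set)

text \<open>The head of a duplicate-free list is preceded by nothing but precedes every other
  letter, so equal order relations force equal heads; the tails follow by induction.\<close>

lemma precedes_determines:
  assumes "distinct xs" "distinct ys" "set xs = set ys"
    and "\<And>i j. i \<in> set xs \<Longrightarrow> j \<in> set xs \<Longrightarrow> precedes xs i j = precedes ys i j"
  shows "xs = ys"
  using assms
proof (induction xs arbitrary: ys)
  case Nil
  then show ?case by simp
next
  case (Cons x xs)
  then obtain y ys' where ys: "ys = y # ys'"
    by (cases ys) auto
  have "y = x"
  proof (rule ccontr)
    assume "y \<noteq> x"
    then have "precedes ys y x"
      using Cons.prems(3) ys list.set_intros(1)[of x xs] by auto
    moreover have "y \<in> set (x # xs)"
      using Cons.prems(3) ys by auto
    ultimately have "precedes (x # xs) y x"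
      using Cons.prems(4) by auto
    then have "precedes xs y x"
      using \<open>y \<noteq> x\<close> by (auto split: if_splits)
    then show False
      using precedes_in_set Cons.prems(1) by fastforce
  qed
  moreover have "xs = ys'"
  proof (rule Cons.IH)
    show "distinct xs" "distinct ys'" using Cons.prems ys by auto
    show "set xs = set ys'"
      using Cons.prems(1-3) ys \<open>y = x\<close> by (simp add: insert_ident)
    fix i j assume ij: "i \<in> set xs" "j \<in> set xs"
    then have "i \<noteq> x" using Cons.prems by auto
    then show "precedes xs i j = precedes ys' i j"
      using Cons.prems(4)[of i j] ij ys \<open>y = x\<close> by simp
  qed
  ultimately show ?case using ys by simp
qed

text \<open>Each inversion is counted in both orders \<open>(i, j)\<close> and \<open>(j, i)\<close>, so \<open>q = r\<^sup>2\<close> below.\<close>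

definition order_kernel :: "real \<Rightarrow> 'a set \<Rightarrow> 'a list \<Rightarrow> 'a list \<Rightarrow> real" where
  "order_kernel r A xs ys =
     (\<Prod>i\<in>A. \<Prod>j\<in>A. if precedes xs i j = precedes ys i j then 1 else r)"

lemma order_kernel_commute: "order_kernel r A xs ys = order_kernel r A ys xs"
proof -
  have "(if precedes xs i j = precedes ys i j then 1 else r)
      = (if precedes ys i j = precedes xs i j then 1 else r)" for i j
    by metis
  then show ?thesis
    unfolding order_kernel_def by presburger
qed

text \<open>The label \<open>x\<close> comes first in one list and after \<open>us\<close> in the
  other, so the two lists disagree about \<open>x\<close> exactly on the labels of
  \<open>us\<close>. Each such label contributes \<open>r\<close> twice, as \<open>(x, j)\<close>
  and as \<open>(j, x)\<close>, and the remaining pairs do not see \<open>x\<close>. This is the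
  weight \<open>q ^ k\<close> in the recursion of \<open>qgram\<close>.\<close>

lemma order_kernel_insert:
  assumes "x \<notin> set xs" "distinct xs" "distinct (us @ vs)" "set (us @ vs) = set xs"
  shows "order_kernel r (insert x (set xs)) (x # xs) (us @ x # vs)
       = (r ^ 2) ^ length us * order_kernel r (set xs) xs (us @ vs)"
proof -
  let ?f = "\<lambda>i j. if precedes (x # xs) i j = precedes (us @ x # vs) i j then 1 else r"
  have x: "x \<notin> set us" "x \<notin> set vs" using assms by auto
  have disj: "set us \<inter> set vs = {}" "distinct us" using assms by auto
  have xj: "?f x j = (if j \<in> set us then r else 1)" if "j \<in> set xs" for j
    using that x disj assms(4) by (auto simp: precedes_from_inserted)
  have ix: "?f i x = (if i \<in> set us then r else 1)" if "i \<in> set xs" for i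
    using that x disj assms(1,4) precedes_to_inserted[of i x vs us]
    by (auto dest: precedes_in_set)
  have ij: "?f i j = (if precedes xs i j = precedes (us @ vs) i j then 1 else r)"
    if "i \<in> set xs" "j \<in> set xs" for i j
    using that assms(1) precedes_insert[of i x j us vs] by auto
  have xx: "?f x x = 1"
    using x assms(1) by (simp add: precedes_from_inserted)
  have pr: "(\<Prod>j\<in>set xs. if j \<in> set us then r else 1) = r ^ length us"
  proof -
    have "(\<Prod>j\<in>set xs. if j \<in> set us then r else 1) = (\<Prod>j\<in>set xs \<inter> set us. r)"
      by (subst prod.inter_restrict) auto
    also have "set xs \<inter> set us = set us" using assms(4) by auto
    finally show ?thesis using disj by (simp add: distinct_card)
  qed
  have "order_kernel r (insert x (set xs)) (x # xs) (us @ x # vs)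
     = (?f x x * (\<Prod>j\<in>set xs. ?f x j)) * (\<Prod>i\<in>set xs. ?f i x * (\<Prod>j\<in>set xs. ?f i j))"
    unfolding order_kernel_def
    by (simp only: prod.insert[OF finite_set assms(1)])
  also have "\<dots> = (\<Prod>j\<in>set xs. ?f x j) * ((\<Prod>i\<in>set xs. ?f i x) * (\<Prod>i\<in>set xs. \<Prod>j\<in>set xs. ?f i j))"
    by (simp only: xx prod.distrib mult_1)
  also have "(\<Prod>j\<in>set xs. ?f x j) = r ^ length us"
    unfolding pr[symmetric] by (intro prod.cong refl xj)
  also have "(\<Prod>i\<in>set xs. ?f i x) = r ^ length us"
    unfolding pr[symmetric] by (intro prod.cong refl ix)
  also have "(\<Prod>i\<in>set xs. \<Prod>j\<in>set xs. ?f i j) = order_kernel r (set xs) xs (us @ vs)"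
    unfolding order_kernel_def by (intro prod.cong refl ij)
  finally show ?thesis
    by (simp add: power_mult[symmetric] power_add[symmetric] mult_2)
qed

text \<open>The quadratic form of a product kernel: every test \<open>s\<close> contributes a factor
  \<open>1\<close> or \<open>r\<close> according to whether \<open>x\<close> and \<open>y\<close>
  give the same answer.\<close>

definition test_form ::
  "real \<Rightarrow> ('s \<Rightarrow> 'a \<Rightarrow> bool) \<Rightarrow> 's set \<Rightarrow> 'a set \<Rightarrow> ('a \<Rightarrow> complex) \<Rightarrow> complex" where
  "test_form r t S X g = (\<Sum>x\<in>X. \<Sum>y\<in>X.
     complex_of_real (\<Prod>s\<in>S. if t s x = t s y then 1 else r) * cnj (g x) * g y)"

text \<open>The factor of one test is \<open>r\<close> times the constant kernel plus
  \<open>1 - r\<close> times the kernel "equal answers"; the latter splits \<open>g\<close> into its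
  restrictions to the two answers.\<close>

lemma test_form_insert:
  assumes "finite S" "s \<notin> S"
  shows "test_form r t (insert s S) X g = of_real r * test_form r t S X g
     + of_real (1 - r) * (test_form r t S X (\<lambda>x. if t s x then g x else 0)
                        + test_form r t S X (\<lambda>x. if t s x then 0 else g x))"
  unfolding test_form_def sum_distrib_left sum.distrib[symmetric]
proof (intro sum.cong refl)
  fix x y
  define P where "P = complex_of_real (\<Prod>s\<in>S. if t s x = t s y then 1 else r)"
  have P: "complex_of_real (\<Prod>s\<in>insert s S. if t s x = t s y then 1 else r)
      = (if t s x = t s y then 1 else of_real r) * P"
    using assms by (simp add: P_def)
  show "complex_of_real (\<Prod>s\<in>insert s S. if t s x = t s y then 1 else r) * cnj (g x) * g y
    = of_real r * (of_real (\<Prod>s\<in>S. if t s x = t s y then 1 else r) * cnj (g x) * g y)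
    + of_real (1 - r) * (of_real (\<Prod>s\<in>S. if t s x = t s y then 1 else r)
          * cnj (if t s x then g x else 0) * (if t s y then g y else 0)
        + of_real (\<Prod>s\<in>S. if t s x = t s y then 1 else r)
          * cnj (if t s x then 0 else g x) * (if t s y then 0 else g y))"
    unfolding P P_def[symmetric]
    by (cases "t s x"; cases "t s y") (simp_all add: left_diff_distrib mult.assoc)
qed

lemma test_form_nonneg:
  assumes "finite S" "0 \<le> r" "r \<le> 1"
  shows "0 \<le> Re (test_form r t S X g)"
  using assms(1)
proof (induction S arbitrary: g)
  case empty
  have "test_form r t {} X g = cnj (\<Sum>x\<in>X. g x) * (\<Sum>x\<in>X. g x)"
    by (simp add: test_form_def sum_product)
  also have "\<dots> = of_real ((cmod (\<Sum>x\<in>X. g x))\<^sup>2)"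
    by (simp only: complex_norm_square mult.commute)
  finally show ?case by simp
next
  case (insert s S)
  then show ?case
    using assms(2,3) by (simp add: test_form_insert)
qed

text \<open>The form with \<open>r = 0\<close> only sees pairs that agree on all tests.\<close>

lemma test_form_lower_bound:
  assumes "finite S" "0 \<le> r" "r \<le> 1"
  shows "(1 - r) ^ card S * Re (test_form 0 t S X g) \<le> Re (test_form r t S X g)"
  using assms(1)
proof (induction S arbitrary: g)
  case empty
  then show ?case by (simp add: test_form_def)
next
  case (insert s S)
  let ?g1 = "\<lambda>x. if t s x then g x else 0" and ?g2 = "\<lambda>x. if t s x then 0 else g x"
  have "(1 - r) ^ card (insert s S) * Re (test_form 0 t (insert s S) X g)
     = (1 - r) * ((1 - r) ^ card S * Re (test_form 0 t S X ?g1)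
                + (1 - r) ^ card S * Re (test_form 0 t S X ?g2))"
    using insert by (simp add: test_form_insert algebra_simps)
  also have "\<dots> \<le> (1 - r) * (Re (test_form r t S X ?g1) + Re (test_form r t S X ?g2))"
    using assms by (intro mult_left_mono add_mono insert.IH) auto
  \<comment> \<open>The dropped summand \<open>r * test_form r t S X g\<close> is
    nonnegative.\<close>
  also have "\<dots> \<le> Re (test_form r t (insert s S) X g)"
    using insert assms by (simp add: test_form_insert test_form_nonneg)
  finally show ?case .
qed

text \<open>The tests are the ordered pairs in \<open>A \<times> A\<close>. At \<open>r = 0\<close>
  the kernel is the identity matrix, since a permutation is determined by its order relation, so the
  comparison with \<open>r = 0\<close> bounds the form below by a multiple of the sum of
  squares.\<close>

lemma order_kernel_pos_def:
  assumes "finite A" "0 \<le> r" "r \<le> 1"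
  shows "(1 - r) ^ (card A * card A) * (\<Sum>xs\<in>permutations_of_set A. (cmod (g xs))\<^sup>2)
    \<le> Re (\<Sum>xs\<in>permutations_of_set A. \<Sum>ys\<in>permutations_of_set A.
           of_real (order_kernel r A xs ys) * cnj (g xs) * g ys)"
proof -
  let ?t = "\<lambda>(i, j) xs. precedes xs i j" and ?P = "permutations_of_set A"
  have *: "order_kernel r A xs ys = (\<Prod>s\<in>A \<times> A. if ?t s xs = ?t s ys then 1 else r)"
    for r and xs ys :: "'a list"
    unfolding order_kernel_def prod.cartesian_product by (intro prod.cong) auto
  have z: "order_kernel 0 A xs ys = (if xs = ys then 1 else 0)"
    if xy: "xs \<in> ?P" "ys \<in> ?P" for xs ys
  proof (cases "xs = ys")
    case False
    have "distinct xs" "distinct ys" "set xs = A" "set ys = A"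
      using xy by (auto simp: permutations_of_set_def)
    then obtain i j where "i \<in> A" "j \<in> A" "precedes xs i j \<noteq> precedes ys i j"
      using precedes_determines[of xs ys] False by auto
    then have "(\<Prod>s\<in>A \<times> A. if ?t s xs = ?t s ys then 1 else 0 :: real) = 0"
      using assms(1) by (intro prod_zero bexI[of _ "(i, j)"]) auto
    then show ?thesis using False * by simp
  qed (simp add: order_kernel_def)
  have "test_form 0 ?t (A \<times> A) ?P g
     = (\<Sum>xs\<in>?P. \<Sum>ys\<in>?P. if xs = ys then of_real ((cmod (g xs))\<^sup>2) else 0)"
    unfolding test_form_def *[symmetric]
    by (intro sum.cong refl) (auto simp: z complex_norm_square mult.commute simp del: of_real_power)
  also have "\<dots> = of_real (\<Sum>xs\<in>?P. (cmod (g xs))\<^sup>2)"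
    by simp
  finally have "Re (test_form 0 ?t (A \<times> A) ?P g) = (\<Sum>xs\<in>?P. (cmod (g xs))\<^sup>2)"
    by simp
  moreover have "(1 - r) ^ card (A \<times> A) * Re (test_form 0 ?t (A \<times> A) ?P g)
      \<le> Re (test_form r ?t (A \<times> A) ?P g)"
    using assms by (intro test_form_lower_bound) auto
  ultimately show ?thesis
    unfolding test_form_def[of r] *[symmetric] by (simp add: card_cartesian_product)
qed

subsection \<open>The Gram matrix as an average over labelled words\<close>

lemma sum_permutations_of_set_insert:
  assumes "finite A" "x \<notin> A"
  shows "(\<Sum>ys\<in>permutations_of_set (insert x A). h ys)
       = (\<Sum>k\<le>card A. \<Sum>ys\<in>permutations_of_set A. h (take k ys @ x # drop k ys))"
proof -
  let ?i = "\<lambda>(k, ys). take k ys @ x # drop k ys"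
  have len: "length ys = card A" if "ys \<in> permutations_of_set A" for ys
    using that by (rule length_finite_permutations_of_set)
  have inj: "inj_on ?i ({..card A} \<times> permutations_of_set A)"
  proof (rule inj_onI, clarify)
    fix k ys l zs
    assume k: "k \<le> card A" "l \<le> card A" and p: "ys \<in> permutations_of_set A" "zs \<in> permutations_of_set A"
      and eq: "take k ys @ x # drop k ys = take l zs @ x # drop l zs"
    have "x \<notin> set ys" "x \<notin> set zs" using p assms by (auto simp: permutations_of_set_def)
    then have "x \<notin> set (take k ys)" "x \<notin> set (drop k ys)" "x \<notin> set (take l zs)" "x \<notin> set (drop l zs)"
      by (auto dest: in_set_takeD in_set_dropD)
    then have "take k ys = take l zs" "drop k ys = drop l zs"
      using eq by (simp_all add: append_Cons_eq_iff)
    moreover have "k = l"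
      using arg_cong[OF calculation(1), of length] k len[OF p(1)] len[OF p(2)] by simp
    ultimately show "k = l \<and> ys = zs"
      by (metis append_take_drop_id)
  qed
  have img: "?i ` ({..card A} \<times> permutations_of_set A) = permutations_of_set (insert x A)"
  proof (intro equalityI subsetI)
    fix ys assume "ys \<in> ?i ` ({..card A} \<times> permutations_of_set A)"
    then obtain k zs where k: "zs \<in> permutations_of_set A" "ys = take k zs @ x # drop k zs" by auto
    obtain us vs where uv: "take k zs = us" "drop k zs = vs" "zs = us @ vs"
      by (metis append_take_drop_id)
    show "ys \<in> permutations_of_set (insert x A)"
      using assms(2) k uv(3) unfolding k(2) uv(1,2) permutations_of_set_def by auto
  next
    fix ys assume ys: "ys \<in> permutations_of_set (insert x A)"
    then have "x \<in> set ys" by (auto simp: permutations_of_set_def)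
    then obtain us vs where uv: "ys = us @ x # vs" by (auto simp: in_set_conv_decomp)
    then have "us @ vs \<in> permutations_of_set A"
      using ys assms(2) by (auto simp: permutations_of_set_def)
    moreover from len[OF this] have "length us \<le> card A" by auto
    ultimately show "ys \<in> ?i ` ({..card A} \<times> permutations_of_set A)"
      using uv by (intro image_eqI[of _ _ "(length us, us @ vs)"]) auto
  qed
  show ?thesis
    unfolding img[symmetric] sum.reindex[OF inj] by (simp add: sum.cartesian_product o_def case_prod_unfold)
qed

text \<open>Unrolled completely, the recursion matches each letter of the first word with an equal
  letter of the second. With \<open>f\<close> assigning letters to labels, such a matching is an
  ordering \<open>ys\<close> of the labels that spells \<open>bs\<close>; the index \<open>k\<close>
  of one recursion step is the position of the label \<open>x\<close> in \<open>ys\<close>.\<close>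

lemma qgram_map:
  assumes "distinct xs" "length bs = length xs"
  shows "qgram (r\<^sup>2) (map f xs) bs = (\<Sum>ys\<in>permutations_of_set (set xs).
           if map f ys = bs then order_kernel r (set xs) xs ys else 0)"
  using assms
proof (induction xs arbitrary: bs)
  case Nil
  then show ?case by (auto simp: order_kernel_def)
next
  case (Cons x xs)
  let ?n = "length xs"
  have x: "x \<notin> set xs" "distinct xs" using Cons.prems by auto
  have card: "card (set xs) = ?n" using x by (simp add: distinct_card)
  have "(\<Sum>ys\<in>permutations_of_set (set (x # xs)).
           if map f ys = bs then order_kernel r (set (x # xs)) (x # xs) ys else 0)
      = (\<Sum>k\<le>?n. \<Sum>ys\<in>permutations_of_set (set xs).
           if map f (take k ys @ x # drop k ys) = bs
           then order_kernel r (insert x (set xs)) (x # xs) (take k ys @ x # drop k ys) else 0)"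
    unfolding list.set(2) using x by (simp add: sum_permutations_of_set_insert card)
  also have "\<dots> = (\<Sum>k\<le>?n. if bs ! k = f x
       then (r\<^sup>2) ^ k * qgram (r\<^sup>2) (map f xs) (take k bs @ drop (Suc k) bs) else 0)"
  proof (intro sum.cong refl)
    fix k assume "k \<in> {..?n}"
    then have k: "k \<le> ?n" "k < length bs" using Cons.prems by auto
    let ?bs = "take k bs @ drop (Suc k) bs"
    have bs: "bs = take k bs @ bs ! k # drop (Suc k) bs"
      using k by (simp add: id_take_nth_drop)
    have eq: "map f (take k ys @ x # drop k ys) = bs \<longleftrightarrow> bs ! k = f x \<and> map f ys = ?bs"
      (is "?L \<longleftrightarrow> ?R") if ys: "ys \<in> permutations_of_set (set xs)" for ys
    proof -
      have len: "length ys = ?n" using ys card length_finite_permutations_of_set by metis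
      have "?L \<longleftrightarrow> map f (take k ys) @ f x # map f (drop k ys) = take k bs @ bs ! k # drop (Suc k) bs"
        by (subst bs) (simp only: map_append list.map)
      also have "\<dots> \<longleftrightarrow> map f (take k ys) = take k bs \<and> bs ! k = f x \<and> map f (drop k ys) = drop (Suc k) bs"
        using len k by (auto simp: min_def)
      also have "\<dots> \<longleftrightarrow> bs ! k = f x \<and> map f (take k ys) @ map f (drop k ys) = ?bs"
        using len k by (auto simp: min_def)
      also have "map f (take k ys) @ map f (drop k ys) = map f ys"
        by (simp only: map_append[symmetric] append_take_drop_id)
      finally show ?thesis .
    qed
    have K: "order_kernel r (insert x (set xs)) (x # xs) (take k ys @ x # drop k ys)
        = (r\<^sup>2) ^ k * order_kernel r (set xs) xs ys" if ys: "ys \<in> permutations_of_set (set xs)" for ys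
    proof -
      have len: "length ys = ?n" using ys card length_finite_permutations_of_set by metis
      show ?thesis
        using order_kernel_insert[of x xs "take k ys" "drop k ys" r] x ys k len
        by (simp add: permutations_of_set_def min_def)
    qed
    have "(\<Sum>ys\<in>permutations_of_set (set xs).
           if map f (take k ys @ x # drop k ys) = bs
           then order_kernel r (insert x (set xs)) (x # xs) (take k ys @ x # drop k ys) else 0)
      = (\<Sum>ys\<in>permutations_of_set (set xs). if bs ! k = f x
          then (r\<^sup>2) ^ k * (if map f ys = ?bs then order_kernel r (set xs) xs ys else 0) else 0)"
      by (intro sum.cong refl) (simp only: eq K split: if_splits, auto)
    also have "\<dots> = (if bs ! k = f x then (r\<^sup>2) ^ k * qgram (r\<^sup>2) (map f xs) ?bs else 0)"
      using Cons.IH[of ?bs] x k Cons.prems by (simp add: sum_distrib_left)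
    finally show "(\<Sum>ys\<in>permutations_of_set (set xs).
           if map f (take k ys @ x # drop k ys) = bs
           then order_kernel r (insert x (set xs)) (x # xs) (take k ys @ x # drop k ys) else 0)
        = (if bs ! k = f x then (r\<^sup>2) ^ k * qgram (r\<^sup>2) (map f xs) ?bs else 0)" .
  qed
  also have "\<dots> = qgram (r\<^sup>2) (map f (x # xs)) bs"
    using Cons.prems by (simp add: lessThan_Suc_atMost)
  finally show ?case by simp
qed

lemma finite_words [simp]: "finite {w :: bool list. length w = n}"
  using finite_lists_length_eq[of "UNIV :: bool set" n] by simp

text \<open>For a fixed order \<open>xs\<close> of the labels, letter assignments and words are in
  bijection. The functions are extensional outside the labels so that this bijection is
  exact.\<close>

lemma sum_over_words:
  assumes xs: "xs \<in> permutations_of_set {..<n}"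
  shows "(\<Sum>f\<in>{..<n} \<rightarrow>\<^sub>E (UNIV :: bool set). h (map f xs)) = (\<Sum>w\<in>{w. length w = n}. h w)"
proof -
  have d: "distinct xs" "set xs = {..<n}" "length xs = n"
    using xs length_finite_permutations_of_set[OF xs] by (auto simp: permutations_of_set_def)
  have "bij_betw (\<lambda>f. map f xs) ({..<n} \<rightarrow>\<^sub>E (UNIV :: bool set)) {w. length w = n}"
    unfolding bij_betw_def
  proof
    show "inj_on (\<lambda>f. map f xs) ({..<n} \<rightarrow>\<^sub>E (UNIV :: bool set))"
    proof (rule inj_onI)
      fix f g :: "nat \<Rightarrow> bool"
      assume fg: "f \<in> {..<n} \<rightarrow>\<^sub>E UNIV" "g \<in> {..<n} \<rightarrow>\<^sub>E UNIV" "map f xs = map g xs"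
      show "f = g"
        using fg d by (intro PiE_ext[OF fg(1,2)]) auto
    qed
    show "(\<lambda>f. map f xs) ` ({..<n} \<rightarrow>\<^sub>E (UNIV :: bool set)) = {w. length w = n}"
    proof (intro equalityI subsetI)
      fix w :: "bool list" assume "w \<in> {w. length w = n}"
      then have w: "length w = length xs" using d by simp
      define f where "f = restrict (\<lambda>i. the (map_of (zip xs w) i)) {..<n}"
      have "map f xs ! k = w ! k" if "k < length xs" for k
      proof -
        have "xs ! k \<in> {..<n}" using that d nth_mem by blast
        moreover have "map_of (zip xs w) (xs ! k) = Some (w ! k)"
          using that d w by (intro map_of_is_SomeI) (auto simp: in_set_zip)
        ultimately show ?thesis using that by (simp add: f_def)
      qed
      then have "map f xs = w" using w by (intro nth_equalityI) auto
      then show "w \<in> (\<lambda>f. map f xs) ` ({..<n} \<rightarrow>\<^sub>E UNIV)"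
        by (intro image_eqI[of _ _ f]) (auto simp: f_def)
    next
      fix w assume "w \<in> (\<lambda>f. map f xs) ` ({..<n} \<rightarrow>\<^sub>E (UNIV :: bool set))"
      then have "length w = length xs" by force
      then show "w \<in> {w. length w = n}" using d(3) by simp
    qed
  qed
  from sum.reindex_bij_betw[OF this, of h] show ?thesis .
qed

text \<open>Each of the \<open>fact n\<close> orders \<open>xs\<close> runs through every word
  exactly once as \<open>f\<close> varies, whence the division. For fixed \<open>f\<close> the inner
  sum is a form of \<open>order_kernel\<close>, so positivity can be read off one \<open>f\<close>
  at a time.\<close>

lemma qip_deg_as_average:
  fixes r :: real
  shows "qip_deg (r\<^sup>2) u v n = 1 / fact n *
    (\<Sum>f\<in>{..<n} \<rightarrow>\<^sub>E (UNIV :: bool set). \<Sum>xs\<in>permutations_of_set {..<n}. \<Sum>ys\<in>permutations_of_set {..<n}.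
       of_real (order_kernel r {..<n} xs ys) * cnj (u (map f xs)) * v (map f ys))"
proof -
  let ?P = "permutations_of_set {..<n}" and ?F = "{..<n} \<rightarrow>\<^sub>E (UNIV :: bool set)"
  let ?W = "{w :: bool list. length w = n}"
  have inner: "(\<Sum>ys\<in>?P. of_real (order_kernel r {..<n} xs ys) * cnj (u (map f xs)) * v (map f ys))
     = (\<Sum>w'\<in>?W. cnj (u (map f xs)) * v w' * of_real (qgram (r\<^sup>2) (map f xs) w'))"
    if xs: "xs \<in> ?P" for xs and f :: "nat \<Rightarrow> bool"
  proof -
    have d: "distinct xs" "set xs = {..<n}" "length xs = n"
      using xs length_finite_permutations_of_set[OF xs] by (auto simp: permutations_of_set_def)
    have "(\<Sum>w'\<in>?W. cnj (u (map f xs)) * v w' * of_real (qgram (r\<^sup>2) (map f xs) w'))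
       = (\<Sum>w'\<in>?W. \<Sum>ys\<in>?P. if map f ys = w'
            then of_real (order_kernel r {..<n} xs ys) * cnj (u (map f xs)) * v w' else 0)"
    proof (intro sum.cong refl)
      fix w' assume "w' \<in> ?W"
      then have eq: "qgram (r\<^sup>2) (map f xs) w'
          = (\<Sum>ys\<in>?P. if map f ys = w' then order_kernel r {..<n} xs ys else 0)"
        using qgram_map[of xs w' r f] d(1,3) unfolding d(2) by simp
      show "cnj (u (map f xs)) * v w' * of_real (qgram (r\<^sup>2) (map f xs) w')
         = (\<Sum>ys\<in>?P. if map f ys = w'
            then of_real (order_kernel r {..<n} xs ys) * cnj (u (map f xs)) * v w' else 0)"
        unfolding eq of_real_sum sum_distrib_left by (intro sum.cong refl) simp
    qed
    also have "\<dots> = (\<Sum>ys\<in>?P. \<Sum>w'\<in>?W. if map f ys = w'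
            then of_real (order_kernel r {..<n} xs ys) * cnj (u (map f xs)) * v w' else 0)"
      by (rule sum.swap)
    also have "\<dots> = (\<Sum>ys\<in>?P. of_real (order_kernel r {..<n} xs ys) * cnj (u (map f xs)) * v (map f ys))"
      using length_finite_permutations_of_set[of _ "{..<n}"]
      by (intro sum.cong refl) (simp add: sum.delta')
    finally show ?thesis by (rule sym)
  qed
  have "(\<Sum>f\<in>?F. \<Sum>xs\<in>?P. \<Sum>ys\<in>?P.
       of_real (order_kernel r {..<n} xs ys) * cnj (u (map f xs)) * v (map f ys))
     = (\<Sum>f\<in>?F. \<Sum>xs\<in>?P. \<Sum>w'\<in>?W. cnj (u (map f xs)) * v w' * of_real (qgram (r\<^sup>2) (map f xs) w'))"
    by (intro sum.cong refl inner)
  also have "\<dots> = (\<Sum>xs\<in>?P. \<Sum>f\<in>?F. \<Sum>w'\<in>?W. cnj (u (map f xs)) * v w' * of_real (qgram (r\<^sup>2) (map f xs) w'))"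
    by (rule sum.swap)
  also have "\<dots> = (\<Sum>xs\<in>?P. qip_deg (r\<^sup>2) u v n)"
    unfolding qip_deg_def
    by (intro sum.cong refl sum_over_words[where h = "\<lambda>w. \<Sum>w'\<in>?W. cnj (u w) * v w' * of_real (qgram (r\<^sup>2) w w')"])
  also have "\<dots> = fact n * qip_deg (r\<^sup>2) u v n"
    by simp
  finally show ?thesis by simp
qed

text \<open>The recursion of \<open>qgram\<close> treats its two words differently and hides its
  symmetry; after averaging, it is the symmetry of \<open>order_kernel\<close>.\<close>

lemma qip_deg_hermitian:
  assumes "0 \<le> q"
  shows "qip_deg q v u n = cnj (qip_deg q u v n)"
proof -
  define r where "r = sqrt q"
  have q: "q = r\<^sup>2" using assms by (simp add: r_def)
  let ?P = "permutations_of_set {..<n}"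
  have "(\<Sum>xs\<in>?P. \<Sum>ys\<in>?P. of_real (order_kernel r {..<n} xs ys) * cnj (v (map f xs)) * u (map f ys))
      = cnj (\<Sum>xs\<in>?P. \<Sum>ys\<in>?P. of_real (order_kernel r {..<n} xs ys) * cnj (u (map f xs)) * v (map f ys))" for f
    unfolding cnj_sum
    by (subst sum.swap) (simp add: order_kernel_commute[of r "{..<n}"] mult_ac)
  then show ?thesis
    unfolding q qip_deg_as_average by simp
qed

text \<open>The constant found is \<open>(1 - sqrt q) ^ (n * n)\<close>. It depends on the degree,
  which suffices because each coefficient belongs to a single degree.\<close>

lemma qip_deg_pos_def:
  assumes "0 \<le> q" "q < 1"
  shows "\<exists>c>0. \<forall>u. c * (\<Sum>w\<in>{w. length w = n}. (cmod (u w))\<^sup>2) \<le> Re (qip_deg q u u n)"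
proof -
  define r where "r = sqrt q"
  have q: "q = r\<^sup>2" "0 \<le> r" "r < 1" using assms by (auto simp: r_def)
  let ?P = "permutations_of_set {..<n}" and ?F = "{..<n} \<rightarrow>\<^sub>E (UNIV :: bool set)"
  define c where "c = (1 - r) ^ (n * n)"
  have "c * (\<Sum>w\<in>{w. length w = n}. (cmod (u w))\<^sup>2) \<le> Re (qip_deg q u u n)" for u
  proof -
    have "(\<Sum>f\<in>?F. c * (\<Sum>xs\<in>?P. (cmod (u (map f xs)))\<^sup>2))
       \<le> (\<Sum>f\<in>?F. Re (\<Sum>xs\<in>?P. \<Sum>ys\<in>?P.
           of_real (order_kernel r {..<n} xs ys) * cnj (u (map f xs)) * u (map f ys)))"
      unfolding c_def using order_kernel_pos_def[of "{..<n}" r] q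
      by (intro sum_mono) simp
    also have "\<dots> = fact n * Re (qip_deg q u u n)"
    proof -
      have "Re (1 / fact n * z) = Re z / fact n" for z :: complex
      proof -
        have "1 / fact n * z = of_real (1 / fact n) * z" by simp
        then show ?thesis by (simp only: times_complex.sel Re_complex_of_real Im_complex_of_real) simp
      qed
      then show ?thesis
        unfolding q qip_deg_as_average by simp
    qed
    also have "(\<Sum>f\<in>?F. c * (\<Sum>xs\<in>?P. (cmod (u (map f xs)))\<^sup>2))
       = c * (\<Sum>xs\<in>?P. \<Sum>f\<in>?F. (cmod (u (map f xs)))\<^sup>2)"
      unfolding sum_distrib_left[symmetric] by (subst sum.swap) simp
    also have "\<dots> = c * (\<Sum>xs\<in>?P. \<Sum>w\<in>{w. length w = n}. (cmod (u w))\<^sup>2)"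
      by (intro arg_cong[where f = "(*) c"] sum.cong refl sum_over_words[where h = "\<lambda>w. (cmod (u w))\<^sup>2"])
    also have "\<dots> = fact n * (c * (\<Sum>w\<in>{w. length w = n}. (cmod (u w))\<^sup>2))"
      by simp
    finally show ?thesis by simp
  qed
  moreover have "c > 0" using q by (simp add: c_def)
  ultimately show ?thesis by blast
qed

subsection \<open>Moment functionals on a compact interval\<close>

text \<open>The factorial moment of a binomial distribution:
  \<open>(N choose k) * (k choose j)\<close> equals
  \<open>(N choose j) * ((N - j) choose (k - j))\<close>, and the binomial theorem sums the rest. It
  is stated over a ring because \<open>a\<close> and \<open>b\<close> will be the polynomials
  \<open>x\<close> and \<open>1 - x\<close>.\<close>

lemma bernstein_binomial_moment:
  fixes a b :: "'a :: comm_ring_1"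
  assumes "a + b = 1" "j \<le> N"
  shows "(\<Sum>k\<le>N. of_nat ((N choose k) * (k choose j)) * (a ^ k * b ^ (N - k)))
       = of_nat (N choose j) * a ^ j"
proof -
  have "(\<Sum>k\<le>N. of_nat ((N choose k) * (k choose j)) * (a ^ k * b ^ (N - k)))
     = (\<Sum>k\<in>{j..N}. of_nat ((N choose k) * (k choose j)) * (a ^ k * b ^ (N - k)))"
    by (intro sum.mono_neutral_right) (auto simp: not_le binomial_eq_0)
  also have "\<dots> = (\<Sum>i\<le>N - j. of_nat ((N choose (i + j)) * ((i + j) choose j)) * (a ^ (i + j) * b ^ (N - (i + j))))"
    using assms(2) by (intro sum.reindex_bij_witness[of _ "\<lambda>i. i + j" "\<lambda>k. k - j"]) auto
  also have "\<dots> = (\<Sum>i\<le>N - j. (of_nat (N choose j) * a ^ j) * (of_nat ((N - j) choose i) * a ^ i * b ^ (N - j - i)))"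
  proof (intro sum.cong refl)
    fix i assume "i \<in> {..N - j}"
    then have "(N choose (i + j)) * ((i + j) choose j) = (N choose j) * ((N - j) choose i)"
      using choose_mult[of j "i + j" N] assms(2) by simp
    then show "of_nat ((N choose (i + j)) * ((i + j) choose j)) * (a ^ (i + j) * b ^ (N - (i + j)))
       = (of_nat (N choose j) * a ^ j) * (of_nat ((N - j) choose i) * a ^ i * b ^ (N - j - i))"
      by (simp only: of_nat_mult power_add add.commute[of i j] diff_diff_left[symmetric]) (simp add: mult_ac)
  qed
  also have "\<dots> = of_nat (N choose j) * a ^ j * (a + b) ^ (N - j)"
    by (simp only: sum_distrib_left[symmetric] binomial_ring)
  finally show ?thesis using assms(1) by simp
qed

text \<open>Both terms are products of \<open>j\<close> factors in the unit interval,
  \<open>(k - i) / (N - i)\<close> against \<open>k / N\<close>, and corresponding factors differ by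
  at most \<open>j / N\<close>. For \<open>j > k\<close> the truncated subtraction supplies the zero
  factor that the vanishing binomial coefficient requires.\<close>

lemma binomial_ratio_approx:
  assumes "k \<le> N" "j \<le> N" "0 < N"
  shows "\<bar>real (k choose j) / real (N choose j) - (real k / real N) ^ j\<bar> \<le> real (j * j) / real N"
proof -
  have ratio: "real (k choose j) / real (N choose j) = (\<Prod>i<j. real (k - i) / real (N - i))"
  proof (cases "j \<le> k")
    case True
    have "real (k choose j) / real (N choose j)
       = (\<Prod>i<j. real (k - i) / real (j - i)) / (\<Prod>i<j. real (N - i) / real (j - i))"
      using True assms(2) by (simp only: binomial_altdef_of_nat atLeast0LessThan)
    also have "\<dots> = (\<Prod>i<j. (real (k - i) / real (j - i)) / (real (N - i) / real (j - i)))"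
      by (rule prod_dividef[symmetric])
    also have "\<dots> = (\<Prod>i<j. real (k - i) / real (N - i))"
      by (intro prod.cong refl) auto
    finally show ?thesis .
  next
    case False
    then have "(\<Prod>i<j. real (k - i) / real (N - i)) = 0"
      by (intro prod_zero bexI[of _ k]) auto
    then show ?thesis using False by (simp add: binomial_eq_0)
  qed
  have "norm ((\<Prod>i<j. real (k - i) / real (N - i)) - (\<Prod>i<j. real k / real N))
     \<le> (\<Sum>i<j. norm (real (k - i) / real (N - i) - real k / real N))"
    using assms by (intro norm_prod_diff) (auto simp: divide_le_eq)
  also have "\<dots> \<le> (\<Sum>i<j. real j / real N)"
  proof (intro sum_mono)
    fix i assume i: "i \<in> {..<j}"
    have N: "real N > 0" "real (N - i) > 0" using assms i by auto
    show "norm (real (k - i) / real (N - i) - real k / real N) \<le> real j / real N"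
    proof (cases "i \<le> k")
      case True
      have e: "real (k - i) / real (N - i) - real k / real N
          = - (real i / real N) * (real (N - k) / real (N - i))"
        using N True assms i by (simp add: field_simps of_nat_diff)
      have "real (N - k) / real (N - i) \<le> 1" using True N by simp
      then have "norm (- (real i / real N) * (real (N - k) / real (N - i))) \<le> real i / real N * 1"
        unfolding norm_mult by (intro mult_mono) auto
      also have "\<dots> \<le> real j / real N" using i N by (simp add: divide_right_mono)
      finally show ?thesis unfolding e .
    next
      case False
      then have "real k / real N \<le> real j / real N" using i by (intro divide_right_mono) auto
      then show ?thesis using False by simp
    qed
  qed
  also have "\<dots> = real (j * j) / real N" by simp
  finally show ?thesis unfolding ratio by simp
qed

locale linear_functional =
  fixes L :: "real poly \<Rightarrow> real"
  assumes add: "L (p + q) = L p + L q" and smult: "L (smult c p) = c * L p"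
begin

lemma zero: "L 0 = 0"
  using smult[of 0 0] by simp

lemma sum: "L (\<Sum>i\<in>A. p i) = (\<Sum>i\<in>A. L (p i))"
  by (induction A rule: infinite_finite_induct) (simp_all add: zero add)

lemma expand: "L p = (\<Sum>i\<le>degree p. coeff p i * L ([:0, 1:] ^ i))"
proof -
  have "L p = L (\<Sum>i\<le>degree p. smult (coeff p i) ([:0, 1:] ^ i))"
    by (simp only: monom_altdef[symmetric] poly_as_sum_of_monoms)
  then show ?thesis by (simp only: sum smult)
qed

end

text \<open>The solution is a weak limit of the discrete measures with the Bernstein weights
  \<open>(N choose k) * L (x ^ k * (1 - x) ^ (N - k))\<close> at the points \<open>k / N\<close>.\<close>

lemma (in linear_functional) hausdorff_moment_prob:
  assumes pos: "\<And>k l. 0 \<le> L ([:0, 1:] ^ k * [:1, -1:] ^ l)" and L1: "L 1 = 1"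
  shows "\<exists>\<mu>. real_distribution \<mu> \<and> (\<forall>n. integrable \<mu> (\<lambda>t. t ^ n) \<and> (\<integral>t. t ^ n \<partial>\<mu>) = L ([:0, 1:] ^ n))"
proof -
  define w where "w N k = (if k \<le> N then real (N choose k) * L ([:0, 1:] ^ k * [:1, -1:] ^ (N - k)) else 0)"
    for N k :: nat
  have w_nonneg: "0 \<le> w N k" for N k
    using pos by (simp add: w_def)
  have smult_of_nat: "smult (real n) p = of_nat n * p" for n and p :: "real poly"
    by (simp add: of_nat_poly)
  \<comment> \<open>Against the Bernstein weights the ratios of binomial coefficients integrate
    exactly to the moments of \<open>L\<close>; only their replacement by \<open>(k / N) ^ j\<close>
    costs an error.\<close>
  have falling: "(\<Sum>k\<le>N. w N k * (real (k choose j) / real (N choose j))) = L ([:0, 1:] ^ j)"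
    if "j \<le> N" for j N
  proof -
    have "(\<Sum>k\<le>N. w N k * real (k choose j))
      = L (\<Sum>k\<le>N. of_nat ((N choose k) * (k choose j)) * ([:0, 1:] ^ k * [:1, -1:] ^ (N - k)))"
      unfolding sum by (intro sum.cong refl)
        (simp only: smult_of_nat[symmetric] smult, simp add: w_def)
    also have "\<dots> = L (of_nat (N choose j) * [:0, 1:] ^ j)"
      using that by (subst bernstein_binomial_moment) (auto simp: one_pCons)
    also have "\<dots> = real (N choose j) * L ([:0, 1:] ^ j)"
      by (simp only: smult_of_nat[symmetric] smult)
    finally show ?thesis
      using that by (simp add: sum_divide_distrib[symmetric])
  qed
  have w_sum: "(\<Sum>k\<le>N. w N k) = 1" for N
    using falling[of 0 N] L1 by simp
  define P where "P N = embed_pmf (w N)" for N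
  have pmf_P: "pmf (P N) k = w N k" and set_P: "set_pmf (P N) \<subseteq> {..N}" for N k
  proof -
    have "(\<integral>\<^sup>+x. ennreal (w N x) \<partial>count_space UNIV) = (\<integral>\<^sup>+x. ennreal (w N x) \<partial>count_space {..N})"
      by (intro nn_integral_count_space_eq) (auto simp: w_def)
    also have "\<dots> = ennreal (\<Sum>k\<le>N. w N k)"
      by (simp add: nn_integral_count_space_finite w_nonneg)
    finally have nn: "(\<integral>\<^sup>+x. ennreal (w N x) \<partial>count_space UNIV) = 1"
      by (simp add: w_sum)
    show "pmf (P N) k = w N k"
      unfolding P_def using w_nonneg nn by (rule pmf_embed_pmf)
    show "set_pmf (P N) \<subseteq> {..N}"
      unfolding P_def set_embed_pmf[OF w_nonneg nn] by (auto simp: w_def)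
  qed
  define \<mu> where "\<mu> N = distr (measure_pmf (P N)) borel (\<lambda>k. real k / real N)" for N
  have rd: "real_distribution (\<mu> N)" for N
  proof -
    interpret prob_space "\<mu> N"
      unfolding \<mu>_def by (intro measure_pmf.prob_space_distr) simp
    show ?thesis
      by unfold_locales (simp_all add: \<mu>_def)
  qed
  have ratio: "real k / real N \<in> {0..1}" if "k \<in> set_pmf (P N)" for k N
    using that set_P[of N] by (cases "N = 0") (auto simp: divide_le_eq)
  have "tight \<mu>"
    unfolding tight_def
  proof (intro conjI allI impI rd)
    fix \<epsilon> :: real assume "\<epsilon> > 0"
    have "measure (\<mu> N) {-1<..1} = 1" for N
    proof -
      have "measure (\<mu> N) {-1<..1} = measure (measure_pmf (P N)) {k. real k / real N \<in> {-1<..1}}"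
        unfolding \<mu>_def by (subst measure_distr) (auto simp: vimage_def)
      also have "\<dots> = 1"
      proof (subst measure_pmf.prob_eq_1)
        have "real k / real N \<in> {-1<..1}" if "k \<in> set_pmf (P N)" for k
          using ratio[OF that] unfolding atLeastAtMost_iff greaterThanAtMost_iff by linarith
        then show "AE k in measure_pmf (P N). k \<in> {k. real k / real N \<in> {-1<..1}}"
          by (simp add: AE_measure_pmf_iff)
      qed simp
      finally show ?thesis .
    qed
    with \<open>\<epsilon> > 0\<close> show "\<exists>a b. a < b \<and> (\<forall>n. 1 - \<epsilon> < measure (\<mu> n) {a<..b})"
      by (intro exI[of _ "-1"] exI[of _ 1]) auto
  qed
  from tight_imp_convergent_subsubsequence[OF this strict_mono_id] obtain r M where
    r: "strict_mono r" and M: "real_distribution M" and conv: "weak_conv_m (\<mu> \<circ> id \<circ> r) M"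
    by blast
  interpret M: real_distribution M by (rule M)
  \<comment> \<open>Truncation to \<open>[0, 1]\<close> turns powers into bounded continuous
    functions, to which weak convergence applies, and fixes the atoms \<open>k / N\<close>. The
    image of \<open>M\<close> under \<open>clamp\<close> is then the required measure.\<close>
  define clamp where "clamp t = max 0 (min 1 t)" for t :: real
  have clamp_cont: "continuous_on UNIV clamp"
    unfolding clamp_def[abs_def] by (intro continuous_intros)
  then have [measurable]: "clamp \<in> borel_measurable borel"
    by (rule borel_measurable_continuous_onI)
  have clamp_le: "norm (clamp t ^ j) \<le> 1" for t j
    unfolding norm_power by (intro power_le_one) (auto simp: clamp_def)
  have moment: "(\<integral>t. clamp t ^ j \<partial>M) = L ([:0, 1:] ^ j)" for j
  proof (rule LIMSEQ_unique)
    have "(\<lambda>n. integral\<^sup>L ((\<mu> \<circ> id \<circ> r) n) (\<lambda>t. clamp t ^ j)) \<longlonglongrightarrow> integral\<^sup>L M (\<lambda>t. clamp t ^ j)"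
    proof (rule weak_conv_imp_integral_bdd_continuous_conv[OF _ M conv _ clamp_le])
      show "real_distribution ((\<mu> \<circ> id \<circ> r) n)" for n using rd by simp
      show "isCont (\<lambda>t. clamp t ^ j) x" for x
        using clamp_cont by (intro continuous_intros) (auto simp: continuous_on_eq_continuous_at)
    qed
    then show "(\<lambda>n. \<integral>t. clamp t ^ j \<partial>(\<mu> (r n))) \<longlonglongrightarrow> (\<integral>t. clamp t ^ j \<partial>M)" by simp
    have "(\<lambda>N. (\<integral>t. clamp t ^ j \<partial>(\<mu> N))) \<longlonglongrightarrow> L ([:0, 1:] ^ j)"
    proof (rule LIM_zero_cancel, rule Lim_null_comparison)
      show "(\<lambda>N. real (j * j) / real N) \<longlonglongrightarrow> 0"
        by (rule lim_const_over_n)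
      have "norm ((\<integral>t. clamp t ^ j \<partial>(\<mu> N)) - L ([:0, 1:] ^ j)) \<le> real (j * j) / real N"
        if N: "N \<ge> Suc j" for N
      proof -
        have "(\<integral>t. clamp t ^ j \<partial>(\<mu> N)) = (\<integral>k. clamp (real k / real N) ^ j \<partial>(measure_pmf (P N)))"
          unfolding \<mu>_def by (subst integral_distr) auto
        also have "\<dots> = (\<Sum>k\<le>N. clamp (real k / real N) ^ j * w N k)"
          using set_P[of N] by (subst integral_measure_pmf_real[of "{..N}"]) (auto simp: pmf_P)
        also have "\<dots> = (\<Sum>k\<le>N. w N k * (real k / real N) ^ j)"
          using N by (intro sum.cong refl) (auto simp: clamp_def max_def min_def divide_le_eq)
        finally have "norm ((\<integral>t. clamp t ^ j \<partial>(\<mu> N)) - L ([:0, 1:] ^ j))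
          = norm (\<Sum>k\<le>N. w N k * ((real k / real N) ^ j - real (k choose j) / real (N choose j)))"
          using N falling[of j N] by (simp add: sum_subtractf right_diff_distrib)
        also have "\<dots> \<le> (\<Sum>k\<le>N. w N k * (real (j * j) / real N))"
        proof (rule sum_norm_le)
          fix k assume "k \<in> {..N}"
          then have "\<bar>real (k choose j) / real (N choose j) - (real k / real N) ^ j\<bar> \<le> real (j * j) / real N"
            using N by (intro binomial_ratio_approx) auto
          then show "norm (w N k * ((real k / real N) ^ j - real (k choose j) / real (N choose j)))
             \<le> w N k * (real (j * j) / real N)"
            unfolding norm_mult using w_nonneg[of N k]
            by (intro mult_mono) (auto simp: abs_minus_commute)
        qed
        also have "\<dots> = real (j * j) / real N"
          by (simp only: sum_distrib_right[symmetric] w_sum mult_1)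
        finally show ?thesis .
      qed
      then show "\<forall>\<^sub>F N in sequentially. norm ((\<integral>t. clamp t ^ j \<partial>(\<mu> N)) - L ([:0, 1:] ^ j)) \<le> real (j * j) / real N"
        by (intro eventually_sequentiallyI)
    qed
    from LIMSEQ_subseq_LIMSEQ[OF this r]
    show "(\<lambda>n. \<integral>t. clamp t ^ j \<partial>(\<mu> (r n))) \<longlonglongrightarrow> L ([:0, 1:] ^ j)"
      by (simp add: o_def)
  qed
  have int: "integrable M (\<lambda>t. clamp t ^ j)" for j
    by (rule M.integrable_const_bound[of _ 1]) (use clamp_le in auto)
  have "real_distribution (distr M borel clamp)"
    using M.prob_space_distr[of clamp borel]
    by (simp add: real_distribution_def real_distribution_axioms_def)
  moreover have "integrable (distr M borel clamp) (\<lambda>t. t ^ n)" for n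
    using int by (subst integrable_distr_eq) auto
  moreover have "(\<integral>t. t ^ n \<partial>(distr M borel clamp)) = L ([:0, 1:] ^ n)" for n
    using moment by (subst integral_distr) auto
  ultimately show ?thesis by blast
qed

text \<open>If \<open>L 1 > 0\<close>, normalise. If \<open>L 1 = 0\<close>, then all moments
  vanish, because positivity on \<open>x ^ n * (1 - x)\<close> makes the moments decrease, and the
  zero measure represents \<open>L\<close>.\<close>

lemma (in linear_functional) hausdorff_moment:
  assumes pos: "\<And>k l. 0 \<le> L ([:0, 1:] ^ k * [:1, -1:] ^ l)"
  shows "\<exists>\<mu>. sets \<mu> = sets borel \<and> finite_measure \<mu> \<and>
    (\<forall>p. integrable \<mu> (poly p) \<and> (\<integral>t. poly p t \<partial>\<mu>) = L p)"
proof -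
  have powers: "\<exists>\<mu>. sets \<mu> = sets borel \<and> finite_measure \<mu> \<and>
    (\<forall>n. integrable \<mu> (\<lambda>t. t ^ n) \<and> (\<integral>t. t ^ n \<partial>\<mu>) = L ([:0, 1:] ^ n))"
  proof (cases "L 1 = 0")
    case True
    have "L ([:0, 1:] ^ n) = 0" for n
    proof (induction n)
      case 0
      then show ?case using True by simp
    next
      case (Suc n)
      have "[:0, 1:] ^ n = [:0, 1:] ^ Suc n + [:0, 1:] ^ n * [:1, -1::real:] ^ 1"
        by (simp add: algebra_simps flip: one_pCons)
      then have "L ([:0, 1:] ^ n) = L ([:0, 1:] ^ Suc n) + L ([:0, 1:] ^ n * [:1, -1:] ^ 1)"
        by (metis add)
      then show ?case
        using pos[of n 1] pos[of "Suc n" 0] Suc.IH by simp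
    qed
    then show ?thesis
      by (intro exI[of _ "null_measure borel"]) (auto intro!: finite_measureI)
  next
    case False
    then have pos1: "L 1 > 0" using pos[of 0 0] by simp
    interpret L': linear_functional "\<lambda>p. L p / L 1"
      by unfold_locales (simp_all add: add smult add_divide_distrib)
    have "\<And>k l. 0 \<le> L ([:0, 1:] ^ k * [:1, -1:] ^ l) / L 1" "L 1 / L 1 = 1"
      using pos pos1 by auto
    from L'.hausdorff_moment_prob[OF this] obtain \<nu> where \<nu>: "real_distribution \<nu>"
      "\<And>n. integrable \<nu> (\<lambda>t. t ^ n)" "\<And>n. (\<integral>t. t ^ n \<partial>\<nu>) = L ([:0, 1:] ^ n) / L 1" by blast
    interpret \<nu>: real_distribution \<nu> by (rule \<nu>(1))
    let ?\<mu> = "density \<nu> (\<lambda>_. ennreal (L 1))"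
    have "finite_measure ?\<mu>"
      by (intro finite_measureI) (simp add: emeasure_density nn_integral_cmult_indicator
        \<nu>.emeasure_eq_measure ennreal_mult_eq_top_iff)
    moreover have "integrable ?\<mu> (\<lambda>t. t ^ n)" for n
      using \<nu>(2) pos1 by (subst integrable_density) auto
    moreover have "(\<integral>t. t ^ n \<partial>?\<mu>) = L ([:0, 1:] ^ n)" for n
      using \<nu>(3) pos1 by (subst integral_density) auto
    ultimately show ?thesis
      by (intro exI[of _ ?\<mu>]) simp
  qed
  then obtain \<mu> where \<mu>: "sets \<mu> = sets borel" "finite_measure \<mu>"
    "\<And>n. integrable \<mu> (\<lambda>t. t ^ n)" "\<And>n. (\<integral>t. t ^ n \<partial>\<mu>) = L ([:0, 1:] ^ n)" by blast
  have "integrable \<mu> (poly p)" for p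
    unfolding poly_altdef[abs_def] by (intro Bochner_Integration.integrable_sum integrable_mult_right \<mu>)
  moreover have "(\<integral>t. poly p t \<partial>\<mu>) = L p" for p
    unfolding poly_altdef expand[of p]
    by (subst Bochner_Integration.integral_sum) (auto intro!: \<mu> integrable_mult_right simp: \<mu>(4))
  ultimately show ?thesis using \<mu>(1,2) by blast
qed

lemma pcompose_power: "pcompose (p ^ n) q = pcompose p q ^ n"
  for p q :: "'a :: comm_semiring_1 poly"
  by (induction n) (simp_all add: pcompose_1 pcompose_mult)

text \<open>Affine transport of the unit interval: \<open>h\<close> carries \<open>[-R, R]\<close>
  onto \<open>[0, 1]\<close> and \<open>g\<close> is its inverse. Under \<open>h\<close> the
  Bernstein products become positive multiples of \<open>(R + t) ^ k * (R - t) ^ l\<close>.\<close>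

lemma (in linear_functional) interval_moment:
  assumes R: "0 < R" and pos: "\<And>k l. 0 \<le> L ([:R, 1:] ^ k * [:R, -1:] ^ l)"
  shows "\<exists>\<mu>. sets \<mu> = sets borel \<and> finite_measure \<mu> \<and>
    (\<forall>p. integrable \<mu> (poly p) \<and> (\<integral>t. poly p t \<partial>\<mu>) = L p)"
proof -
  define h where "h = [:1 / 2, 1 / (2 * R):]"
  define g where "g = [:- R, 2 * R:]"
  have gh: "pcompose g h = [:0, 1:]"
    using R by (simp add: g_def h_def pcompose_pCons)
  interpret L': linear_functional "\<lambda>p. L (pcompose p h)"
    by unfold_locales (simp_all add: add smult pcompose_add pcompose_smult)
  have "0 \<le> L (pcompose ([:0, 1:] ^ k * [:1, -1:] ^ l) h)" for k l
  proof -
    have 1: "pcompose [:0, 1:] h = smult (1 / (2 * R)) [:R, 1:]"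
      and 2: "pcompose [:1, -1:] h = smult (1 / (2 * R)) [:R, -1:]"
      using R by (auto simp: h_def pcompose_pCons field_simps)
    have "pcompose ([:0, 1:] ^ k * [:1, -1:] ^ l) h
      = smult ((1 / (2 * R)) ^ k * (1 / (2 * R)) ^ l) ([:R, 1:] ^ k * [:R, -1:] ^ l)"
      unfolding pcompose_mult pcompose_power 1 2 smult_power mult_smult_left mult_smult_right smult_smult
      by (simp only: mult.commute)
    then show ?thesis
      using R pos[of k l] by (simp only: smult) simp
  qed
  from L'.hausdorff_moment[OF this] obtain \<nu> where \<nu>: "sets \<nu> = sets borel" "finite_measure \<nu>"
    "\<And>p. integrable \<nu> (poly p)" "\<And>p. (\<integral>t. poly p t \<partial>\<nu>) = L (pcompose p h)" by blast
  have [measurable]: "poly g \<in> borel_measurable \<nu>" "poly p \<in> borel_measurable borel" for p :: "real poly"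
    using \<nu>(3) by (auto intro!: borel_measurable_continuous_onI continuous_intros)
  have "finite_measure (distr \<nu> borel (poly g))"
    by (intro finite_measure.finite_measure_distr \<nu>) simp
  moreover have "integrable (distr \<nu> borel (poly g)) (poly p)" for p
    using \<nu>(3)[of "pcompose p g"] by (subst integrable_distr_eq) (auto simp: poly_pcompose[abs_def])
  moreover have "(\<integral>t. poly p t \<partial>distr \<nu> borel (poly g)) = L p" for p
  proof -
    have "(\<integral>t. poly p t \<partial>distr \<nu> borel (poly g)) = (\<integral>t. poly (pcompose p g) t \<partial>\<nu>)"
      by (subst integral_distr) (auto simp: poly_pcompose[abs_def])
    also have "\<dots> = L (pcompose p (pcompose g h))"
      by (simp only: \<nu>(4) pcompose_assoc)
    finally show ?thesis by (simp add: gh pcompose_idR)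
  qed
  ultimately show ?thesis by (intro exI[of _ "distr \<nu> borel (poly g)"]) simp
qed

subsection \<open>Bounded symmetric operators and their spectral measures\<close>

definition lincomb :: "complex \<Rightarrow> ('i \<Rightarrow> complex) \<Rightarrow> complex \<Rightarrow> ('i \<Rightarrow> complex) \<Rightarrow> 'i \<Rightarrow> complex" where
  "lincomb a u b v = (\<lambda>w. a * u w + b * v w)"

text \<open>Definiteness is left out on purpose: the form in a single degree is also an instance,
  and it vanishes on vectors supported in other degrees.\<close>

locale ip_space =
  fixes V :: "('i \<Rightarrow> complex) set" and ip :: "('i \<Rightarrow> complex) \<Rightarrow> ('i \<Rightarrow> complex) \<Rightarrow> complex"
  assumes zero_in: "(\<lambda>_. 0) \<in> V"
    and lincomb_in: "u \<in> V \<Longrightarrow> v \<in> V \<Longrightarrow> lincomb a u b v \<in> V"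
    and ip_lincomb_right: "z \<in> V \<Longrightarrow> u \<in> V \<Longrightarrow> v \<in> V \<Longrightarrow>
      ip z (lincomb a u b v) = a * ip z u + b * ip z v"
    and ip_cnj: "u \<in> V \<Longrightarrow> v \<in> V \<Longrightarrow> ip v u = cnj (ip u v)"
    and ip_nonneg: "u \<in> V \<Longrightarrow> 0 \<le> Re (ip u u)"
begin

definition nsq :: "('i \<Rightarrow> complex) \<Rightarrow> real" where
  "nsq u = Re (ip u u)"

lemma nsq_nonneg: "u \<in> V \<Longrightarrow> 0 \<le> nsq u"
  by (simp add: nsq_def ip_nonneg)

lemma ip_self: "u \<in> V \<Longrightarrow> ip u u = of_real (nsq u)"
  using ip_cnj[of u u] by (simp add: nsq_def complex_eq_iff)

lemma ip_lincomb_left: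
  "z \<in> V \<Longrightarrow> u \<in> V \<Longrightarrow> v \<in> V \<Longrightarrow> ip (lincomb a u b v) z = cnj a * ip u z + cnj b * ip v z"
  using ip_cnj[of z "lincomb a u b v"] ip_cnj[of z u] ip_cnj[of z v]
  by (simp add: lincomb_in ip_lincomb_right)

lemma nsq_lincomb:
  assumes "u \<in> V" "v \<in> V"
  shows "nsq (lincomb a u b v)
       = (cmod a)\<^sup>2 * nsq u + (cmod b)\<^sup>2 * nsq v + 2 * Re (cnj a * b * ip u v)"
proof -
  have "ip (lincomb a u b v) (lincomb a u b v)
      = cnj a * a * of_real (nsq u) + cnj b * b * of_real (nsq v)
        + (cnj a * b * ip u v + cnj (cnj a * b * ip u v))"
    using assms ip_cnj[of u v]
    by (simp add: lincomb_in ip_lincomb_right ip_lincomb_left ip_self[OF assms(1)]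
      ip_self[OF assms(2)] algebra_simps)
  also have "cnj a * a = of_real ((cmod a)\<^sup>2)"
    by (simp only: complex_norm_square mult.commute)
  also have "cnj b * b = of_real ((cmod b)\<^sup>2)"
    by (simp only: complex_norm_square mult.commute)
  finally show ?thesis
    by (simp only: nsq_def[of "lincomb a u b v"] complex_add_cnj) (simp del: of_real_power)
qed

lemma Cauchy_Schwarz:
  assumes "u \<in> V" "v \<in> V"
  shows "(cmod (ip u v))\<^sup>2 \<le> nsq u * nsq v"
proof -
  have vu: "ip v u * ip u v = of_real ((cmod (ip u v))\<^sup>2)"
    using ip_cnj[OF assms] by (simp only: complex_norm_square mult.commute)
  have cvu: "cmod (ip v u) = cmod (ip u v)"
    using ip_cnj[OF assms] by simp
  show ?thesis
  proof (cases "nsq v = 0")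
    case True
    have "ip u v = 0"
    proof (rule ccontr)
      assume "ip u v \<noteq> 0"
      then have pos: "(cmod (ip u v))\<^sup>2 > 0" by simp
      \<comment> \<open>Chosen so that the squared norm computed below would be
        \<open>- 1\<close>.\<close>
      define t where "t = - (nsq u + 1) / (2 * (cmod (ip u v))\<^sup>2)"
      have "0 \<le> nsq (lincomb 1 u (of_real t * ip v u) v)"
        using assms by (intro nsq_nonneg lincomb_in)
      also have "\<dots> = nsq u + 2 * Re (of_real t * (ip v u * ip u v))"
        using assms True by (simp add: nsq_lincomb mult.assoc)
      also have "\<dots> = nsq u + 2 * t * (cmod (ip u v))\<^sup>2"
        unfolding vu by simp
      also have "\<dots> = - 1" using pos by (simp add: t_def field_simps)
      finally show False by simp
    qed
    then show ?thesis using True by simp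
  next
    case False
    then have pos: "nsq v > 0" using nsq_nonneg[OF assms(2)] by simp
    \<comment> \<open>This vector is \<open>nsq v\<close> times the component of \<open>u\<close>
      orthogonal to \<open>v\<close>.\<close>
    have "0 \<le> nsq (lincomb (of_real (nsq v)) u (- ip v u) v)"
      using assms by (intro nsq_nonneg lincomb_in)
    also have "\<dots> = (nsq v)\<^sup>2 * nsq u + (cmod (ip u v))\<^sup>2 * nsq v
        - 2 * Re (of_real (nsq v) * (ip v u * ip u v))"
      using assms by (simp add: nsq_lincomb cvu mult.assoc)
    also have "\<dots> = nsq v * (nsq u * nsq v - (cmod (ip u v))\<^sup>2)"
      unfolding vu by (simp add: algebra_simps power2_eq_square)
    finally show ?thesis using pos by (simp add: zero_le_mult_iff)
  qed
qed

text \<open>Parallelogram law: the squared norm of \<open>a u - b v\<close> is added and is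
  nonnegative.\<close>

lemma nsq_lincomb_le:
  assumes "u \<in> V" "v \<in> V"
  shows "nsq (lincomb a u b v) \<le> 2 * (cmod a)\<^sup>2 * nsq u + 2 * (cmod b)\<^sup>2 * nsq v"
proof -
  have "Re (cnj a * (- b) * ip u v) = - Re (cnj a * b * ip u v)" by simp
  then show ?thesis
    using nsq_lincomb[OF assms, of a b] nsq_lincomb[OF assms, of a "- b"]
      nsq_nonneg[OF lincomb_in[OF assms, of a "- b"]]
    unfolding norm_minus_cancel by linarith
qed

definition nconv :: "(nat \<Rightarrow> 'i \<Rightarrow> complex) \<Rightarrow> ('i \<Rightarrow> complex) \<Rightarrow> bool" where
  "nconv s v \<longleftrightarrow> (\<forall>n. s n \<in> V) \<and> v \<in> V \<and> (\<lambda>n. nsq (lincomb 1 (s n) (-1) v)) \<longlonglongrightarrow> 0"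

lemma nconv_const: "v \<in> V \<Longrightarrow> nconv (\<lambda>_. v) v"
  unfolding nconv_def by (simp add: nsq_lincomb ip_self)

lemma nconv_ip:
  assumes "nconv s u" "nconv t v"
  shows "(\<lambda>n. ip (s n) (t n)) \<longlonglongrightarrow> ip u v"
proof (rule LIM_zero_cancel, rule Lim_null_comparison)
  let ?a = "\<lambda>n. nsq (lincomb 1 (s n) (-1) u)" and ?b = "\<lambda>n. nsq (lincomb 1 (t n) (-1) v)"
  have V: "\<And>n. s n \<in> V" "u \<in> V" "\<And>n. t n \<in> V" "v \<in> V"
    and lims: "?a \<longlonglongrightarrow> 0" "?b \<longlonglongrightarrow> 0"
    using assms by (auto simp: nconv_def)
  have "norm (ip (s n) (t n) - ip u v)
      \<le> sqrt (?a n * (2 * ?b n + 2 * nsq v)) + sqrt (nsq u * ?b n)" for n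
  proof -
    let ?x = "lincomb 1 (s n) (-1) u" and ?y = "lincomb 1 (t n) (-1) v"
    have xy: "?x \<in> V" "?y \<in> V" using V by (auto intro: lincomb_in)
    have "ip (s n) (t n) - ip u v = ip ?x (t n) + ip u ?y"
      using V by (simp add: ip_lincomb_left ip_lincomb_right)
    then have "norm (ip (s n) (t n) - ip u v) \<le> cmod (ip ?x (t n)) + cmod (ip u ?y)"
      by (simp add: norm_triangle_ineq)
    moreover have "nsq (t n) \<le> 2 * ?b n + 2 * nsq v"
    proof -
      have "t n = lincomb 1 ?y 1 v" by (simp add: lincomb_def)
      then show ?thesis using nsq_lincomb_le[OF xy(2) V(4), of 1 1] by simp
    qed
    then have "cmod (ip ?x (t n)) \<le> sqrt (?a n * (2 * ?b n + 2 * nsq v))"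
      using Cauchy_Schwarz[OF xy(1) V(3)[of n]] nsq_nonneg[OF xy(1)]
      by (intro real_le_rsqrt order_trans[OF Cauchy_Schwarz[OF xy(1) V(3)]] mult_left_mono) auto
    moreover have "cmod (ip u ?y) \<le> sqrt (nsq u * ?b n)"
      using Cauchy_Schwarz[OF V(2) xy(2)] by (intro real_le_rsqrt)
    ultimately show ?thesis by linarith
  qed
  then show "\<forall>\<^sub>F n in sequentially. norm (ip (s n) (t n) - ip u v)
      \<le> sqrt (?a n * (2 * ?b n + 2 * nsq v)) + sqrt (nsq u * ?b n)"
    by simp
  have "(\<lambda>n. sqrt (?a n * (2 * ?b n + 2 * nsq v)) + sqrt (nsq u * ?b n))
      \<longlonglongrightarrow> sqrt (0 * (2 * 0 + 2 * nsq v)) + sqrt (nsq u * 0)"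
    by (intro tendsto_intros lims)
  then show "(\<lambda>n. sqrt (?a n * (2 * ?b n + 2 * nsq v)) + sqrt (nsq u * ?b n)) \<longlonglongrightarrow> 0"
    by simp
qed

lemma nconv_nsq: "nconv s u \<Longrightarrow> (\<lambda>n. nsq (s n)) \<longlonglongrightarrow> nsq u"
  unfolding nsq_def by (intro tendsto_Re nconv_ip)

end

section \<open>Polynomials in a bounded symmetric operator\<close>

locale sym_op = ip_space +
  fixes X :: "('a \<Rightarrow> complex) \<Rightarrow> 'a \<Rightarrow> complex" and R :: real
  assumes R_pos: "0 < R"
    and X_in: "v \<in> V \<Longrightarrow> X v \<in> V"
    and X_lincomb: "u \<in> V \<Longrightarrow> v \<in> V \<Longrightarrow> X (lincomb a u b v) = lincomb a (X u) b (X v)"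
    and X_sym: "u \<in> V \<Longrightarrow> v \<in> V \<Longrightarrow> ip u (X v) = ip (X u) v"
    and X_bound: "v \<in> V \<Longrightarrow> nsq (X v) \<le> R\<^sup>2 * nsq v"
begin

lemma funpow_in: "v \<in> V \<Longrightarrow> (X ^^ n) v \<in> V"
  by (induction n) (auto intro: X_in)

lemma funpow_sym: "u \<in> V \<Longrightarrow> v \<in> V \<Longrightarrow> ip u ((X ^^ n) v) = ip ((X ^^ n) u) v"
proof (induction n arbitrary: u)
  case (Suc n)
  then show ?case
    using X_sym[of u "(X ^^ n) v"] by (simp add: funpow_in X_in funpow_swap1)
qed simp

lemma funpow_bound: "v \<in> V \<Longrightarrow> nsq ((X ^^ n) v) \<le> R ^ (2 * n) * nsq v"
proof (induction n)
  case (Suc n)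
  have "nsq ((X ^^ Suc n) v) \<le> R\<^sup>2 * nsq ((X ^^ n) v)"
    using Suc.prems by (simp add: X_bound funpow_in)
  also have "\<dots> \<le> R\<^sup>2 * (R ^ (2 * n) * nsq v)"
    using Suc by (intro mult_left_mono) auto
  also have "\<dots> = R ^ (2 * Suc n) * nsq v"
    by (simp add: power2_eq_square mult_ac)
  finally show ?case .
qed simp

lemma X_zero: "X (\<lambda>_. 0) = (\<lambda>_. 0)"
  using X_lincomb[OF zero_in zero_in, of 0 0] by (simp add: lincomb_def)

text \<open>Horner evaluation of a polynomial at the operator, so that \<open>papp p\<close> is
  \<open>p(X)\<close>.\<close>

fun papp_list :: "real list \<Rightarrow> ('a \<Rightarrow> complex) \<Rightarrow> 'a \<Rightarrow> complex" where
  "papp_list [] v = (\<lambda>_. 0)"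
| "papp_list (a # as) v = lincomb (of_real a) v 1 (X (papp_list as v))"

definition papp :: "real poly \<Rightarrow> ('a \<Rightarrow> complex) \<Rightarrow> 'a \<Rightarrow> complex" where
  "papp p = papp_list (coeffs p)"

lemma papp_0: "papp 0 v = (\<lambda>_. 0)"
  by (simp add: papp_def)

lemma papp_pCons: "papp (pCons a p) v = lincomb (of_real a) v 1 (X (papp p v))"
proof (cases "pCons a p = 0")
  case True
  then have "a = 0" "p = 0" by simp_all
  then show ?thesis by (simp add: papp_0 X_zero) (simp add: lincomb_def)
next
  case False
  then have "coeffs (pCons a p) = a # coeffs p" by (auto simp: cCons_def)
  then show ?thesis by (simp add: papp_def)
qed

lemma papp_in: "v \<in> V \<Longrightarrow> papp p v \<in> V"
  by (induction p) (auto simp: papp_0 papp_pCons intro: zero_in lincomb_in X_in)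

lemma papp_add: "v \<in> V \<Longrightarrow> papp (p + q) v = lincomb 1 (papp p v) 1 (papp q v)"
proof (induction p q rule: poly_induct2)
  case 0
  then show ?case by (simp add: papp_0 lincomb_def)
next
  case (pCons a p b q)
  then show ?case
    by (simp add: papp_pCons X_lincomb papp_in) (simp add: lincomb_def fun_eq_iff algebra_simps)
qed

lemma papp_smult: "v \<in> V \<Longrightarrow> papp (smult c p) v = lincomb (of_real c) (papp p v) 0 v"
proof (induction p)
  case 0
  then show ?case by (simp add: papp_0 lincomb_def)
next
  case (pCons a p)
  have "X (lincomb (of_real c) (papp p v) 0 v) = lincomb (of_real c) (X (papp p v)) 0 (X v)"
    using pCons by (simp add: X_lincomb papp_in)
  then show ?case
    using pCons by (simp add: papp_pCons) (simp add: lincomb_def fun_eq_iff algebra_simps)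
qed

lemma papp_mult: "v \<in> V \<Longrightarrow> papp (p * q) v = papp p (papp q v)"
proof (induction p)
  case (pCons a p)
  then show ?case
    by (simp add: papp_add papp_smult papp_pCons) (simp add: lincomb_def fun_eq_iff)
qed (simp add: papp_0)

lemma papp_X: "v \<in> V \<Longrightarrow> papp [:0, 1:] v = X v"
  using X_lincomb[OF zero_in zero_in] X_lincomb[of v v 1 0]
  by (simp add: papp_pCons papp_0 X_zero) (simp add: lincomb_def X_zero)

lemma papp_1: "v \<in> V \<Longrightarrow> papp 1 v = v"
  by (simp add: one_pCons papp_pCons papp_0 X_zero) (simp add: lincomb_def)

lemma papp_power: "v \<in> V \<Longrightarrow> papp (p ^ n) v = (papp p ^^ n) v"
  by (induction n) (simp_all add: papp_1 papp_mult)

lemma papp_X_power: "v \<in> V \<Longrightarrow> papp ([:0, 1:] ^ n) v = (X ^^ n) v"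
proof (induction n)
  case (Suc n)
  then show ?case by (simp add: papp_mult papp_X funpow_in del: mult_pCons_left)
qed (simp add: papp_1)

lemma papp_sym: "u \<in> V \<Longrightarrow> v \<in> V \<Longrightarrow> ip u (papp p v) = ip (papp p u) v"
proof (induction p arbitrary: u)
  case 0
  have "ip u (\<lambda>_. 0) = 0" "ip (\<lambda>_. 0) v = 0"
    using ip_lincomb_right[of u u u 0 0] ip_lincomb_left[of v v v 0 0] 0 by (auto simp: lincomb_def)
  then show ?case by (simp add: papp_0)
next
  case (pCons a p)
  have "X (papp p u) = papp p (X u)"
    using papp_mult[of u p "[:0, 1:]"] papp_mult[of u "[:0, 1:]" p] pCons.prems
    by (simp add: papp_X papp_in mult.commute del: mult_pCons_left mult_pCons_right)
  then show ?case
    using pCons by (simp add: papp_pCons ip_lincomb_right ip_lincomb_left papp_in X_in X_sym)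
qed

lemma papp_pair: "u \<in> V \<Longrightarrow> papp [:a, b:] u = lincomb (of_real a) u (of_real b) (X u)"
proof -
  assume u: "u \<in> V"
  have "papp [:b:] u = lincomb (of_real b) u 0 u"
    by (simp add: papp_pCons papp_0 X_zero) (simp add: lincomb_def)
  then have "papp [:a, b:] u = lincomb (of_real a) u 1 (lincomb (of_real b) (X u) 0 (X u))"
    using u by (simp only: papp_pCons[of a] X_lincomb)
  then show ?thesis by (simp add: lincomb_def)
qed

lemma ip_X_bound: "u \<in> V \<Longrightarrow> cmod (ip u (X u)) \<le> R * nsq u"
proof (rule power2_le_imp_le)
  assume u: "u \<in> V"
  have "(cmod (ip u (X u)))\<^sup>2 \<le> nsq u * nsq (X u)"
    using u by (simp add: Cauchy_Schwarz X_in)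
  also have "\<dots> \<le> nsq u * (R\<^sup>2 * nsq u)"
    using u by (intro mult_left_mono X_bound nsq_nonneg)
  finally show "(cmod (ip u (X u)))\<^sup>2 \<le> (R * nsq u)\<^sup>2"
    by (simp add: power2_eq_square mult_ac)
  show "0 \<le> R * nsq u" using u R_pos nsq_nonneg by simp
qed

text \<open>Pulling out the square of \<open>s\<close>, which symmetry moves to both sides of the
  inner product, leaves exponents \<open>0\<close> or \<open>1\<close>. The four remaining operators
  are \<open>1\<close>, \<open>R + X\<close>, \<open>R - X\<close> and
  \<open>R\<^sup>2 - X\<^sup>2\<close>, all positive by the norm bound.\<close>

lemma papp_interval_pos:
  assumes v: "v \<in> V"
  shows "0 \<le> Re (ip v (papp ([:R, 1:] ^ k * [:R, -1:] ^ l) v))"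
proof -
  let ?p = "[:R, 1:]" and ?q = "[:R, -1:]"
  define s where "s = ?p ^ (k div 2) * ?q ^ (l div 2)"
  define t where "t = ?p ^ (k mod 2) * ?q ^ (l mod 2)"
  have split: "x ^ n = x ^ (n div 2) * x ^ (n div 2) * x ^ (n mod 2)" for x :: "real poly" and n
    by (simp only: power_add[symmetric] mult_2[symmetric] mult_div_mod_eq)
  have "?p ^ k * ?q ^ l = s * (t * s)"
    unfolding s_def t_def split[of _ k] split[of _ l] by (simp only: mult_ac)
  define u where "u = papp s v"
  have u: "u \<in> V" using v by (simp add: u_def papp_in)
  have "ip v (papp (?p ^ k * ?q ^ l) v) = ip u (papp t u)"
    using v unfolding \<open>?p ^ k * ?q ^ l = s * (t * s)\<close> papp_mult[OF v] u_def
    by (simp add: papp_sym papp_in)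
  moreover have "0 \<le> Re (ip u (papp t u))"
  proof -
    have re: "\<bar>Re (ip u (X u))\<bar> \<le> R * nsq u"
      using ip_X_bound[OF u] abs_Re_le_cmod order_trans by blast
    have p: "0 \<le> Re (ip u (papp ?p u))" and q: "0 \<le> Re (ip u (papp ?q u))"
      using u re by (simp_all add: papp_pair ip_lincomb_right X_in ip_self)
    have "ip u (papp (?p * ?q) u) = ip (papp ?p u) (papp ?q u)"
      using u unfolding papp_mult[OF u] by (simp add: papp_sym papp_in)
    also have "\<dots> = of_real (R\<^sup>2 * nsq u - nsq (X u))"
      using u X_sym[OF u u]
      by (simp add: papp_pair ip_lincomb_right ip_lincomb_left X_in lincomb_in ip_self)
        (simp add: algebra_simps power2_eq_square)
    finally have pq: "0 \<le> Re (ip u (papp (?p * ?q) u))"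
      using X_bound[OF u] by simp
    have "k mod 2 = 0 \<or> k mod 2 = 1" "l mod 2 = 0 \<or> l mod 2 = 1" by auto
    then show ?thesis
      unfolding t_def using p q pq u nsq_nonneg[OF u]
      by (elim disjE) (simp_all add: papp_1 ip_self del: mult_pCons_left mult_pCons_right)
  qed
  ultimately show ?thesis by simp
qed

section \<open>Measures representing the moments of a vector\<close>

definition spectral :: "('a \<Rightarrow> complex) \<Rightarrow> real measure \<Rightarrow> bool" where
  "spectral z mu \<longleftrightarrow> sets mu = sets borel \<and> finite_measure mu \<and>
     (\<forall>n. integrable mu (\<lambda>t. t ^ n) \<and> complex_of_real (\<integral>t. t ^ n \<partial>mu) = ip z ((X ^^ n) z))"

lemma ip_papp_real: "v \<in> V \<Longrightarrow> ip v (papp p v) = of_real (Re (ip v (papp p v)))"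
  using ip_cnj[of v "papp p v"] by (simp add: papp_in papp_sym complex_eq_iff)

text \<open>The functional sending \<open>p\<close> to \<open>\<langle>v, p(X) v\<rangle>\<close>
  satisfies the positivity condition of the moment problem on \<open>[-R, R]\<close>.\<close>

lemma spectral_exists:
  assumes v: "v \<in> V"
  shows "\<exists>mu. spectral v mu"
proof -
  interpret L: linear_functional "\<lambda>p. Re (ip v (papp p v))"
    using v by unfold_locales (simp_all add: papp_add papp_smult ip_lincomb_right papp_in)
  from L.interval_moment[OF R_pos papp_interval_pos[OF v]] obtain mu where
    mu: "sets mu = sets borel" "finite_measure mu" "\<And>p. integrable mu (poly p)"
      "\<And>p. (\<integral>t. poly p t \<partial>mu) = Re (ip v (papp p v))" by blast
  have "poly ([:0, 1:] ^ n) = (\<lambda>t :: real. t ^ n)" for n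
    by (simp add: fun_eq_iff)
  then have "integrable mu (\<lambda>t. t ^ n)" "complex_of_real (\<integral>t. t ^ n \<partial>mu) = ip v ((X ^^ n) v)" for n
    using mu(3,4)[of "[:0, 1:] ^ n"] ip_papp_real[OF v, of "[:0, 1:] ^ n"] papp_X_power[OF v, of n]
    by auto
  then show ?thesis using mu by (auto simp: spectral_def)
qed

lemma spectral_poly:
  assumes v: "v \<in> V" and mu: "spectral v mu"
  shows "integrable mu (poly p)" "of_real (\<integral>t. poly p t \<partial>mu) = ip v (papp p v)"
proof -
  interpret L: linear_functional "\<lambda>p. Re (ip v (papp p v))"
    using v by unfold_locales (simp_all add: papp_add papp_smult ip_lincomb_right papp_in)
  have int: "integrable mu (\<lambda>t. t ^ n)" for n
    using mu by (simp add: spectral_def)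
  have mom: "(\<integral>t. t ^ n \<partial>mu) = Re (ip v (papp ([:0, 1:] ^ n) v))" for n
    using mu papp_X_power[OF v, of n] unfolding spectral_def by (metis Re_complex_of_real)
  show "integrable mu (poly p)"
    unfolding poly_altdef[abs_def]
    by (intro Bochner_Integration.integrable_sum integrable_mult_right int)
  have "(\<integral>t. poly p t \<partial>mu) = Re (ip v (papp p v))"
    unfolding poly_altdef L.expand[of p]
    by (subst Bochner_Integration.integral_sum) (auto intro!: int integrable_mult_right simp: mom)
  then show "of_real (\<integral>t. poly p t \<partial>mu) = ip v (papp p v)"
    using ip_papp_real[OF v, of p] by simp
qed

text \<open>Only moments are prescribed, so the support must come from their growth: the moment of
  order \<open>2 n\<close> is at most \<open>R ^ (2 * n) * nsq v\<close>. Markov's inequality bounds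
  the mass outside radius \<open>R c\<close> by \<open>nsq v / c ^ (2 * n)\<close>, which tends to
  \<open>0\<close> for every \<open>c > 1\<close>.\<close>

lemma spectral_support:
  assumes v: "v \<in> V" and mu: "spectral v mu"
  shows "AE t in mu. \<bar>t\<bar> \<le> R"
proof -
  interpret finite_measure mu using mu by (simp add: spectral_def)
  have sets [measurable_cong]: "sets mu = sets borel" using mu by (simp add: spectral_def)
  have even: "(\<integral>t. t ^ (2 * n) \<partial>mu) \<le> R ^ (2 * n) * nsq v" for n
  proof -
    have "complex_of_real (\<integral>t. t ^ (2 * n) \<partial>mu) = ip v ((X ^^ (n + n)) v)"
      using mu by (simp add: spectral_def mult_2)
    also have "\<dots> = of_real (nsq ((X ^^ n) v))"
      using v by (simp only: funpow_add o_apply) (simp add: funpow_sym funpow_in ip_self)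
    finally show ?thesis using funpow_bound[OF v, of n] by simp
  qed
  have "AE t in mu. \<bar>t\<bar> < R * (1 + 1 / real (Suc k))" for k
  proof -
    define c where "c = 1 + 1 / real (Suc k)"
    have c: "c > 1" by (simp add: c_def)
    let ?A = "{t \<in> space mu. (R * c) \<le> \<bar>t\<bar>}"
    have bound: "measure mu ?A \<le> nsq v * (inverse (c\<^sup>2)) ^ n" for n
    proof -
      have pos: "0 < (R * c) ^ (2 * n)" using R_pos c by simp
      have "measure mu {t \<in> space mu. (R * c) ^ (2 * n) \<le> t ^ (2 * n)} \<le> (\<integral>t. t ^ (2 * n) \<partial>mu) / (R * c) ^ (2 * n)"
        using mu pos by (intro integral_Markov_inequality_measure[where A = "{}"]) (auto simp: spectral_def)
      moreover have "measure mu ?A \<le> measure mu {t \<in> space mu. (R * c) ^ (2 * n) \<le> t ^ (2 * n)}"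
      proof (rule finite_measure_mono)
        show "?A \<subseteq> {t \<in> space mu. (R * c) ^ (2 * n) \<le> t ^ (2 * n)}"
        proof clarify
          fix t assume "R * c \<le> \<bar>t\<bar>"
          then have "(R * c) ^ (2 * n) \<le> \<bar>t\<bar> ^ (2 * n)"
            using R_pos c by (intro power_mono) auto
          moreover have "\<bar>t\<bar> ^ (2 * n) = t ^ (2 * n)" by (rule power_even_abs) simp
          ultimately show "(R * c) ^ (2 * n) \<le> t ^ (2 * n)" by simp
        qed
      qed simp
      moreover have "(\<integral>t. t ^ (2 * n) \<partial>mu) / (R * c) ^ (2 * n) \<le> nsq v * (inverse (c\<^sup>2)) ^ n"
      proof -
        have e: "(R * c) ^ (2 * n) = R ^ (2 * n) * (c\<^sup>2) ^ n"
          by (simp only: power_mult_distrib power_mult)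
        have "(\<integral>t. t ^ (2 * n) \<partial>mu) / (R * c) ^ (2 * n) \<le> R ^ (2 * n) * nsq v / (R * c) ^ (2 * n)"
          using even[of n] pos by (intro divide_right_mono) auto
        also have "\<dots> = nsq v * (inverse (c\<^sup>2)) ^ n"
          unfolding e using R_pos c by (simp add: power_inverse field_simps)
        finally show ?thesis .
      qed
      ultimately show ?thesis by linarith
    qed
    have "(\<lambda>n. nsq v * (inverse (c\<^sup>2)) ^ n) \<longlonglongrightarrow> nsq v * 0"
      using c by (intro tendsto_intros LIMSEQ_realpow_zero) (auto simp: inverse_less_1_iff one_less_power)
    then have "measure mu ?A \<le> 0"
      by (intro LIMSEQ_le_const[of _ 0]) (use bound in auto)
    then have "measure mu ?A = 0" using measure_nonneg[of mu ?A] by linarith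
    then have "emeasure mu ?A = 0" by (simp add: emeasure_eq_measure)
    then have "AE t in mu. t \<notin> ?A" by (intro AE_not_in) (auto simp: null_sets_def)
    then show ?thesis by eventually_elim (use c_def sets_eq_imp_space_eq[OF sets] in auto)
  qed
  then have "AE t in mu. \<forall>k. \<bar>t\<bar> < R * (1 + 1 / real (Suc k))"
    by (simp add: AE_all_countable)
  then show ?thesis
  proof eventually_elim
    fix t assume t: "\<forall>k. \<bar>t\<bar> < R * (1 + 1 / real (Suc k))"
    have "(\<lambda>k. R * (1 + 1 / real (Suc k))) \<longlonglongrightarrow> R * (1 + 0)"
      by (intro tendsto_intros LIMSEQ_Suc[OF lim_1_over_n])
    then show "\<bar>t\<bar> \<le> R"
      by (intro LIMSEQ_le_const[of _ R]) (use t in \<open>auto intro: less_imp_le\<close>)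
  qed
qed

lemma spectral_finite: "spectral v mu \<Longrightarrow> finite_measure mu"
  and spectral_sets: "spectral v mu \<Longrightarrow> sets mu = sets borel"
  by (auto simp: spectral_def)

lemma spectral_total:
  assumes "v \<in> V" "spectral v mu"
  shows "measure mu (space mu) = nsq v"
proof -
  have "complex_of_real (\<integral>t. t ^ 0 \<partial>mu) = ip v ((X ^^ 0) v)"
    using assms(2) unfolding spectral_def by blast
  then show ?thesis using assms(1) by (simp add: ip_self)
qed

text \<open>The map sending \<open>p\<close> to \<open>p(X) v\<close> is isometric from polynomials
  in \<open>L\<^sup>2(mu)\<close>; norm estimates for operators thereby become integral
  estimates.\<close>

lemma ip_papp_papp:
  assumes v: "v \<in> V" and mu: "spectral v mu"
  shows "ip (papp p v) (papp q v) = of_real (\<integral>t. poly p t * poly q t \<partial>mu)"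
proof -
  have "ip (papp p v) (papp q v) = ip v (papp (p * q) v)"
    using v by (simp add: papp_mult papp_sym papp_in)
  then show ?thesis using spectral_poly(2)[OF v mu, of "p * q"] by simp
qed

end

subsection \<open>Functional calculus for bounded limits of polynomials\<close>

text \<open>Completeness is required together with convergence of each coefficient, so that a norm
  limit can be named and computed coefficientwise.\<close>

locale hilbert = ip_space +
  assumes complete: "\<And>s. (\<And>n :: nat. s n \<in> V) \<Longrightarrow>
      (\<And>e. 0 < e \<Longrightarrow> \<exists>N. \<forall>m\<ge>N. \<forall>n\<ge>N. nsq (lincomb 1 (s m) (-1) (s n)) \<le> e) \<Longrightarrow>
      \<exists>v. nconv s v \<and> (\<forall>w. (\<lambda>n. s n w) \<longlonglongrightarrow> v w)"

text \<open>Bounded pointwise convergence on \<open>[-R, R]\<close> allows a discontinuous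
  \<open>\<gamma>\<close>; dominated convergence under each spectral measure replaces uniform
  approximation.\<close>

locale poly_limit = hilbert + sym_op +
  fixes p :: "nat \<Rightarrow> real poly" and \<gamma> :: "real \<Rightarrow> real" and B :: real
  assumes B_pos: "0 < B"
    and p_bound: "\<bar>t\<bar> \<le> R \<Longrightarrow> \<bar>poly (p n) t\<bar> \<le> B"
    and p_lim: "\<bar>t\<bar> \<le> R \<Longrightarrow> (\<lambda>n. poly (p n) t) \<longlonglongrightarrow> \<gamma> t"
    and \<gamma>_borel: "\<gamma> \<in> borel_measurable borel"
begin

definition T :: "('a \<Rightarrow> complex) \<Rightarrow> 'a \<Rightarrow> complex" where
  "T v = (\<lambda>w. lim (\<lambda>n. papp (p n) v w))"

lemma poly_borel: "sets mu = sets borel \<Longrightarrow> poly r \<in> borel_measurable mu" for r :: "real poly"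
  by (subst measurable_cong_sets[OF _ refl, of _ borel])
    (auto intro!: borel_measurable_continuous_onI continuous_intros)

lemma \<gamma>_bound: "\<bar>t\<bar> \<le> R \<Longrightarrow> \<bar>\<gamma> t\<bar> \<le> B"
  using p_bound by (intro LIMSEQ_le_const2[OF tendsto_rabs[OF p_lim]]) auto

text \<open>Dominated convergence, with the constant bound given by compactness of
  \<open>[-R, R] \<times> [-B, B]\<close>. The two-variable \<open>g\<close> serves both for powers
  of \<open>\<gamma>\<close> and for \<open>t * \<gamma> t\<close>.\<close>

lemma integral_limit:
  assumes v: "v \<in> V" and mu: "spectral v mu"
    and g: "continuous_on UNIV (case_prod g)"
  shows "(\<lambda>n. \<integral>t. g t (poly (p n) t) \<partial>mu) \<longlonglongrightarrow> (\<integral>t. g t (\<gamma> t) \<partial>mu :: real)"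
proof -
  have sets [measurable_cong]: "sets mu = sets borel"
    using mu by (rule spectral_sets)
  interpret finite_measure mu using mu by (rule spectral_finite)
  have [measurable]: "\<gamma> \<in> borel_measurable borel" "\<And>n. poly (p n) \<in> borel_measurable borel"
    by (auto intro: \<gamma>_borel poly_borel)
  have [measurable]: "case_prod g \<in> borel_measurable (borel \<Otimes>\<^sub>M borel)"
    unfolding borel_prod by (rule borel_measurable_continuous_onI[OF g])
  have "compact (case_prod g ` ({-R..R} \<times> {-B..B}))"
    by (intro compact_continuous_image continuous_on_subset[OF g] compact_Times) auto
  then have "bounded (case_prod g ` ({-R..R} \<times> {-B..B}))"
    by (rule compact_imp_bounded)
  then obtain C where C': "\<And>y. y \<in> case_prod g ` ({-R..R} \<times> {-B..B}) \<Longrightarrow> norm y \<le> C"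
    unfolding bounded_iff by blast
  have C: "\<bar>g t x\<bar> \<le> C" if "\<bar>t\<bar> \<le> R" "\<bar>x\<bar> \<le> B" for t x
    using C'[of "g t x"] that by (force simp: abs_le_iff)
  note supp = spectral_support[OF v mu]
  have ct: "isCont (g t) x" for t x
  proof -
    have "continuous_on UNIV (\<lambda>x. case_prod g (t, x))"
      by (intro continuous_on_compose2[OF g] continuous_intros) auto
    then show ?thesis by (simp add: continuous_on_eq_continuous_at)
  qed
  show ?thesis
  proof (rule integral_dominated_convergence[where w = "\<lambda>_. C"])
    show "AE t in mu. (\<lambda>n. g t (poly (p n) t)) \<longlonglongrightarrow> g t (\<gamma> t)"
      using supp by eventually_elim (intro isCont_tendsto_compose[OF ct] p_lim)
    show "AE t in mu. norm (g t (poly (p n) t)) \<le> C" for n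
      using supp by eventually_elim (auto intro: C p_bound)
  qed simp_all
qed

lemma papp_bound:
  assumes "v \<in> V"
  shows "nsq (papp (p n) v) \<le> B\<^sup>2 * nsq v"
proof -
  obtain mu where mu: "spectral v mu" using spectral_exists[OF assms] by blast
  interpret finite_measure mu using mu by (rule spectral_finite)
  have "nsq (papp (p n) v) = (\<integral>t. poly (p n) t * poly (p n) t \<partial>mu)"
    by (simp add: nsq_def ip_papp_papp[OF assms mu])
  also have "\<dots> \<le> (\<integral>t. B\<^sup>2 \<partial>mu)"
  proof (rule integral_mono_AE)
    show "integrable mu (\<lambda>t. poly (p n) t * poly (p n) t)"
      using spectral_poly(1)[OF assms mu, of "p n * p n"] by (simp add: poly_mult[abs_def])
    show "AE t in mu. poly (p n) t * poly (p n) t \<le> B\<^sup>2"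
      using spectral_support[OF assms mu]
    proof eventually_elim
      fix t assume "\<bar>t\<bar> \<le> R"
      then have "\<bar>poly (p n) t\<bar>\<^sup>2 \<le> B\<^sup>2" by (intro power_mono p_bound) auto
      then show "poly (p n) t * poly (p n) t \<le> B\<^sup>2" by (simp add: power2_eq_square)
    qed
  qed simp
  also have "\<dots> = B\<^sup>2 * nsq v" by (simp add: spectral_total[OF assms mu])
  finally show ?thesis .
qed

text \<open>By the isometry the distance of \<open>p\<^sub>m(X) v\<close> and
  \<open>p\<^sub>n(X) v\<close> is their distance in \<open>L\<^sup>2(mu)\<close>. It is controlled
  by \<open>a m\<close> and \<open>a n\<close>, the squared distances to \<open>\<gamma>\<close>,
  which tend to \<open>0\<close>; so the sequence is Cauchy.\<close>

lemma T_limit: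
  assumes v: "v \<in> V"
  shows "nconv (\<lambda>n. papp (p n) v) (T v)" "(\<lambda>n. papp (p n) v w) \<longlonglongrightarrow> T v w"
proof -
  obtain mu where mu: "spectral v mu" using spectral_exists[OF v] by blast
  have sets [measurable_cong]: "sets mu = sets borel"
    using mu by (rule spectral_sets)
  interpret finite_measure mu using mu by (rule spectral_finite)
  have [measurable]: "\<gamma> \<in> borel_measurable borel" "\<And>n. poly (p n) \<in> borel_measurable borel"
    by (auto intro: \<gamma>_borel poly_borel)
  note supp = spectral_support[OF v mu]
  define a where "a n = (\<integral>t. (poly (p n) t - \<gamma> t)\<^sup>2 \<partial>mu)" for n
  have bd: "\<bar>poly (p n) t - \<gamma> t\<bar> \<le> 2 * B" if "\<bar>t\<bar> \<le> R" for n t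
    using p_bound[OF that, of n] \<gamma>_bound[OF that] by linarith
  have sq: "(poly (p n) t - \<gamma> t)\<^sup>2 \<le> (2 * B)\<^sup>2" if "\<bar>t\<bar> \<le> R" for n t
    using power_mono[OF bd[OF that, of n], of 2] by simp
  have int: "integrable mu (\<lambda>t. (poly (p n) t - \<gamma> t)\<^sup>2)" for n
    using supp sq by (intro integrable_const_bound[of _ "(2 * B)\<^sup>2"]) (auto elim!: eventually_mono)
  have "a \<longlonglongrightarrow> (\<integral>t. 0 \<partial>mu)"
    unfolding a_def
  proof (rule integral_dominated_convergence[where w = "\<lambda>_. (2 * B)\<^sup>2"])
    show "AE t in mu. (\<lambda>n. (poly (p n) t - \<gamma> t)\<^sup>2) \<longlonglongrightarrow> 0"
      using supp
    proof eventually_elim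
      fix t assume "\<bar>t\<bar> \<le> R"
      from tendsto_power[OF tendsto_diff[OF p_lim[OF this] tendsto_const[of "\<gamma> t"]], of 2]
      show "(\<lambda>n. (poly (p n) t - \<gamma> t)\<^sup>2) \<longlonglongrightarrow> 0" by simp
    qed
    show "AE t in mu. norm ((poly (p n) t - \<gamma> t)\<^sup>2) \<le> (2 * B)\<^sup>2" for n
      using supp sq by (auto elim!: eventually_mono)
  qed simp_all
  then have a0: "a \<longlonglongrightarrow> 0" by simp
  have diff: "nsq (lincomb 1 (papp (p m) v) (-1) (papp (p n) v)) \<le> 2 * a m + 2 * a n" for m n
  proof -
    have "lincomb 1 (papp (p m) v) (-1) (papp (p n) v) = papp (p m + smult (-1) (p n)) v"
      using v by (simp only: papp_add papp_smult) (simp add: lincomb_def)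
    then have "nsq (lincomb 1 (papp (p m) v) (-1) (papp (p n) v))
        = (\<integral>t. (poly (p m) t - poly (p n) t) * (poly (p m) t - poly (p n) t) \<partial>mu)"
      by (simp add: nsq_def ip_papp_papp[OF v mu])
    also have "\<dots> \<le> (\<integral>t. 2 * (poly (p m) t - \<gamma> t)\<^sup>2 + 2 * (poly (p n) t - \<gamma> t)\<^sup>2 \<partial>mu)"
    proof (rule integral_mono)
      show "integrable mu (\<lambda>t. (poly (p m) t - poly (p n) t) * (poly (p m) t - poly (p n) t))"
        using spectral_poly(1)[OF v mu, of "(p m - p n) * (p m - p n)"]
        by (simp add: poly_mult[abs_def] poly_diff[abs_def])
      show "(poly (p m) t - poly (p n) t) * (poly (p m) t - poly (p n) t)
         \<le> 2 * (poly (p m) t - \<gamma> t)\<^sup>2 + 2 * (poly (p n) t - \<gamma> t)\<^sup>2" for t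
        using zero_le_power2[of "(poly (p m) t - \<gamma> t) + (poly (p n) t - \<gamma> t)"]
        by (simp add: power2_eq_square algebra_simps)
    qed (use int in auto)
    also have "\<dots> = 2 * a m + 2 * a n"
      using int by (simp add: a_def)
    finally show ?thesis .
  qed
  have "\<exists>v'. nconv (\<lambda>n. papp (p n) v) v' \<and> (\<forall>w. (\<lambda>n. papp (p n) v w) \<longlonglongrightarrow> v' w)"
  proof (rule complete)
    show "papp (p n) v \<in> V" for n using v by (rule papp_in)
    fix e :: real assume "0 < e"
    then have "\<forall>\<^sub>F n in sequentially. a n < e / 4"
      using a0 by (intro order_tendstoD) auto
    then obtain N where N: "\<And>n. n \<ge> N \<Longrightarrow> a n < e / 4"
      by (auto simp: eventually_sequentially)
    have "nsq (lincomb 1 (papp (p m) v) (-1) (papp (p n) v)) \<le> e" if "m \<ge> N" "n \<ge> N" for m n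
      using diff[of m n] N[OF that(1)] N[OF that(2)] by linarith
    then show "\<exists>N. \<forall>m\<ge>N. \<forall>n\<ge>N. nsq (lincomb 1 (papp (p m) v) (-1) (papp (p n) v)) \<le> e"
      by blast
  qed
  then obtain v' where v': "nconv (\<lambda>n. papp (p n) v) v'" "\<And>w. (\<lambda>n. papp (p n) v w) \<longlonglongrightarrow> v' w"
    by blast
  have "T v = v'"
    unfolding T_def using v'(2) by (auto simp: fun_eq_iff intro: limI)
  then show "nconv (\<lambda>n. papp (p n) v) (T v)" "(\<lambda>n. papp (p n) v w) \<longlonglongrightarrow> T v w"
    using v' by auto
qed

lemma T_in: "v \<in> V \<Longrightarrow> T v \<in> V"
  using T_limit(1)[of v] by (simp add: nconv_def)

lemma papp_lincomb:
  assumes "u \<in> V" "v \<in> V"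
  shows "papp r (lincomb a u b v) = lincomb a (papp r u) b (papp r v)"
proof (induction r)
  case 0
  then show ?case by (simp add: papp_0 lincomb_def)
next
  case (pCons c r)
  then show ?case
    using assms by (simp add: papp_pCons X_lincomb papp_in) (simp add: lincomb_def fun_eq_iff algebra_simps)
qed

lemma T_lincomb:
  assumes "u \<in> V" "v \<in> V"
  shows "T (lincomb a u b v) = lincomb a (T u) b (T v)"
proof
  fix w
  have "(\<lambda>n. a * papp (p n) u w + b * papp (p n) v w) \<longlonglongrightarrow> a * T u w + b * T v w"
    using assms by (intro tendsto_intros T_limit)
  moreover have "(\<lambda>n. papp (p n) (lincomb a u b v) w) \<longlonglongrightarrow> T (lincomb a u b v) w"
    using assms by (intro T_limit lincomb_in)
  ultimately show "T (lincomb a u b v) w = lincomb a (T u) b (T v) w"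
    using assms by (simp add: papp_lincomb) (simp add: lincomb_def LIMSEQ_unique)
qed

lemma T_sym:
  assumes "u \<in> V" "v \<in> V"
  shows "ip u (T v) = ip (T u) v"
proof (rule LIMSEQ_unique)
  show "(\<lambda>n. ip u (papp (p n) v)) \<longlonglongrightarrow> ip u (T v)"
    using assms by (intro nconv_ip nconv_const T_limit)
  have "(\<lambda>n. ip (papp (p n) u) v) \<longlonglongrightarrow> ip (T u) v"
    using assms by (intro nconv_ip nconv_const T_limit)
  then show "(\<lambda>n. ip u (papp (p n) v)) \<longlonglongrightarrow> ip (T u) v"
    using assms by (simp add: papp_sym)
qed

lemma T_bound: "v \<in> V \<Longrightarrow> nsq (T v) \<le> B\<^sup>2 * nsq v"
  by (rule LIMSEQ_le_const2[OF nconv_nsq[OF T_limit(1)]]) (auto intro: papp_bound)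

lemma sym_op_T: "sym_op V ip T B"
  by unfold_locales (auto intro: B_pos T_in T_lincomb T_sym T_bound)

text \<open>Strong convergence survives products of uniformly bounded operators: the error of the
  next power is \<open>p\<^sub>k(X)\<close> applied to the previous error, plus the error of
  \<open>p\<^sub>k(X)\<close> on the fixed vector \<open>?y\<close>.\<close>

lemma T_funpow_limit:
  assumes v: "v \<in> V"
  shows "nconv (\<lambda>k. (papp (p k) ^^ n) v) ((T ^^ n) v)"
proof (induction n)
  case 0
  then show ?case using v by (simp add: nconv_const)
next
  case (Suc n)
  let ?y = "(T ^^ n) v" and ?s = "\<lambda>k. (papp (p k) ^^ n) v"
  have y: "?y \<in> V" and s: "\<And>k. ?s k \<in> V"
    using Suc by (auto simp: nconv_def)
  show ?case
    unfolding nconv_def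
  proof (intro conjI allI)
    show "(papp (p k) ^^ Suc n) v \<in> V" for k using s by (simp add: papp_in)
    show "(T ^^ Suc n) v \<in> V" using y by (simp add: T_in)
    have le: "nsq (lincomb 1 ((papp (p k) ^^ Suc n) v) (-1) ((T ^^ Suc n) v))
       \<le> 2 * (B\<^sup>2 * nsq (lincomb 1 (?s k) (-1) ?y)) + 2 * nsq (lincomb 1 (papp (p k) ?y) (-1) (T ?y))" for k
    proof -
      have d: "lincomb 1 (?s k) (-1) ?y \<in> V" using s y by (intro lincomb_in)
      have "lincomb 1 ((papp (p k) ^^ Suc n) v) (-1) ((T ^^ Suc n) v)
         = lincomb 1 (papp (p k) (lincomb 1 (?s k) (-1) ?y)) 1 (lincomb 1 (papp (p k) ?y) (-1) (T ?y))"
        using s y by (simp add: papp_lincomb) (simp add: lincomb_def)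
      then have "nsq (lincomb 1 ((papp (p k) ^^ Suc n) v) (-1) ((T ^^ Suc n) v))
         \<le> 2 * nsq (papp (p k) (lincomb 1 (?s k) (-1) ?y)) + 2 * nsq (lincomb 1 (papp (p k) ?y) (-1) (T ?y))"
        using nsq_lincomb_le[of "papp (p k) (lincomb 1 (?s k) (-1) ?y)"
            "lincomb 1 (papp (p k) ?y) (-1) (T ?y)" 1 1] d y
        by (simp add: papp_in lincomb_in T_in)
      then show ?thesis using papp_bound[OF d, of k] by linarith
    qed
    show "(\<lambda>k. nsq (lincomb 1 ((papp (p k) ^^ Suc n) v) (-1) ((T ^^ Suc n) v))) \<longlonglongrightarrow> 0"
    proof (rule Lim_null_comparison)
      show "\<forall>\<^sub>F k in sequentially. norm (nsq (lincomb 1 ((papp (p k) ^^ Suc n) v) (-1) ((T ^^ Suc n) v)))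
        \<le> 2 * (B\<^sup>2 * nsq (lincomb 1 (?s k) (-1) ?y)) + 2 * nsq (lincomb 1 (papp (p k) ?y) (-1) (T ?y))"
      proof (intro always_eventually allI)
        fix k
        have "lincomb 1 ((papp (p k) ^^ Suc n) v) (-1) ((T ^^ Suc n) v) \<in> V"
          using s y by (intro lincomb_in) (auto simp: papp_in T_in)
        from nsq_nonneg[OF this] le[of k]
        show "norm (nsq (lincomb 1 ((papp (p k) ^^ Suc n) v) (-1) ((T ^^ Suc n) v)))
          \<le> 2 * (B\<^sup>2 * nsq (lincomb 1 (?s k) (-1) ?y)) + 2 * nsq (lincomb 1 (papp (p k) ?y) (-1) (T ?y))"
          by simp
      qed
      have "(\<lambda>k. 2 * (B\<^sup>2 * nsq (lincomb 1 (?s k) (-1) ?y)) + 2 * nsq (lincomb 1 (papp (p k) ?y) (-1) (T ?y)))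
        \<longlonglongrightarrow> 2 * (B\<^sup>2 * 0) + 2 * 0"
        using Suc T_limit(1)[OF y] by (intro tendsto_intros) (auto simp: nconv_def)
      then show "(\<lambda>k. 2 * (B\<^sup>2 * nsq (lincomb 1 (?s k) (-1) ?y)) + 2 * nsq (lincomb 1 (papp (p k) ?y) (-1) (T ?y)))
        \<longlonglongrightarrow> 0" by simp
    qed
  qed
qed

text \<open>At \<open>n = 1\<close> this is the defining property of the functional calculus; at the
  vacuum it gives all moments of \<open>T\<close>.\<close>

lemma T_moment:
  assumes v: "v \<in> V" and mu: "spectral v mu"
  shows "ip v ((T ^^ n) v) = of_real (\<integral>t. \<gamma> t ^ n \<partial>mu)"
proof (rule LIMSEQ_unique)
  show "(\<lambda>k. ip v ((papp (p k) ^^ n) v)) \<longlonglongrightarrow> ip v ((T ^^ n) v)"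
    using v by (intro nconv_ip nconv_const T_funpow_limit)
  have "ip v ((papp (p k) ^^ n) v) = of_real (\<integral>t. poly (p k) t ^ n \<partial>mu)" for k
    using spectral_poly(2)[OF v mu, of "p k ^ n"] v by (simp add: papp_power)
  moreover have "(\<lambda>k. complex_of_real (\<integral>t. poly (p k) t ^ n \<partial>mu)) \<longlonglongrightarrow> of_real (\<integral>t. \<gamma> t ^ n \<partial>mu)"
    by (intro tendsto_of_real integral_limit[OF v mu, where g = "\<lambda>t x. x ^ n"])
      (auto simp: case_prod_unfold intro!: continuous_intros)
  ultimately show "(\<lambda>k. ip v ((papp (p k) ^^ n) v)) \<longlonglongrightarrow> of_real (\<integral>t. \<gamma> t ^ n \<partial>mu)"
    by simp
qed

lemma X_T_moment:
  assumes v: "v \<in> V" and mu: "spectral v mu"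
  shows "ip (X v) (T v) = of_real (\<integral>t. t * \<gamma> t \<partial>mu)"
proof (rule LIMSEQ_unique)
  show "(\<lambda>k. ip (X v) (papp (p k) v)) \<longlonglongrightarrow> ip (X v) (T v)"
    using v by (intro nconv_ip nconv_const T_limit X_in)
  have "ip (X v) (papp (p k) v) = of_real (\<integral>t. t * poly (p k) t \<partial>mu)" for k
    using ip_papp_papp[OF v mu, of "[:0, 1:]" "p k"] papp_X[OF v] by simp
  moreover have "(\<lambda>k. complex_of_real (\<integral>t. t * poly (p k) t \<partial>mu)) \<longlonglongrightarrow> of_real (\<integral>t. t * \<gamma> t \<partial>mu)"
    by (intro tendsto_of_real integral_limit[OF v mu, where g = "\<lambda>t x. t * x"])
      (auto simp: case_prod_unfold intro!: continuous_intros)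
  ultimately show "(\<lambda>k. ip (X v) (papp (p k) v)) \<longlonglongrightarrow> of_real (\<integral>t. t * \<gamma> t \<partial>mu)"
    by simp
qed

end

subsection \<open>The q-Fock space as a Hilbert space\<close>

lemma qip_deg_lincomb_right:
  "qip_deg q z (lincomb a u b v) n = a * qip_deg q z u n + b * qip_deg q z v n"
  unfolding qip_deg_def lincomb_def sum_distrib_left sum.distrib[symmetric]
  by (intro sum.cong refl) (simp add: algebra_simps)

lemma sum_words_Suc:
  "(\<Sum>w\<in>{w :: bool list. length w = Suc n}. h w) = (\<Sum>a\<in>UNIV. \<Sum>x\<in>{x. length x = n}. h (a # x))"
proof -
  have "(\<Sum>w\<in>{w :: bool list. length w = Suc n}. h w)
     = (\<Sum>(a, x)\<in>UNIV \<times> {x. length x = n}. h (a # x))"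
    by (rule sum.reindex_bij_witness[of _ "\<lambda>(a, x). a # x" "\<lambda>w. (hd w, tl w)"])
      (auto simp: length_Suc_conv)
  then show ?thesis by (simp add: sum.cartesian_product)
qed

text \<open>Deleting position \<open>k\<close> is a bijection from words with letter
  \<open>i\<close> there to words one letter shorter.\<close>

lemma sum_words_insert:
  assumes "k \<le> n"
  shows "(\<Sum>w\<in>{w :: bool list. length w = Suc n}. if w ! k = i then h w (take k w @ drop (Suc k) w) else 0)
       = (\<Sum>y\<in>{y. length y = n}. h (take k y @ i # drop k y) y)"
proof -
  have "(\<Sum>w\<in>{w :: bool list. length w = Suc n}. if w ! k = i then h w (take k w @ drop (Suc k) w) else 0)
      = (\<Sum>w\<in>{w. length w = Suc n \<and> w ! k = i}. h w (take k w @ drop (Suc k) w))"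
    by (subst sum.inter_filter[OF finite_words, symmetric]) simp
  also have "\<dots> = (\<Sum>y\<in>{y. length y = n}. h (take k y @ i # drop k y) y)"
  proof (rule sum.reindex_bij_witness[of _ "\<lambda>y. take k y @ i # drop k y" "\<lambda>w. take k w @ drop (Suc k) w"])
    fix w assume w: "w \<in> {w. length w = Suc n \<and> w ! k = i}"
    then have len: "k < length w" using assms by simp
    have td: "take k (take k w @ drop (Suc k) w) = take k w" "drop k (take k w @ drop (Suc k) w) = drop (Suc k) w"
      using len by simp_all
    have "w ! k = i" using w by simp
    then show eq: "take k (take k w @ drop (Suc k) w) @ i # drop k (take k w @ drop (Suc k) w) = w"
      unfolding td using id_take_nth_drop[OF len, symmetric] by (simp only:)
    show "take k w @ drop (Suc k) w \<in> {y. length y = n}" using w assms by simp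
    show "h (take k (take k w @ drop (Suc k) w) @ i # drop k (take k w @ drop (Suc k) w))
        (take k w @ drop (Suc k) w) = h w (take k w @ drop (Suc k) w)"
      by (simp only: eq)
  next
    fix y :: "bool list" assume y: "y \<in> {y. length y = n}"
    then show "take k (take k y @ i # drop k y) @ drop (Suc k) (take k y @ i # drop k y) = y"
      using assms by (simp add: min_def)
    show "take k y @ i # drop k y \<in> {w. length w = Suc n \<and> w ! k = i}"
      using y assms by (simp add: nth_append min_def)
  qed
  finally show ?thesis .
qed

lemma qip_deg_cre_0: "qip_deg q (cre i u) v 0 = 0"
  by (simp add: qip_deg_def cre_def)

text \<open>Adjointness is built into \<open>qgram\<close>: its recursion removes the first letter
  of one word and every equal letter of the other in turn, with the weights of the annihilation
  operator. Removing a letter becomes inserting one when the sum is reindexed by the shorter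
  word.\<close>

lemma qip_deg_cre: "qip_deg q (cre i u) v (Suc n) = qip_deg q u (ann q i v) n"
proof -
  let ?W = "\<lambda>n. {w :: bool list. length w = n}"
  have "qip_deg q (cre i u) v (Suc n)
     = (\<Sum>x\<in>?W n. \<Sum>w'\<in>?W (Suc n). cnj (u x) * v w' * of_real (qgram q (i # x) w'))"
    unfolding qip_deg_def sum_words_Suc[of _ n] by (cases i) (simp_all add: cre_def UNIV_bool)
  also have "\<dots> = (\<Sum>x\<in>?W n. \<Sum>y\<in>?W n. cnj (u x) * ann q i v y * of_real (qgram q x y))"
  proof (rule sum.cong[OF refl])
    fix x assume x: "x \<in> ?W n"
    have "(\<Sum>w'\<in>?W (Suc n). cnj (u x) * v w' * of_real (qgram q (i # x) w'))
      = (\<Sum>w'\<in>?W (Suc n). \<Sum>k\<le>n. if w' ! k = i then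
           cnj (u x) * v w' * of_real (q ^ k * qgram q x (take k w' @ drop (Suc k) w')) else 0)"
    proof (rule sum.cong[OF refl])
      fix w' assume "w' \<in> ?W (Suc n)"
      then have "qgram q (i # x) w' = (\<Sum>k\<le>n. if w' ! k = i
          then q ^ k * qgram q x (take k w' @ drop (Suc k) w') else 0)"
        using x by (simp add: lessThan_Suc_atMost)
      then show "cnj (u x) * v w' * of_real (qgram q (i # x) w') = (\<Sum>k\<le>n. if w' ! k = i then
           cnj (u x) * v w' * of_real (q ^ k * qgram q x (take k w' @ drop (Suc k) w')) else 0)"
        unfolding of_real_sum by (auto simp: sum_distrib_left intro!: sum.cong)
    qed
    also have "\<dots> = (\<Sum>k\<le>n. \<Sum>w'\<in>?W (Suc n). if w' ! k = i then
           cnj (u x) * v w' * of_real (q ^ k * qgram q x (take k w' @ drop (Suc k) w')) else 0)"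
      by (rule sum.swap)
    also have "\<dots> = (\<Sum>k\<le>n. \<Sum>y\<in>?W n. cnj (u x) * v (take k y @ i # drop k y) * of_real (q ^ k * qgram q x y))"
    proof (rule sum.cong[OF refl])
      fix k assume "k \<in> {..n}"
      then show "(\<Sum>w'\<in>?W (Suc n). if w' ! k = i then
           cnj (u x) * v w' * of_real (q ^ k * qgram q x (take k w' @ drop (Suc k) w')) else 0)
        = (\<Sum>y\<in>?W n. cnj (u x) * v (take k y @ i # drop k y) * of_real (q ^ k * qgram q x y))"
        by (intro sum_words_insert[where h = "\<lambda>w' y. cnj (u x) * v w' * of_real (q ^ k * qgram q x y)"]) simp
    qed
    also have "\<dots> = (\<Sum>y\<in>?W n. \<Sum>k\<le>n. cnj (u x) * v (take k y @ i # drop k y) * of_real (q ^ k * qgram q x y))"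
      by (rule sum.swap)
    also have "\<dots> = (\<Sum>y\<in>?W n. cnj (u x) * ann q i v y * of_real (qgram q x y))"
      by (intro sum.cong refl) (simp add: ann_def sum_distrib_left sum_distrib_right mult_ac)
    finally show "(\<Sum>w'\<in>?W (Suc n). cnj (u x) * v w' * of_real (qgram q (i # x) w'))
       = (\<Sum>y\<in>?W n. cnj (u x) * ann q i v y * of_real (qgram q x y))" .
  qed
  finally show ?thesis by (simp add: qip_deg_def)
qed

text \<open>The q-commutation relation. Insertion in front of the first letter gives the scalar
  term; all later insertions have their index shifted by one, which produces the factor
  \<open>q\<close>.\<close>

lemma ann_cre: "ann q i (cre j v) = lincomb (if i = j then 1 else 0) v (of_real q) (cre j (ann q i v))"
proof
  fix w
  show "ann q i (cre j v) w = lincomb (if i = j then 1 else 0) v (of_real q) (cre j (ann q i v)) w"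
  proof (cases w)
    case Nil
    then show ?thesis by (simp add: ann_def cre_def lincomb_def)
  next
    case (Cons a x)
    have "(\<Sum>k\<le>length x. of_real (q ^ Suc k) * (if a = j then v (take k x @ i # drop k x) else 0))
        = of_real q * (if a = j then \<Sum>k\<le>length x. of_real (q ^ k) * v (take k x @ i # drop k x) else 0)"
      by (simp add: sum_distrib_left mult_ac)
    then show ?thesis
      unfolding Cons by (simp only: ann_def cre_def lincomb_def length_Cons sum.atMost_Suc_shift) simp
  qed
qed

lemma ann_lincomb: "ann q i (lincomb a u b v) = lincomb a (ann q i u) b (ann q i v)"
  by (simp add: ann_def lincomb_def fun_eq_iff sum_distrib_left sum.distrib algebra_simps)

lemma cre_lincomb: "cre i (lincomb a u b v) = lincomb a (cre i u) b (cre i v)"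
  by (simp add: cre_def lincomb_def fun_eq_iff split: list.split)

lemma Xop_eq: "Xop q i v = lincomb 1 (ann q i v) 1 (cre i v)"
  by (simp add: Xop_def lincomb_def)

lemma Xop_lincomb: "Xop q i (lincomb a u b v) = lincomb a (Xop q i u) b (Xop q i v)"
  by (simp add: Xop_eq ann_lincomb cre_lincomb) (simp add: lincomb_def fun_eq_iff algebra_simps)

locale q_fock =
  fixes q :: real
  assumes q_pos: "0 < q" and q_less: "q < 1"
begin

sublocale D: ip_space UNIV "\<lambda>u v. qip_deg q u v n" for n
proof
  show "0 \<le> Re (qip_deg q u u n)" for u
  proof -
    obtain c where "c > 0" "c * (\<Sum>w\<in>{w. length w = n}. (cmod (u w))\<^sup>2) \<le> Re (qip_deg q u u n)"
      using qip_deg_pos_def[of q n] q_pos q_less by auto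
    moreover from this(1) have "0 \<le> c * (\<Sum>w\<in>{w. length w = n}. (cmod (u w))\<^sup>2)"
      by (simp add: sum_nonneg)
    ultimately show ?thesis by linarith
  qed
  show "qip_deg q v u n = cnj (qip_deg q u v n)" for u v
    using q_pos by (intro qip_deg_hermitian) simp
qed (simp_all add: qip_deg_lincomb_right)

abbreviation dsq :: "nat \<Rightarrow> (bool list \<Rightarrow> complex) \<Rightarrow> real" where
  "dsq n u \<equiv> Re (qip_deg q u u n)"

lemma dsq_nonneg: "0 \<le> dsq n u"
  by (rule D.ip_nonneg) simp

lemma cmod_qip_deg_le: "cmod (qip_deg q u v n) \<le> dsq n u + dsq n v"
proof (rule power2_le_imp_le)
  have "(cmod (qip_deg q u v n))\<^sup>2 \<le> dsq n u * dsq n v"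
    using D.Cauchy_Schwarz[where n = n and u = u and v = v] by (simp add: D.nsq_def)
  also have "\<dots> \<le> (dsq n u + dsq n v)\<^sup>2"
    using dsq_nonneg[of u n] dsq_nonneg[of v n] by (simp add: power2_sum)
  finally show "(cmod (qip_deg q u v n))\<^sup>2 \<le> (dsq n u + dsq n v)\<^sup>2" .
qed (simp add: dsq_nonneg)

lemma summable_dsq: "u \<in> fock q \<Longrightarrow> summable (\<lambda>n. dsq n u)"
  by (simp add: fock_def)

lemma summable_qip_deg: "u \<in> fock q \<Longrightarrow> v \<in> fock q \<Longrightarrow> summable (\<lambda>n. qip_deg q u v n)"
  by (rule summable_comparison_test'[where N = 0 and g = "\<lambda>n. dsq n u + dsq n v"])
    (auto intro: summable_add summable_dsq cmod_qip_deg_le)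

lemma dsq_lincomb_le: "dsq n (lincomb a u b v) \<le> 2 * (cmod a)\<^sup>2 * dsq n u + 2 * (cmod b)\<^sup>2 * dsq n v"
  using D.nsq_lincomb_le[where n = n and u = u and v = v and a = a and b = b] by (simp add: D.nsq_def)

lemma fock_lincomb: "u \<in> fock q \<Longrightarrow> v \<in> fock q \<Longrightarrow> lincomb a u b v \<in> fock q"
  unfolding fock_def mem_Collect_eq
  by (rule summable_comparison_test'[where N = 0
        and g = "\<lambda>n. 2 * (cmod a)\<^sup>2 * dsq n u + 2 * (cmod b)\<^sup>2 * dsq n v"])
    (auto intro: summable_add summable_mult dsq_lincomb_le simp: dsq_nonneg)

sublocale F: ip_space "fock q" "qip q"
proof
  show "(\<lambda>_. 0) \<in> fock q"
    by (simp add: fock_def qip_deg_def)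
  show "lincomb a u b v \<in> fock q" if "u \<in> fock q" "v \<in> fock q" for a u b v
    using that by (rule fock_lincomb)
  show "qip q z (lincomb a u b v) = a * qip q z u + b * qip q z v"
    if "z \<in> fock q" "u \<in> fock q" "v \<in> fock q" for z a u b v
    using that unfolding qip_def qip_deg_lincomb_right
    by (simp add: suminf_add[symmetric] suminf_mult summable_mult summable_qip_deg)
  show "qip q v u = cnj (qip q u v)" if "u \<in> fock q" "v \<in> fock q" for u v
  proof -
    have "(\<lambda>n. cnj (qip_deg q u v n)) sums cnj (qip q u v)"
      unfolding sums_cnj qip_def using that by (intro summable_sums summable_qip_deg)
    then show ?thesis
      unfolding qip_def D.ip_cnj[OF UNIV_I UNIV_I, of v u] by (simp add: sums_iff)
  qed
  show "0 \<le> Re (qip q u u)" if "u \<in> fock q" for u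
  proof -
    have "Re (qip q u u) = (\<Sum>n. dsq n u)"
      unfolding qip_def using that
      by (intro bounded_linear.suminf[OF bounded_linear_Re] summable_qip_deg)
    then show ?thesis using that by (simp add: suminf_nonneg summable_dsq dsq_nonneg)
  qed
qed

lemma nsq_eq: "u \<in> fock q \<Longrightarrow> F.nsq u = (\<Sum>n. dsq n u)"
  unfolding F.nsq_def qip_def by (intro bounded_linear.suminf[OF bounded_linear_Re] summable_qip_deg)

lemma sum_dsq_le_nsq: "u \<in> fock q \<Longrightarrow> (\<Sum>n<N. dsq n u) \<le> F.nsq u"
  by (simp add: nsq_eq sum_le_suminf summable_dsq dsq_nonneg)

lemma fockI: "(\<And>N. (\<Sum>n<N. dsq n u) \<le> B) \<Longrightarrow> u \<in> fock q"
  unfolding fock_def mem_Collect_eq by (rule summableI_nonneg_bounded) (auto simp: dsq_nonneg)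

text \<open>Evaluation at a word is continuous in the norm, by strict positivity of the Gram matrix
  in the degree of that word.\<close>

lemma coefficient_bound: "\<exists>c>0. \<forall>u\<in>fock q. c * (cmod (u w))\<^sup>2 \<le> F.nsq u"
proof -
  obtain c where c: "c > 0"
    "\<And>u. c * (\<Sum>x\<in>{x. length x = length w}. (cmod (u x))\<^sup>2) \<le> dsq (length w) u"
    using qip_deg_pos_def[of q "length w"] q_pos q_less by auto
  have "c * (cmod (u w))\<^sup>2 \<le> F.nsq u" if "u \<in> fock q" for u
  proof -
    have "c * (cmod (u w))\<^sup>2 \<le> c * (\<Sum>x\<in>{x. length x = length w}. (cmod (u x))\<^sup>2)"
      using c(1) by (intro mult_left_mono member_le_sum) auto
    also have "\<dots> \<le> dsq (length w) u" by (rule c(2))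
    also have "\<dots> \<le> (\<Sum>n<Suc (length w). dsq n u)"
      by (intro member_le_sum) (auto simp: dsq_nonneg)
    also have "\<dots> \<le> F.nsq u" using that by (rule sum_dsq_le_nsq)
    finally show ?thesis .
  qed
  then show ?thesis using c(1) by blast
qed

lemma dsq_tendsto:
  assumes "\<And>w. (\<lambda>k. s k w) \<longlonglongrightarrow> v w"
  shows "(\<lambda>k. dsq n (s k)) \<longlonglongrightarrow> dsq n v"
  unfolding qip_deg_def by (intro tendsto_Re tendsto_sum tendsto_mult tendsto_cnj tendsto_const assms)

sublocale H: hilbert "fock q" "qip q"
proof
  fix s :: "nat \<Rightarrow> bool list \<Rightarrow> complex"
  assume s: "\<And>n. s n \<in> fock q"
    and cauchy: "\<And>e. 0 < e \<Longrightarrow> \<exists>N. \<forall>m\<ge>N. \<forall>n\<ge>N. F.nsq (lincomb 1 (s m) (-1) (s n)) \<le> e"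
  have "convergent (\<lambda>n. s n w)" for w
  proof -
    obtain c where c: "c > 0" "\<And>u. u \<in> fock q \<Longrightarrow> c * (cmod (u w))\<^sup>2 \<le> F.nsq u"
      using coefficient_bound by blast
    have "Cauchy (\<lambda>n. s n w)"
    proof (rule CauchyI)
      fix e :: real assume e: "0 < e"
      then obtain N where N: "\<And>m n. m \<ge> N \<Longrightarrow> n \<ge> N \<Longrightarrow> F.nsq (lincomb 1 (s m) (-1) (s n)) \<le> c * (e / 2)\<^sup>2"
        using cauchy[of "c * (e / 2)\<^sup>2"] c(1) by auto
      have "norm (s m w - s n w) < e" if "m \<ge> N" "n \<ge> N" for m n
      proof -
        have "c * (cmod (s m w - s n w))\<^sup>2 \<le> c * (e / 2)\<^sup>2"
          using c(2)[OF fock_lincomb[OF s s], of 1 m "-1" n] N[OF that] by (simp add: lincomb_def)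
        then have "(cmod (s m w - s n w))\<^sup>2 \<le> (e / 2)\<^sup>2" using c(1) by simp
        then have "cmod (s m w - s n w) \<le> e / 2" by (rule power2_le_imp_le) (use e in simp)
        then show ?thesis using e by simp
      qed
      then show "\<exists>M. \<forall>m\<ge>M. \<forall>n\<ge>M. norm (s m w - s n w) < e" by blast
    qed
    then show ?thesis by (simp add: Cauchy_convergent_iff)
  qed
  then obtain v where v: "\<And>w. (\<lambda>n. s n w) \<longlonglongrightarrow> v w"
    unfolding convergent_def by metis
  \<comment> \<open>For finitely many degrees the Cauchy bound passes to the coefficientwise limit
    \<open>v\<close>; letting the number of degrees grow gives both membership and the norm
    estimate.\<close>
  have diff: "\<exists>N. \<forall>m\<ge>N. lincomb 1 (s m) (-1) v \<in> fock q \<and> F.nsq (lincomb 1 (s m) (-1) v) \<le> e" if "0 < e" for e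
  proof -
    obtain N where N: "\<And>m n. m \<ge> N \<Longrightarrow> n \<ge> N \<Longrightarrow> F.nsq (lincomb 1 (s m) (-1) (s n)) \<le> e"
      using cauchy[OF \<open>0 < e\<close>] by blast
    have "lincomb 1 (s m) (-1) v \<in> fock q \<and> F.nsq (lincomb 1 (s m) (-1) v) \<le> e" if m: "m \<ge> N" for m
    proof -
      have part: "(\<Sum>n<M. dsq n (lincomb 1 (s m) (-1) v)) \<le> e" for M
      proof (rule LIMSEQ_le_const2)
        show "(\<lambda>k. \<Sum>n<M. dsq n (lincomb 1 (s m) (-1) (s k))) \<longlonglongrightarrow> (\<Sum>n<M. dsq n (lincomb 1 (s m) (-1) v))"
        proof (intro tendsto_sum dsq_tendsto)
          show "(\<lambda>k. lincomb 1 (s m) (-1) (s k) w) \<longlonglongrightarrow> lincomb 1 (s m) (-1) v w" for w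
            unfolding lincomb_def by (intro tendsto_intros v)
        qed
        have "(\<Sum>n<M. dsq n (lincomb 1 (s m) (-1) (s k))) \<le> e" if "k \<ge> N" for k
          using sum_dsq_le_nsq[OF fock_lincomb[OF s s]] N[OF m that] order_trans by blast
        then show "\<exists>N. \<forall>k\<ge>N. (\<Sum>n<M. dsq n (lincomb 1 (s m) (-1) (s k))) \<le> e" by blast
      qed
      have f: "lincomb 1 (s m) (-1) v \<in> fock q" by (rule fockI[OF part])
      then have "F.nsq (lincomb 1 (s m) (-1) v) \<le> e"
        unfolding nsq_eq[OF f] using part summable_dsq by (intro suminf_le_const) auto
      with f show ?thesis by blast
    qed
    then show ?thesis by blast
  qed
  have "v \<in> fock q"
  proof -
    obtain m where "lincomb 1 (s m) (-1) v \<in> fock q" using diff[of 1] by auto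
    from fock_lincomb[OF s this, of 1 m "-1"] show ?thesis by (simp add: lincomb_def)
  qed
  moreover have "(\<lambda>n. F.nsq (lincomb 1 (s n) (-1) v)) \<longlonglongrightarrow> 0"
  proof (rule LIMSEQ_I)
    fix e :: real assume "0 < e"
    then obtain N where "\<And>m. m \<ge> N \<Longrightarrow> lincomb 1 (s m) (-1) v \<in> fock q \<and> F.nsq (lincomb 1 (s m) (-1) v) \<le> e / 2"
      using diff[of "e / 2"] by auto
    with \<open>0 < e\<close> show "\<exists>N. \<forall>n\<ge>N. norm (F.nsq (lincomb 1 (s n) (-1) v) - 0) < e"
      using F.nsq_nonneg by (intro exI[of _ N]) fastforce
  qed
  ultimately show "\<exists>v. F.nconv s v \<and> (\<forall>w. (\<lambda>n. s n w) \<longlonglongrightarrow> v w)"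
    using s v unfolding F.nconv_def by blast
qed

text \<open>The creation operator is bounded degree by degree because \<open>a a\<^sup>* = 1 + q a\<^sup>* a\<close>:
  a bound \<open>C\<close> in degree \<open>n\<close> gives the bound \<open>1 + q C\<close> in degree \<open>n + 1\<close>.\<close>

lemma dsq_ann_le_of_cre:
  assumes "\<And>u. dsq (Suc n) (cre i u) \<le> C * dsq n u" "0 \<le> C"
  shows "dsq n (ann q i u) \<le> C * dsq (Suc n) u"
proof -
  let ?a = "dsq n (ann q i u)"
  \<comment> \<open>The squared norm of \<open>a u\<close> is
    \<open>\<langle>a\<^sup>* a u, u\<rangle>\<close>; Cauchy-Schwarz and the bound on
    \<open>a\<^sup>*\<close> leave one factor of it to cancel.\<close>
  have "qip_deg q (cre i (ann q i u)) u (Suc n) = of_real ?a"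
    by (metis D.ip_self D.nsq_def UNIV_I qip_deg_cre)
  then have "?a\<^sup>2 \<le> dsq (Suc n) (cre i (ann q i u)) * dsq (Suc n) u"
    using D.Cauchy_Schwarz[where u = "cre i (ann q i u)" and v = u and n = "Suc n"] by (simp add: D.nsq_def)
  also have "\<dots> \<le> (C * ?a) * dsq (Suc n) u"
    using assms(1) dsq_nonneg by (intro mult_right_mono)
  finally have "?a * ?a \<le> ?a * (C * dsq (Suc n) u)"
    by (simp add: power2_eq_square mult_ac)
  then show ?thesis
    using dsq_nonneg[of "ann q i u" n] assms(2) dsq_nonneg[of u "Suc n"]
    by (cases "?a = 0") (auto simp: mult_le_cancel_left)
qed

text \<open>The constant \<open>1 / (1 - q)\<close> is the fixed point of
  \<open>C = 1 + q C\<close>, so one bound serves all degrees.\<close>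

lemma dsq_cre_le: "dsq (Suc n) (cre i u) \<le> 1 / (1 - q) * dsq n u"
proof (induction n arbitrary: u)
  case 0
  have "qip_deg q (cre i u) (cre i u) (Suc 0) = qip_deg q u u 0 + of_real q * qip_deg q u (cre i (ann q i u)) 0"
    by (simp add: qip_deg_cre ann_cre qip_deg_lincomb_right)
  also have "qip_deg q u (cre i (ann q i u)) 0 = 0"
    using D.ip_cnj[where u = "cre i (ann q i u)" and v = u and n = 0] by (simp add: qip_deg_cre_0)
  finally have "dsq (Suc 0) (cre i u) = 1 * dsq 0 u" by simp
  also have "\<dots> \<le> 1 / (1 - q) * dsq 0 u"
    using q_pos q_less by (intro mult_right_mono dsq_nonneg) simp
  finally show ?case .
next
  case (Suc n)
  have "qip_deg q (cre i u) (cre i u) (Suc (Suc n))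
      = qip_deg q u u (Suc n) + of_real q * qip_deg q u (cre i (ann q i u)) (Suc n)"
    by (simp add: qip_deg_cre[of _ _ _ _ "Suc n"] ann_cre qip_deg_lincomb_right)
  also have "qip_deg q u (cre i (ann q i u)) (Suc n) = of_real (dsq n (ann q i u))"
    by (metis D.ip_cnj D.ip_self D.nsq_def UNIV_I complex_cnj_complex_of_real qip_deg_cre)
  finally have "dsq (Suc (Suc n)) (cre i u) = dsq (Suc n) u + q * dsq n (ann q i u)" by simp
  also have "\<dots> \<le> dsq (Suc n) u + q * (1 / (1 - q) * dsq (Suc n) u)"
    using q_pos q_less Suc.IH by (intro add_left_mono mult_left_mono dsq_ann_le_of_cre) auto
  also have "\<dots> = 1 / (1 - q) * dsq (Suc n) u"
    using q_less by (simp add: field_simps)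
  finally show ?case .
qed

lemma dsq_ann_le: "dsq n (ann q i u) \<le> 1 / (1 - q) * dsq (Suc n) u"
  using q_less by (intro dsq_ann_le_of_cre dsq_cre_le) auto

section \<open>Boundedness and adjointness on the completed space\<close>

lemma cre_fock:
  assumes u: "u \<in> fock q"
  shows "cre i u \<in> fock q" "F.nsq (cre i u) \<le> 1 / (1 - q) * F.nsq u"
proof -
  have sum: "summable (\<lambda>n. 1 / (1 - q) * dsq n u)" using u by (intro summable_mult summable_dsq)
  have S: "summable (\<lambda>n. dsq (Suc n) (cre i u))"
    by (rule summable_comparison_test'[OF sum, of 0])
      (use dsq_cre_le dsq_nonneg in \<open>simp only: real_norm_def abs_of_nonneg\<close>)
  then show f: "cre i u \<in> fock q"
    unfolding fock_def mem_Collect_eq by (rule summable_Suc_iff[THEN iffD1])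
  have "F.nsq (cre i u) = (\<Sum>n. dsq (Suc n) (cre i u))"
    using suminf_split_head[OF summable_dsq[OF f]] by (simp add: nsq_eq[OF f] qip_deg_cre_0)
  also have "\<dots> \<le> (\<Sum>n. 1 / (1 - q) * dsq n u)"
    using sum S dsq_cre_le by (intro suminf_le)
  also have "\<dots> = 1 / (1 - q) * F.nsq u"
    using u by (simp only: nsq_eq suminf_mult summable_dsq)
  finally show "F.nsq (cre i u) \<le> 1 / (1 - q) * F.nsq u" .
qed

lemma ann_fock:
  assumes u: "u \<in> fock q"
  shows "ann q i u \<in> fock q" "F.nsq (ann q i u) \<le> 1 / (1 - q) * F.nsq u"
proof -
  have S: "summable (\<lambda>n. dsq (Suc n) u)" using summable_dsq[OF u] by (rule summable_Suc_iff[THEN iffD2])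
  then have sum: "summable (\<lambda>n. 1 / (1 - q) * dsq (Suc n) u)" by (rule summable_mult)
  show f: "ann q i u \<in> fock q"
    unfolding fock_def mem_Collect_eq
    by (rule summable_comparison_test'[OF sum, of 0])
      (use dsq_ann_le dsq_nonneg in \<open>simp only: real_norm_def abs_of_nonneg\<close>)
  have "F.nsq (ann q i u) \<le> (\<Sum>n. 1 / (1 - q) * dsq (Suc n) u)"
    unfolding nsq_eq[OF f] using sum f summable_dsq dsq_ann_le by (intro suminf_le) auto
  also have "\<dots> = 1 / (1 - q) * (\<Sum>n. dsq (Suc n) u)"
    using S by (rule suminf_mult)
  also have "\<dots> \<le> 1 / (1 - q) * F.nsq u"
    using suminf_split_head[OF summable_dsq[OF u]] dsq_nonneg[of u 0] q_less
    by (intro mult_left_mono) (simp_all add: nsq_eq[OF u])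
  finally show "F.nsq (ann q i u) \<le> 1 / (1 - q) * F.nsq u" .
qed

lemma qip_cre: "u \<in> fock q \<Longrightarrow> v \<in> fock q \<Longrightarrow> qip q (cre i u) v = qip q u (ann q i v)"
  using suminf_split_head[OF summable_qip_deg[OF cre_fock(1)], of u v i]
  by (simp add: qip_def qip_deg_cre_0 qip_deg_cre)

lemma qip_ann: "u \<in> fock q \<Longrightarrow> v \<in> fock q \<Longrightarrow> qip q (ann q i u) v = qip q u (cre i v)"
  using qip_cre[of v u i] F.ip_cnj[of "ann q i u" v] F.ip_cnj[of u "cre i v"]
  by (simp add: ann_fock cre_fock)

lemma Xop_in: "v \<in> fock q \<Longrightarrow> Xop q i v \<in> fock q"
  by (simp add: Xop_eq fock_lincomb ann_fock cre_fock)

lemma Xop_sym: "u \<in> fock q \<Longrightarrow> v \<in> fock q \<Longrightarrow> qip q u (Xop q i v) = qip q (Xop q i u) v"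
  by (simp add: Xop_eq F.ip_lincomb_right F.ip_lincomb_left ann_fock cre_fock qip_cre qip_ann)

lemma Xop_bound: "v \<in> fock q \<Longrightarrow> F.nsq (Xop q i v) \<le> 4 / (1 - q) * F.nsq v"
  using F.nsq_lincomb_le[OF ann_fock(1) cre_fock(1), of v v 1 i 1 i]
    ann_fock(2)[of v i] cre_fock(2)[of v i] by (simp add: Xop_eq)

lemma sym_op_Xop:
  assumes "0 < R" "4 / (1 - q) \<le> R\<^sup>2"
  shows "sym_op (fock q) (qip q) (Xop q i) R"
proof unfold_locales
  show "F.nsq (Xop q i v) \<le> R\<^sup>2 * F.nsq v" if "v \<in> fock q" for v
    using Xop_bound[OF that, of i] mult_right_mono[OF assms(2) F.nsq_nonneg[OF that]] by linarith
qed (auto simp: Xop_in Xop_lincomb Xop_sym assms)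

lemma sym_op_add:
  assumes "sym_op (fock q) (qip q) S A" "sym_op (fock q) (qip q) S' A'"
  shows "sym_op (fock q) (qip q) (\<lambda>v w. S v w + S' v w) (2 * (A + A'))"
proof -
  interpret S: sym_op "fock q" "qip q" S A by fact
  interpret S': sym_op "fock q" "qip q" S' A' by fact
  have eq: "(\<lambda>w. S v w + S' v w) = lincomb 1 (S v) 1 (S' v)" for v
    by (simp add: lincomb_def)
  show ?thesis
    unfolding eq
  proof unfold_locales
    show "F.nsq (lincomb 1 (S v) 1 (S' v)) \<le> (2 * (A + A'))\<^sup>2 * F.nsq v" if v: "v \<in> fock q" for v
    proof -
      have "F.nsq (lincomb 1 (S v) 1 (S' v)) \<le> 2 * F.nsq (S v) + 2 * F.nsq (S' v)"
        using F.nsq_lincomb_le[OF S.X_in[OF v] S'.X_in[OF v], of 1 1] by simp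
      also have "\<dots> \<le> 2 * (A\<^sup>2 * F.nsq v) + 2 * (A'\<^sup>2 * F.nsq v)"
        using S.X_bound[OF v] S'.X_bound[OF v] by linarith
      also have "\<dots> = (2 * A\<^sup>2 + 2 * A'\<^sup>2) * F.nsq v" by (simp add: algebra_simps)
      also have "\<dots> \<le> (2 * (A + A'))\<^sup>2 * F.nsq v"
        using S.R_pos S'.R_pos by (intro mult_right_mono F.nsq_nonneg v) (simp add: power2_eq_square algebra_simps)
      finally show ?thesis .
    qed
    show "lincomb 1 (S (lincomb a u b v)) 1 (S' (lincomb a u b v))
        = lincomb a (lincomb 1 (S u) 1 (S' u)) b (lincomb 1 (S v) 1 (S' v))"
      if "u \<in> fock q" "v \<in> fock q" for u v a b
      using that by (simp add: S.X_lincomb S'.X_lincomb) (simp add: lincomb_def fun_eq_iff algebra_simps)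
  qed (auto simp: S.X_in S'.X_in F.lincomb_in F.ip_lincomb_right F.ip_lincomb_left S.X_sym S'.X_sym
      S.R_pos S'.R_pos add_pos_pos)
qed

end

subsection \<open>Vectors without or with exactly one factor \<open>f\<^sub>1\<close>\<close>

text \<open>Each step of the recursion deletes the same letter from both words. Hence the number of
  letters \<open>f\<^sub>1\<close> is an orthogonal grading.\<close>

lemma qgram_count_list: "qgram q as bs \<noteq> 0 \<Longrightarrow> count_list as x = count_list bs x"
proof (induction as arbitrary: bs)
  case Nil
  then show ?case by (auto split: if_splits)
next
  case (Cons a as)
  have len: "length bs = Suc (length as)"
    using Cons.prems by (auto split: if_splits)
  have "\<exists>k<length bs. bs ! k = a \<and> qgram q as (take k bs @ drop (Suc k) bs) \<noteq> 0"
  proof (rule ccontr)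
    assume "\<not> ?thesis"
    then have "(\<Sum>k<length bs. if bs ! k = a then q ^ k * qgram q as (take k bs @ drop (Suc k) bs) else 0) = 0"
      by (intro sum.neutral) auto
    then show False using Cons.prems len by simp
  qed
  then obtain k where k: "k < length bs" "bs ! k = a" "qgram q as (take k bs @ drop (Suc k) bs) \<noteq> 0"
    by blast
  have "count_list bs x = count_list (take k bs @ bs ! k # drop (Suc k) bs) x"
    using id_take_nth_drop[OF k(1)] by simp
  also have "\<dots> = count_list (a # take k bs @ drop (Suc k) bs) x"
    by (simp add: k(2))
  finally show ?case using Cons.IH[OF k(3)] by simp
qed

lemma qip_count_orthogonal:
  assumes "\<And>w w'. u w \<noteq> 0 \<Longrightarrow> v w' \<noteq> 0 \<Longrightarrow> count_list w True \<noteq> count_list w' True"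
  shows "qip q u v = 0"
proof -
  have zero: "cnj (u w) * v w' * of_real (qgram q w w') = 0" for w w'
    using assms[of w w'] qgram_count_list[of q w w' True] by auto
  show ?thesis by (simp only: qip_def qip_deg_def zero sum.neutral_const suminf_zero)
qed

lemma qip_deg_vac: "qip_deg q vac v n = (if n = 0 then v [] else 0)"
proof (cases n)
  case (Suc m)
  then have "vac w = 0" if "length w = n" for w using that by (auto simp: vac_def)
  then show ?thesis using Suc by (simp add: qip_deg_def)
qed (simp add: qip_deg_def vac_def)

lemma qip_vac: "qip q vac v = v []"
  using suminf_finite[of "{0}" "\<lambda>n. qip_deg q vac v n"] by (simp add: qip_def qip_deg_vac)

lemma vac_in_fock: "vac \<in> fock q"
  unfolding fock_def mem_Collect_eq by (rule summable_finite[of "{0}"]) (auto simp: qip_deg_vac)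

lemma ann_vac: "ann q i vac = (\<lambda>_. 0)"
  by (simp add: ann_def vac_def)

lemma ann_cre_vac: "ann q i (cre i vac) = vac"
  by (simp add: ann_cre ann_vac) (simp add: lincomb_def cre_def fun_eq_iff split: list.split)

lemma Xop_vac: "Xop q i vac = cre i vac"
  by (simp add: Xop_def ann_vac)

definition f0_only :: "(bool list \<Rightarrow> complex) \<Rightarrow> bool" where
  "f0_only v \<longleftrightarrow> (\<forall>w. True \<in> set w \<longrightarrow> v w = 0)"

lemma f0_only_count: "f0_only v \<Longrightarrow> v w \<noteq> 0 \<Longrightarrow> count_list w True = 0"
  by (auto simp: f0_only_def count_list_0_iff)

lemma f0_only_vac: "f0_only vac"
  by (auto simp: f0_only_def vac_def)

lemma f0_only_lincomb: "f0_only u \<Longrightarrow> f0_only v \<Longrightarrow> f0_only (lincomb a u b v)"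
  by (simp add: f0_only_def lincomb_def)

lemma f0_only_Xop: "f0_only v \<Longrightarrow> f0_only (Xop q False v)"
  unfolding f0_only_def
proof (intro allI impI)
  fix w :: "bool list"
  assume v: "\<forall>w. True \<in> set w \<longrightarrow> v w = 0" and w: "True \<in> set w"
  have "True \<in> set (take k w @ False # drop k w)" for k
    using w append_take_drop_id[of k w] by (metis Un_iff list.set_intros(2) set_append)
  then have "ann q False v w = 0" using v by (simp add: ann_def)
  moreover have "cre False v w = 0" using v w by (cases w) (auto simp: cre_def)
  ultimately show "Xop q False v w = 0" by (simp add: Xop_def)
qed

lemma ann_True_f0_only: "f0_only v \<Longrightarrow> ann q True v = (\<lambda>_. 0)"
  by (auto simp: ann_def f0_only_def fun_eq_iff intro!: sum.neutral)

text \<open>Creation of \<open>f\<^sub>1\<close> at the right end, away from the end at which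
  \<open>cre\<close> acts.\<close>

definition tensor_f1 :: "(bool list \<Rightarrow> complex) \<Rightarrow> bool list \<Rightarrow> complex" where
  "tensor_f1 v = (\<lambda>w. if w \<noteq> [] \<and> last w then v (butlast w) else 0)"

lemma tensor_f1_simps [simp]:
  "tensor_f1 v [] = 0" "tensor_f1 v (x @ [b]) = (if b then v x else 0)"
  by (auto simp: tensor_f1_def)

lemma tensor_f1_lincomb: "tensor_f1 (lincomb a u b v) = lincomb a (tensor_f1 u) b (tensor_f1 v)"
  by (auto simp: tensor_f1_def lincomb_def)

lemma cre_vac_eq_tensor_f1: "cre True vac = tensor_f1 vac"
proof
  show "cre True vac w = tensor_f1 vac w" for w
    by (cases w) (auto simp: cre_def vac_def tensor_f1_def)
qed

text \<open>Creation acts on the other end, and annihilating \<open>f\<^sub>0\<close> never removes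
  the final \<open>f\<^sub>1\<close> while the weights of the earlier positions stay the same. The
  insertion after the last letter drops out because the resulting word ends in
  \<open>f\<^sub>0\<close>.\<close>

lemma Xop_tensor_f1: "Xop q False (tensor_f1 v) = tensor_f1 (Xop q False v)"
proof
  fix w
  show "Xop q False (tensor_f1 v) w = tensor_f1 (Xop q False v) w"
  proof (cases w rule: rev_cases)
    case Nil
    have "[False] = [] @ [False]" by simp
    then have "tensor_f1 v [False] = 0" by (metis tensor_f1_simps(2))
    then show ?thesis using Nil by (simp add: Xop_def ann_def cre_def)
  next
    case (snoc x b)
    have "tensor_f1 v (take k (x @ [b]) @ False # drop k (x @ [b]))
        = (if b then v (take k x @ False # drop k x) else 0)" if "k \<le> length x" for k
    proof -
      have "take k (x @ [b]) @ False # drop k (x @ [b]) = (take k x @ False # drop k x) @ [b]"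
        using that by simp
      then show ?thesis by (simp only: tensor_f1_simps)
    qed
    moreover have "tensor_f1 v (x @ [b, False]) = 0"
      using tensor_f1_simps(2)[of v "x @ [b]" False] by simp
    ultimately have "ann q False (tensor_f1 v) (x @ [b]) = (if b then ann q False v x else 0)"
      by (simp add: ann_def)
    moreover have "cre False (tensor_f1 v) (x @ [b]) = (if b then cre False v x else 0)"
      by (cases x) (auto simp: cre_def)
    ultimately show ?thesis using snoc by (simp add: Xop_def)
  qed
qed

text \<open>The only letter \<open>f\<^sub>1\<close> is the last one, and removing it costs
  \<open>q\<close> for every letter in front.\<close>

lemma ann_tensor_f1:
  assumes "f0_only v"
  shows "ann q True (tensor_f1 v) = (\<lambda>w. of_real (q ^ length w) * v w)"
proof
  fix w
  have zero: "tensor_f1 v (take k w @ True # drop k w) = 0" if "k < length w" for k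
  proof -
    have "drop k w \<noteq> []" using that by simp
    then obtain y b where y: "drop k w = y @ [b]"
      by (metis append_butlast_last_id)
    have "tensor_f1 v ((take k w @ True # y) @ [b]) = 0"
      using assms by (auto simp only: tensor_f1_simps f0_only_def) simp
    then show ?thesis by (simp add: y)
  qed
  have "ann q True (tensor_f1 v) w
      = (\<Sum>k\<in>{length w}. of_real (q ^ k) * tensor_f1 v (take k w @ True # drop k w))"
    unfolding ann_def by (rule sum.mono_neutral_right) (auto simp: zero)
  then show "ann q True (tensor_f1 v) w = of_real (q ^ length w) * v w" by simp
qed

lemma qip_deg_scale_degree:
  "qip_deg q u (\<lambda>w. of_real (r ^ length w) * v w) n = of_real (r ^ n) * qip_deg q u v n"
  unfolding qip_deg_def sum_distrib_left by (intro sum.cong refl) simp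

subsection \<open>The fourth moment\<close>

context q_fock
begin

text \<open>Moving the left creation to the other side annihilates the right-hand
  \<open>f\<^sub>1\<close>, leaving \<open>\<langle>v, q\<^sup>N v\<rangle>\<close> with
  \<open>N\<close> the degree operator.\<close>

lemma qip_cre_tensor_f1:
  assumes "v \<in> fock q" "tensor_f1 v \<in> fock q" "f0_only v"
  shows "Re (qip q (tensor_f1 v) (cre True v)) = (\<Sum>n. q ^ n * dsq n v)"
proof -
  have sm: "summable (\<lambda>n. of_real (q ^ n) * qip_deg q v v n)"
    using summable_qip_deg[OF assms(1) ann_fock(1)[OF assms(2)], of True]
    by (simp only: ann_tensor_f1[OF assms(3)] qip_deg_scale_degree)
  have "Re (qip q (tensor_f1 v) (cre True v)) = Re (qip q (cre True v) (tensor_f1 v))"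
    using F.ip_cnj[OF cre_fock(1)[OF assms(1)] assms(2), of True] by simp
  also have "\<dots> = Re (\<Sum>n. of_real (q ^ n) * qip_deg q v v n)"
    using assms by (simp only: qip_cre ann_tensor_f1[OF assms(3)]) (simp only: qip_def qip_deg_scale_degree)
  also have "\<dots> = (\<Sum>n. Re (of_real (q ^ n) * qip_deg q v v n))"
    using sm by (rule bounded_linear.suminf[OF bounded_linear_Re])
  finally show "Re (qip q (tensor_f1 v) (cre True v)) = (\<Sum>n. q ^ n * dsq n v)"
    by (simp del: of_real_power)
qed

text \<open>Splitting \<open>(S + X\<^sub>1)\<^sup>2 \<Omega>\<close> by the number of letters \<open>f\<^sub>1\<close> leaves \<open>\<langle>S f\<^sub>1, f\<^sub>1 \<otimes> S \<Omega>\<rangle>\<close> as the only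
  contribution that is not a moment of \<open>S\<close> alone.\<close>

lemma fourth_moment:
  assumes S: "sym_op (fock q) (qip q) S A"
    and f0: "\<And>v. v \<in> fock q \<Longrightarrow> f0_only v \<Longrightarrow> f0_only (S v)"
    and tensor: "S (cre True vac) = tensor_f1 (S vac)"
  shows "Re (qip q vac (((\<lambda>v w. S v w + Xop q True v w) ^^ 4) vac))
     = Re (qip q vac ((S ^^ 4) vac)) + 3 * Re (qip q vac ((S ^^ 2) vac))
       + Re (qip q (cre True vac) ((S ^^ 2) (cre True vac)))
       + F.nsq (Xop q True (cre True vac)) + 2 * (\<Sum>n. q ^ n * dsq n (S vac))"
proof -
  interpret S: sym_op "fock q" "qip q" S A by fact
  obtain B where B: "0 < B" "4 / (1 - q) \<le> B\<^sup>2"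
    using q_less by (intro that[of "sqrt (4 / (1 - q))"]) auto
  let ?X = "Xop q True" and ?Y = "\<lambda>v w. S v w + Xop q True v w"
  interpret X: sym_op "fock q" "qip q" ?X B by (rule sym_op_Xop[OF B])
  interpret Y: sym_op "fock q" "qip q" ?Y "2 * (A + B)"
    by (intro sym_op_add S.sym_op_axioms X.sym_op_axioms)
  define \<xi> f1 where "\<xi> = S vac" and "f1 = cre True vac"
  have in_fock: "vac \<in> fock q" "\<xi> \<in> fock q" "f1 \<in> fock q" "S \<xi> \<in> fock q" "S f1 \<in> fock q"
    "?X f1 \<in> fock q" "?X \<xi> \<in> fock q" "cre True \<xi> \<in> fock q" "cre True f1 \<in> fock q"
    by (simp_all add: \<xi>_def f1_def vac_in_fock cre_fock S.X_in Xop_in)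
  have f0_\<xi>: "f0_only \<xi>" "f0_only (S \<xi>)"
    using f0[OF in_fock(1) f0_only_vac] f0[OF in_fock(2)] by (simp_all add: \<xi>_def)
  have X\<xi>: "?X \<xi> = cre True \<xi>"
    by (simp add: Xop_def ann_True_f0_only[OF f0_\<xi>(1)])
  have ann_f1: "ann q True f1 = vac"
    by (simp add: f1_def ann_cre_vac)
  have Xf1: "?X f1 = lincomb 1 vac 1 (cre True f1)"
    by (simp add: Xop_eq ann_f1)
  \<comment> \<open>The squared operator applied to the vacuum is \<open>E + O'\<close>:
    \<open>E\<close> carries zero or two letters \<open>f\<^sub>1\<close>, \<open>O'\<close> exactly
    one, so they are orthogonal.\<close>
  define E where "E = lincomb 1 (S \<xi>) 1 (?X f1)"
  define O' where "O' = lincomb 1 (S f1) 1 (cre True \<xi>)"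
  have EO: "E \<in> fock q" "O' \<in> fock q"
    using in_fock by (simp_all add: E_def O'_def fock_lincomb)
  have "?Y vac = lincomb 1 \<xi> 1 f1"
    by (simp add: \<xi>_def f1_def Xop_vac lincomb_def)
  moreover have "S (lincomb 1 \<xi> 1 f1) = lincomb 1 (S \<xi>) 1 (S f1)"
    "?X (lincomb 1 \<xi> 1 f1) = lincomb 1 (?X \<xi>) 1 (?X f1)"
    using in_fock by (simp_all only: S.X_lincomb Xop_lincomb)
  ultimately have YY: "?Y (?Y vac) = lincomb 1 E 1 O'"
    by (simp add: E_def O'_def X\<xi>) (simp add: lincomb_def fun_eq_iff)
  have "qip q vac ((?Y ^^ 4) vac) = qip q ((?Y ^^ 2) vac) ((?Y ^^ 2) vac)"
    using Y.funpow_sym[OF vac_in_fock Y.funpow_in[OF vac_in_fock], of 2 2]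
    by (simp add: numeral_eq_Suc)
  also have "(?Y ^^ 2) vac = lincomb 1 E 1 O'"
    using YY by (simp add: numeral_2_eq_2)
  finally have main: "Re (qip q vac ((?Y ^^ 4) vac)) = F.nsq (lincomb 1 E 1 O')"
    by (simp add: F.nsq_def)
  have Sf1: "S f1 = tensor_f1 \<xi>" using tensor by (simp add: f1_def \<xi>_def)
  have cnt_cre: "cre True v w \<noteq> 0 \<Longrightarrow> (\<And>w. v w \<noteq> 0 \<Longrightarrow> count_list w True = c) \<Longrightarrow> count_list w True = Suc c"
    for v w c by (cases w) (auto simp: cre_def split: if_splits)
  have cnt_f1: "f1 w \<noteq> 0 \<Longrightarrow> count_list w True = 1" for w
    unfolding f1_def using cnt_cre[of vac w 0] f0_only_count[OF f0_only_vac] by simp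
  have cnt_f1f1: "cre True f1 w \<noteq> 0 \<Longrightarrow> count_list w True = 2" for w
    using cnt_cre[of f1 w 1] cnt_f1 by simp
  have cnt_tensor: "tensor_f1 \<xi> w \<noteq> 0 \<Longrightarrow> count_list w True = 1" for w
    by (cases w rule: rev_cases) (auto split: if_splits simp: f0_only_count[OF f0_\<xi>(1)])
  have cnt_E: "count_list w True \<in> {0, 2}" if "E w \<noteq> 0" for w
  proof -
    have "S \<xi> w \<noteq> 0 \<or> vac w \<noteq> 0 \<or> cre True f1 w \<noteq> 0"
      using that by (auto simp: E_def Xf1 lincomb_def)
    then show ?thesis
      using f0_only_count[OF f0_\<xi>(2)] f0_only_count[OF f0_only_vac] cnt_f1f1 by blast
  qed
  have cnt_O: "count_list w True = 1" if "O' w \<noteq> 0" for w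
  proof -
    have "tensor_f1 \<xi> w \<noteq> 0 \<or> cre True \<xi> w \<noteq> 0"
      using that by (auto simp: O'_def Sf1 lincomb_def)
    then show ?thesis
      using cnt_tensor cnt_cre[of \<xi> w 0] f0_only_count[OF f0_\<xi>(1)] by auto
  qed
  have "qip q E O' = 0"
    using cnt_E cnt_O by (intro qip_count_orthogonal) force
  then have 1: "F.nsq (lincomb 1 E 1 O') = F.nsq E + F.nsq O'"
    using EO by (simp add: F.nsq_lincomb)
  \<comment> \<open>Only the vacuum component of \<open>X\<^sub>1 f\<^sub>1\<close> can meet
    \<open>S \<xi>\<close>, which gives the second moment of \<open>S\<close>.\<close>
  have "qip q (S \<xi>) (cre True f1) = 0"
    using f0_only_count[OF f0_\<xi>(2)] cnt_f1f1 by (intro qip_count_orthogonal) force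
  then have "Re (qip q (S \<xi>) (?X f1)) = Re (qip q vac (S \<xi>))"
    using in_fock F.ip_cnj[of vac "S \<xi>"] by (simp add: Xf1 F.ip_lincomb_right)
  moreover have "F.nsq (S \<xi>) = Re (qip q vac ((S ^^ 4) vac))"
    using S.funpow_sym[OF vac_in_fock S.funpow_in[OF vac_in_fock], of 2 2]
    by (simp add: numeral_eq_Suc F.nsq_def \<xi>_def)
  ultimately have 2: "F.nsq E = Re (qip q vac ((S ^^ 4) vac)) + F.nsq (?X f1) + 2 * Re (qip q vac ((S ^^ 2) vac))"
    using in_fock by (simp add: E_def F.nsq_lincomb numeral_2_eq_2 \<xi>_def)
  have nf1: "F.nsq (S f1) = Re (qip q f1 ((S ^^ 2) f1))"
    using S.X_sym[of f1 "S f1"] in_fock by (simp add: F.nsq_def numeral_2_eq_2)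
  have "ann q True (cre True \<xi>) = \<xi>"
    by (simp add: ann_cre ann_True_f0_only[OF f0_\<xi>(1)]) (simp add: lincomb_def cre_def fun_eq_iff split: list.split)
  then have "F.nsq (cre True \<xi>) = F.nsq \<xi>"
    using in_fock by (simp add: F.nsq_def qip_cre)
  moreover have "F.nsq \<xi> = Re (qip q vac ((S ^^ 2) vac))"
    using S.X_sym[of vac \<xi>] in_fock by (simp add: F.nsq_def numeral_2_eq_2 \<xi>_def)
  \<comment> \<open>The cross term of \<open>O'\<close>: here \<open>f\<^sub>1\<close> stands on the
    right in one vector and on the left in the other.\<close>
  moreover have "Re (qip q (S f1) (cre True \<xi>)) = (\<Sum>n. q ^ n * dsq n \<xi>)"
    using in_fock f0_\<xi> unfolding Sf1 by (intro qip_cre_tensor_f1) auto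
  ultimately have 3: "F.nsq O' = Re (qip q f1 ((S ^^ 2) f1)) + Re (qip q vac ((S ^^ 2) vac))
      + 2 * (\<Sum>n. q ^ n * dsq n \<xi>)"
    using in_fock nf1 by (simp add: O'_def F.nsq_lincomb)
  show ?thesis
    unfolding main 1 2 3 by (simp add: \<xi>_def f1_def)
qed

lemma dsq_0_1:
  assumes "f0_only v"
  shows "dsq 0 v = (cmod (v []))\<^sup>2" "dsq 1 v = (cmod (v [False]))\<^sup>2"
proof -
  have z: "v [True] = 0" using assms by (simp add: f0_only_def)
  have "qip_deg q v v 0 = of_real ((cmod (v []))\<^sup>2)"
    by (simp add: qip_deg_def complex_norm_square mult.commute del: of_real_power)
  then show "dsq 0 v = (cmod (v []))\<^sup>2" by simp
  have "qip_deg q v v (Suc 0) = cnj (v [False]) * v [False]"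
    unfolding qip_deg_def sum_words_Suc by (simp add: UNIV_bool z)
  also have "\<dots> = of_real ((cmod (v [False]))\<^sup>2)"
    by (simp only: complex_norm_square mult.commute)
  finally show "dsq 1 v = (cmod (v [False]))\<^sup>2" by simp
qed

text \<open>Degrees from two onwards have weight at most \<open>q\<^sup>2 < q\<close>, so any mass
  missing from degree one makes the weighted sum strictly smaller than \<open>q\<close>.\<close>

lemma weighted_dsq_less:
  assumes v: "v \<in> fock q" "F.nsq v = 1" and "dsq 0 v = 0" "dsq 1 v < 1"
  shows "(\<Sum>n. q ^ n * dsq n v) < q"
proof -
  have sums: "(\<lambda>n. dsq n v) sums 1"
    using summable_sums[OF summable_dsq[OF v(1)]] v by (simp add: nsq_eq)
  let ?b = "\<lambda>n. q\<^sup>2 * dsq n v + (if n = 1 then (q - q\<^sup>2) * dsq 1 v else 0)"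
  have b: "?b sums (q\<^sup>2 * 1 + (q - q\<^sup>2) * dsq 1 v)"
    by (intro sums_add sums_mult sums sums_single)
  have le: "q ^ n * dsq n v \<le> ?b n" for n
  proof -
    consider "n = 0" | "n = 1" | "n \<ge> 2" by linarith
    then show ?thesis
    proof cases
      case 3
      then have "q ^ n \<le> q\<^sup>2" using q_pos q_less by (intro power_decreasing) auto
      then show ?thesis using 3 dsq_nonneg by (simp add: mult_right_mono)
    qed (use assms(3) in \<open>simp_all add: algebra_simps\<close>)
  qed
  have "summable (\<lambda>n. q ^ n * dsq n v)"
    by (rule summable_comparison_test'[OF sums_summable[OF b], of 0])
      (use le q_pos dsq_nonneg in \<open>simp add: abs_mult\<close>)
  then have "(\<Sum>n. q ^ n * dsq n v) \<le> q\<^sup>2 * 1 + (q - q\<^sup>2) * dsq 1 v"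
    using le b by (metis (no_types, lifting) sums_iff suminf_le)
  also have "\<dots> < q\<^sup>2 * 1 + (q - q\<^sup>2) * 1"
    using assms(4) q_pos q_less
    by (intro add_strict_left_mono mult_strict_left_mono) (auto simp: power2_eq_square)
  finally show ?thesis by simp
qed

end

subsection \<open>The vacuum moments of \<open>X\<^sub>0\<close>\<close>

lemma Xop_replicate_0: "Xop q False v [] = v [False]"
  by (simp add: Xop_def ann_def cre_def)

text \<open>All insertions of \<open>f\<^sub>0\<close> into a power of \<open>f\<^sub>0\<close> give
  the same word, so annihilation multiplies by a q-integer. This is the three-term recursion of the
  q-Hermite polynomials.\<close>

lemma Xop_replicate_Suc:
  "Xop q False v (replicate (Suc n) False)
     = of_real (\<Sum>k\<le>Suc n. q ^ k) * v (replicate (Suc (Suc n)) False) + v (replicate n False)"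
proof -
  have "take k (replicate (Suc n) False) @ False # drop k (replicate (Suc n) False)
      = replicate (Suc (Suc n)) False" if "k \<le> Suc n" for k
    using that by (intro nth_equalityI) (auto simp: nth_append nth_Cons')
  then have "ann q False v (replicate (Suc n) False)
      = of_real (\<Sum>k\<le>Suc n. q ^ k) * v (replicate (Suc (Suc n)) False)"
    unfolding ann_def of_real_sum sum_distrib_right
    by (intro sum.cong) auto
  then show ?thesis by (simp add: Xop_def cre_def)
qed

text \<open>Each application changes the degree by one, so powers of \<open>X\<^sub>0\<close> on the
  vacuum have a fixed parity; in particular the odd moments vanish.\<close>

lemma Xop_funpow_vac_odd: "odd (n + length w) \<Longrightarrow> (Xop q False ^^ n) vac w = 0"
proof (induction n arbitrary: w)
  case 0
  then show ?case by (auto simp: vac_def)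
next
  case (Suc n)
  let ?v = "(Xop q False ^^ n) vac"
  have "ann q False ?v w = 0"
    unfolding ann_def using Suc by (intro sum.neutral) auto
  moreover have "cre False ?v w = 0"
    using Suc by (cases w) (auto simp: cre_def)
  ultimately show ?case by (simp add: Xop_def[of q False ?v])
qed

text \<open>These count pairings of two, four and six points by their crossings. The fourth moment
  is the origin of the threshold, and the sixth shows that \<open>t\<^sup>2\<close> is not constant
  under the weight \<open>t\<^sup>2\<close>.\<close>

lemma Xop_vac_moments:
  "((Xop q False ^^ 2) vac) [] = 1"
  "((Xop q False ^^ 4) vac) [] = of_real (2 + q)"
  "((Xop q False ^^ 6) vac) [] = of_real (5 + 6 * q + 3 * q\<^sup>2 + q ^ 3)"
proof -
  define c where "c n v = v (replicate n False)" for n and v :: "bool list \<Rightarrow> complex"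
  have c0: "c 0 (Xop q False v) = c (Suc 0) v" for v
    by (simp add: c_def Xop_replicate_0)
  have cS: "c (Suc n) (Xop q False v) = of_real (\<Sum>k\<le>Suc n. q ^ k) * c (Suc (Suc n)) v + c n v" for n v
    unfolding c_def by (rule Xop_replicate_Suc)
  have cv: "c 0 vac = 1" "c (Suc n) vac = 0" for n
    by (simp_all add: c_def vac_def)
  have "c 0 ((Xop q False ^^ 2) vac) = 1"
    by (simp add: numeral_eq_Suc c0 cS cv)
  then show "((Xop q False ^^ 2) vac) [] = 1" by (simp add: c_def)
  have "c 0 ((Xop q False ^^ 4) vac) = of_real (2 + q)"
    by (simp add: numeral_eq_Suc c0 cS cv)
  then show "((Xop q False ^^ 4) vac) [] = of_real (2 + q)" by (simp add: c_def)
  have "c 0 ((Xop q False ^^ 6) vac) = of_real (5 + 6 * q + 3 * q\<^sup>2 + q ^ 3)"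
    by (simp add: numeral_eq_Suc c0 cS cv) (simp add: algebra_simps)
  then show "((Xop q False ^^ 6) vac) [] = of_real (5 + 6 * q + 3 * q\<^sup>2 + q ^ 3)" by (simp add: c_def)
qed

subsection \<open>Polynomial approximation of a threshold function\<close>

text \<open>Bernoulli's inequality leaves the defect \<open>n * (x * K) ^ n\<close>, which tends to
  \<open>0\<close>.\<close>

lemma threshold_limit_below:
  fixes x :: real
  assumes "0 \<le> x" "x \<le> 1" "x * real K < 1"
  shows "(\<lambda>n. (1 - x ^ n) ^ (n * K ^ n)) \<longlonglongrightarrow> 1"
proof (rule tendsto_sandwich)
  have "1 - real n * (x * real K) ^ n \<le> (1 - x ^ n) ^ (n * K ^ n)" for n
    using Bernoulli_inequality[of "- (x ^ n)" "n * K ^ n"] assms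
    by (simp add: power_le_one power_mult_distrib mult_ac)
  then show "\<forall>\<^sub>F n in sequentially. 1 - real n * (x * real K) ^ n \<le> (1 - x ^ n) ^ (n * K ^ n)" by simp
  show "\<forall>\<^sub>F n in sequentially. (1 - x ^ n) ^ (n * K ^ n) \<le> 1"
    using assms by (simp add: power_le_one)
  have "(\<lambda>n. 1 - real n * (x * real K) ^ n) \<longlonglongrightarrow> 1 - 0"
    using assms by (intro tendsto_intros powser_times_n_limit_0) simp
  then show "(\<lambda>n. 1 - real n * (x * real K) ^ n) \<longlonglongrightarrow> 1" by simp
qed simp

text \<open>From \<open>1 - y \<le> exp (- y)\<close> the power \<open>K ^ n\<close> already brings
  the value below \<open>exp (-1)\<close>. The additional factor \<open>n\<close> in the exponent
  forces the limit \<open>0\<close> even at the threshold \<open>x * K = 1\<close>.\<close>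

lemma threshold_limit_above:
  fixes x :: real
  assumes "0 \<le> x" "x \<le> 1" "1 \<le> x * real K"
  shows "(\<lambda>n. (1 - x ^ n) ^ (n * K ^ n)) \<longlonglongrightarrow> 0"
proof (rule Lim_null_comparison)
  have "norm ((1 - x ^ n) ^ (n * K ^ n)) \<le> exp (-1) ^ n" for n
  proof -
    have x: "0 \<le> 1 - x ^ n" using assms by (simp add: power_le_one)
    have "1 - x ^ n \<le> exp (- (x ^ n))" using exp_ge_add_one_self[of "- (x ^ n)"] by simp
    then have "(1 - x ^ n) ^ (K ^ n) \<le> exp (- (x ^ n)) ^ (K ^ n)" using x by (intro power_mono)
    also have "\<dots> = exp (- ((x * real K) ^ n))"
      by (simp add: exp_of_nat_mult[symmetric] power_mult_distrib mult.commute)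
    also have "\<dots> \<le> exp (-1)" using one_le_power[OF assms(3)] by simp
    finally have "((1 - x ^ n) ^ (K ^ n)) ^ n \<le> exp (-1) ^ n" using x by (intro power_mono) auto
    then show ?thesis using x by (simp add: power_mult[symmetric] mult.commute)
  qed
  then show "\<forall>\<^sub>F n in sequentially. norm ((1 - x ^ n) ^ (n * K ^ n)) \<le> exp (-1) ^ n" by simp
  show "(\<lambda>n. exp (-1 :: real) ^ n) \<longlonglongrightarrow> 0" by (intro LIMSEQ_realpow_zero) auto
qed

text \<open>In the limit this is \<open>t\<close> times \<open>2 * 1 - 1\<close> or
  \<open>2 * 0 - 1\<close>, according to whether \<open>t\<^sup>2 / R\<^sup>2\<close> is below
  \<open>1 / K\<close>.\<close>

definition threshold_poly :: "real \<Rightarrow> nat \<Rightarrow> nat \<Rightarrow> real poly" where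
  "threshold_poly R K n =
     [:0, 1:] * (smult 2 ((1 - smult (1 / R\<^sup>2) [:0, 0, 1:] ^ n) ^ (n * K ^ n)) - 1)"

lemma poly_threshold_poly:
  "poly (threshold_poly R K n) t = t * (2 * (1 - (t\<^sup>2 / R\<^sup>2) ^ n) ^ (n * K ^ n) - 1)"
  by (simp add: threshold_poly_def power_divide power2_eq_square)

lemma threshold_poly_bound: "\<bar>t\<bar> \<le> R \<Longrightarrow> 0 < R \<Longrightarrow> \<bar>poly (threshold_poly R K n) t\<bar> \<le> R"
proof -
  assume t: "\<bar>t\<bar> \<le> R" and R: "0 < R"
  let ?y = "(1 - (t\<^sup>2 / R\<^sup>2) ^ n) ^ (n * K ^ n)"
  have "t\<^sup>2 / R\<^sup>2 \<le> 1" using power_mono[OF t, of 2] R by simp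
  then have "0 \<le> 1 - (t\<^sup>2 / R\<^sup>2) ^ n" "1 - (t\<^sup>2 / R\<^sup>2) ^ n \<le> 1"
    by (simp_all add: power_le_one)
  then have "0 \<le> ?y" "?y \<le> 1" by (auto intro: power_le_one)
  then have "\<bar>2 * ?y - 1\<bar> \<le> 1" by simp
  then have "\<bar>t\<bar> * \<bar>2 * ?y - 1\<bar> \<le> R * 1" using t R by (intro mult_mono) auto
  then show ?thesis by (simp add: poly_threshold_poly abs_mult)
qed

text \<open>The value \<open>0\<close> beyond \<open>R\<close> makes the function bounded on the
  whole line while keeping the flip on the interval that carries the spectral measures.\<close>

definition flip_above :: "real \<Rightarrow> real \<Rightarrow> real \<Rightarrow> real" where
  "flip_above s R t = (if \<bar>t\<bar> \<le> R then if t\<^sup>2 < s then t else - t else 0)"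

lemma flip_above_borel: "flip_above s R \<in> borel_measurable borel"
  unfolding flip_above_def[abs_def] by measurable

lemma flip_above_uminus: "flip_above s R (- t) = - flip_above s R t"
  by (simp add: flip_above_def)

lemma threshold_poly_limit:
  assumes R: "0 < R" "R\<^sup>2 = real K * s" and s: "0 < s" and t: "\<bar>t\<bar> \<le> R"
  shows "(\<lambda>n. poly (threshold_poly R K n) t) \<longlonglongrightarrow> flip_above s R t"
proof -
  let ?x = "t\<^sup>2 / R\<^sup>2"
  have K: "0 < real K" using R s by (metis mult_eq_0_iff of_nat_0_less_iff gr0I of_nat_0 zero_less_power less_irrefl)
  have x: "0 \<le> ?x" "?x \<le> 1" using power_mono[OF t, of 2] R(1) by simp_all
  have xK: "?x * real K = t\<^sup>2 / s" using R s K by (simp add: field_simps)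
  show ?thesis
  proof (cases "t\<^sup>2 < s")
    case True
    then have "?x * real K < 1" unfolding xK using s by simp
    from threshold_limit_below[OF x this]
    have "(\<lambda>n. t * (2 * (1 - ?x ^ n) ^ (n * K ^ n) - 1)) \<longlonglongrightarrow> t * (2 * 1 - 1)"
      by (intro tendsto_intros)
    then show ?thesis using True t by (simp add: poly_threshold_poly flip_above_def)
  next
    case False
    then have "1 \<le> ?x * real K" unfolding xK using s by simp
    from threshold_limit_above[OF x this]
    have "(\<lambda>n. t * (2 * (1 - ?x ^ n) ^ (n * K ^ n) - 1)) \<longlonglongrightarrow> t * (2 * 0 - 1)"
      by (intro tendsto_intros)
    then show ?thesis using False t by (simp add: poly_threshold_poly flip_above_def)
  qed
qed

context q_fock
begin

text \<open>The integral is at most \<open>\<integral> t\<^sup>2 = 1\<close> in absolute value, and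
  equality means \<open>\<gamma> t = t\<close> almost everywhere or \<open>\<gamma> t = - t\<close>
  almost everywhere. Either would give \<open>t\<^sup>2 (t\<^sup>2 - s)\<close> a constant sign;
  \<open>c = 1\<close> and \<open>c = -1\<close> treat the two cases at once.\<close>

lemma flip_not_extremal:
  fixes R :: real
  assumes X: "sym_op (fock q) (qip q) (Xop q False) R"
    and mu: "spectral_measure q (Xop q False) vac mu"
  defines "\<gamma> \<equiv> flip_above (2 + q) R"
  shows "\<bar>\<integral>t. t * \<gamma> t \<partial>mu\<bar> < 1"
proof -
  interpret X: sym_op "fock q" "qip q" "Xop q False" R by fact
  have mu': "X.spectral vac mu" using mu by (simp add: X.spectral_def spectral_measure_def)
  have sets [measurable_cong]: "sets mu = sets borel" using mu' by (rule X.spectral_sets)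
  have [measurable]: "\<gamma> \<in> borel_measurable borel" by (simp add: \<gamma>_def flip_above_borel)
  have int [simp]: "integrable mu (\<lambda>t. t ^ n)" for n
    using mu' by (simp add: X.spectral_def)
  have mom: "complex_of_real (\<integral>t. t ^ n \<partial>mu) = ((Xop q False ^^ n) vac) []" for n
    using mu' by (simp add: X.spectral_def qip_vac)
  have m2: "(\<integral>t. t\<^sup>2 \<partial>mu) = 1" and m4: "(\<integral>t. t ^ 4 \<partial>mu) = 2 + q"
    and m6: "(\<integral>t. t ^ 6 \<partial>mu) = 5 + 6 * q + 3 * q\<^sup>2 + q ^ 3"
    using mom[of 2] mom[of 4] mom[of 6] unfolding Xop_vac_moments
    by (simp_all only: of_real_eq_iff of_real_eq_1_iff)
  note supp = X.spectral_support[OF vac_in_fock mu']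
  let ?s = "2 + q"
  have cases: "AE t in mu. (\<gamma> t = t \<and> t\<^sup>2 < ?s) \<or> (\<gamma> t = - t \<and> ?s \<le> t\<^sup>2)"
    using supp by eventually_elim (auto simp: \<gamma>_def flip_above_def)
  text \<open>\<open>\<integral> t\<^sup>2 (t\<^sup>2 - s) = 0\<close> but \<open>\<integral> t\<^sup>2 (t\<^sup>2 - s)\<^sup>2 > 0\<close>, so \<open>t\<^sup>2 (t\<^sup>2 - s)\<close> takes both signs.\<close>
  have null: False if sign: "(AE t in mu. 0 \<le> c * (t ^ 4 - ?s * t\<^sup>2))" and c: "c = 1 \<or> c = -1" for c :: real
  proof -
    have ii: "integrable mu (\<lambda>t. c * (t ^ 4 - ?s * t\<^sup>2))" by simp
    have "(\<integral>t. c * (t ^ 4 - ?s * t\<^sup>2) \<partial>mu) = 0" by (simp add: m2 m4)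
    then have "AE t in mu. c * (t ^ 4 - ?s * t\<^sup>2) = 0"
      using integral_nonneg_eq_0_iff_AE[OF ii sign] by simp
    then have "AE t in mu. t ^ 6 - 2 * ?s * t ^ 4 + ?s\<^sup>2 * t\<^sup>2 = 0"
    proof eventually_elim
      fix t :: real assume "c * (t ^ 4 - ?s * t\<^sup>2) = 0"
      then have "t\<^sup>2 * (t\<^sup>2 - ?s) = 0" using c by (auto simp: power_numeral_reduce algebra_simps)
      then have "t\<^sup>2 * (t\<^sup>2 - ?s) * (t\<^sup>2 - ?s) = 0" by simp
      then show "t ^ 6 - 2 * ?s * t ^ 4 + ?s\<^sup>2 * t\<^sup>2 = 0"
        by (simp add: power_numeral_reduce algebra_simps)
    qed
    then have "(\<integral>t. t ^ 6 - 2 * ?s * t ^ 4 + ?s\<^sup>2 * t\<^sup>2 \<partial>mu) = 0"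
      by (rule integral_eq_zero_AE)
    then have "5 + 6 * q + 3 * q\<^sup>2 + q ^ 3 - 2 * ?s * ?s + ?s\<^sup>2 = 0"
      by (simp add: m2 m4 m6)
    \<comment> \<open>With \<open>s\<close> both the threshold and the fourth moment, the integral
      is the sixth moment minus \<open>s\<^sup>2\<close>.\<close>
    then have "1 + 2 * q + 2 * q\<^sup>2 + q ^ 3 = 0"
      by (simp add: power2_eq_square algebra_simps)
    moreover have "0 < 1 + 2 * q + 2 * q\<^sup>2 + q ^ 3" using q_pos by (simp add: add_pos_pos)
    ultimately show False by simp
  qed
  have int\<gamma>: "integrable mu (\<lambda>t. t * \<gamma> t)"
  proof (rule Bochner_Integration.integrable_bound)
    show "integrable mu (\<lambda>t. t\<^sup>2)" by simp
    show "AE t in mu. norm (t * \<gamma> t) \<le> norm (t\<^sup>2)"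
      using cases by eventually_elim (auto simp: power2_eq_square abs_mult)
  qed measurable
  have strict: "(\<integral>t. t\<^sup>2 - c * (t * \<gamma> t) \<partial>mu) > 0" if c: "c = 1 \<or> c = -1" for c :: real
  proof (rule ccontr)
    assume not: "\<not> ?thesis"
    have ii: "integrable mu (\<lambda>t. t\<^sup>2 - c * (t * \<gamma> t))" using int\<gamma> by simp
    have nn: "AE t in mu. 0 \<le> t\<^sup>2 - c * (t * \<gamma> t)"
      using cases by eventually_elim (use c in \<open>auto simp: power2_eq_square\<close>)
    have "(\<integral>t. t\<^sup>2 - c * (t * \<gamma> t) \<partial>mu) = 0"
      using not integral_nonneg_AE[OF nn] by simp
    then have "AE t in mu. t\<^sup>2 - c * (t * \<gamma> t) = 0"
      using integral_nonneg_eq_0_iff_AE[OF ii nn] by simp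
    then have "AE t in mu. 0 \<le> - c * (t ^ 4 - ?s * t\<^sup>2)"
      using cases
    proof eventually_elim
      fix t assume eq: "t\<^sup>2 - c * (t * \<gamma> t) = 0" and
        "(\<gamma> t = t \<and> t\<^sup>2 < ?s) \<or> (\<gamma> t = - t \<and> ?s \<le> t\<^sup>2)"
      then have "t = 0 \<or> (c = 1 \<and> t\<^sup>2 \<le> ?s) \<or> (c = -1 \<and> ?s \<le> t\<^sup>2)"
        using c by (auto simp: power2_eq_square)
      moreover have "t ^ 4 - ?s * t\<^sup>2 = t\<^sup>2 * (t\<^sup>2 - ?s)" by (simp add: power_numeral_reduce algebra_simps)
      ultimately show "0 \<le> - c * (t ^ 4 - ?s * t\<^sup>2)"
        by (auto simp: mult_nonneg_nonpos)
    qed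
    then show False using null[of "- c"] c by auto
  qed
  show ?thesis
    using strict[of 1] strict[of "-1"] int\<gamma> m2 by (simp add: abs_less_iff)
qed

end

theorem theorem1:
  fixes q :: real
  assumes "0 < q" and "q < 1"
  shows "\<exists>(\<gamma>::real \<Rightarrow> real) T.
           \<gamma> \<in> borel_measurable borel \<and> bounded (range \<gamma>) \<and>
           is_fcalc q (Xop q False) \<gamma> T \<and>
           same_distribution q (Xop q False) T \<and>
           \<not> same_distribution q (\<lambda>v w. Xop q False v w + Xop q True v w)
                                 (\<lambda>v w. T v w + Xop q True v w)"
proof -
  interpret q_fock q using assms by unfold_locales
  let ?X = "Xop q False" and ?s = "2 + q"
  \<comment> \<open>Two demands meet here: \<open>R\<^sup>2 = K * s\<close> puts the threshold
    \<open>s\<close> at \<open>t\<^sup>2 / R\<^sup>2 = 1 / K\<close> with a natural number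
    \<open>K\<close>, and \<open>K \<ge> 4 / (1 - q)\<close> makes \<open>R\<close> a norm bound for
    both field operators.\<close>
  define K where "K = nat \<lceil>4 / (1 - q)\<rceil>"
  have K: "4 / (1 - q) \<le> real K" unfolding K_def by (rule real_nat_ceiling_ge)
  then have K_pos: "0 < real K" using assms by (intro less_le_trans[OF _ K]) simp
  define R where "R = sqrt (real K * ?s)"
  have R: "0 < R" "R\<^sup>2 = real K * ?s"
    using K_pos assms by (simp_all add: R_def)
  have "4 / (1 - q) \<le> R\<^sup>2"
    unfolding R(2) using K mult_left_mono[of 1 ?s "real K"] assms by linarith
  then have symX: "sym_op (fock q) (qip q) ?X R" and symX1: "sym_op (fock q) (qip q) (Xop q True) R"
    by (auto intro: sym_op_Xop R)
  define \<gamma> where "\<gamma> = flip_above ?s R"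
  interpret X: sym_op "fock q" "qip q" ?X R by (rule symX)
  interpret X: poly_limit "fock q" "qip q" ?X R "threshold_poly R K" \<gamma> R
    by unfold_locales (auto simp: \<gamma>_def R assms add_pos_pos
        intro: threshold_poly_bound threshold_poly_limit flip_above_borel)
  define T where "T = X.T"
  interpret T: sym_op "fock q" "qip q" T R unfolding T_def by (rule X.sym_op_T)
  have spectral_eq: "spectral_measure q ?X z mu \<longleftrightarrow> X.spectral z mu" for z mu
    by (simp add: spectral_measure_def X.spectral_def)
  have \<gamma>_sq: "\<gamma> t ^ n = t ^ n" if "\<bar>t\<bar> \<le> R" "even n" for t n
    using that by (auto simp: \<gamma>_def flip_above_def)
  \<comment> \<open>Proved for arbitrary vectors, since the fourth moment also involves the second
    moment at \<open>f\<^sub>1\<close>.\<close>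
  have even_moment: "qip q v ((T ^^ n) v) = qip q v ((?X ^^ n) v)" if v: "v \<in> fock q" and n: "even n" for v n
  proof -
    obtain mu where mu: "X.spectral v mu" using X.spectral_exists[OF v] by blast
    have sets [measurable_cong]: "sets mu = sets borel" using mu by (rule X.spectral_sets)
    have [measurable]: "\<gamma> \<in> borel_measurable borel" by (simp add: \<gamma>_def flip_above_borel)
    have "(\<integral>t. \<gamma> t ^ n \<partial>mu) = (\<integral>t. t ^ n \<partial>mu)"
    proof (rule integral_cong_AE)
      show "AE t in mu. \<gamma> t ^ n = t ^ n"
        using X.spectral_support[OF v mu] by eventually_elim (rule \<gamma>_sq[OF _ n])
    qed measurable
    then show ?thesis
      using X.T_moment[OF v mu, of n] mu by (simp add: T_def X.spectral_def)
  qed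
  have odd_X: "qip q vac ((?X ^^ n) vac) = 0" if "odd n" for n
    using that by (simp add: qip_vac Xop_funpow_vac_odd)
  have odd_T: "qip q vac ((T ^^ n) vac) = 0" if n: "odd n" for n
  proof -
    obtain mu where mu: "X.spectral vac mu" using X.spectral_exists[OF vac_in_fock] by blast
    have sets [measurable_cong]: "sets mu = sets borel" using mu by (rule X.spectral_sets)
    have [measurable]: "\<gamma> \<in> borel_measurable borel" by (simp add: \<gamma>_def flip_above_borel)
    have [measurable]: "uminus \<in> borel_measurable (borel :: real measure)"
      by (intro borel_measurable_continuous_onI continuous_intros)
    have uminus_mu: "uminus \<in> borel_measurable mu" by measurable
    \<comment> \<open>The reflected measure has the same moments, as the odd ones vanish. Applying
      \<open>X.T_moment\<close> to both measures and using that \<open>\<gamma>\<close> is odd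
      equates the moment of \<open>T\<close> with its negative.\<close>
    let ?nu = "distr mu borel uminus"
    have "X.spectral vac ?nu"
      unfolding X.spectral_def
    proof (intro conjI allI)
      show "finite_measure ?nu"
        using X.spectral_finite[OF mu] by (rule finite_measure.finite_measure_distr[OF _ uminus_mu])
      have int: "integrable mu (\<lambda>t. t ^ m)" for m using mu by (simp add: X.spectral_def)
      have pm: "(\<lambda>t :: real. (- t) ^ m) = (\<lambda>t. (-1) ^ m * t ^ m)" for m
        by (rule ext) (rule power_minus)
      have "integrable mu (\<lambda>t. (- t) ^ m)" for m
        unfolding pm by (intro integrable_mult_right int)
      then show "integrable ?nu (\<lambda>t. t ^ m)" for m
        by (subst integrable_distr_eq[OF uminus_mu]) auto
      have "(\<integral>t. t ^ m \<partial>?nu) = (\<integral>t. (- t) ^ m \<partial>mu)" for m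
        by (rule integral_distr[OF uminus_mu]) simp
      then have "(\<integral>t. t ^ m \<partial>?nu) = (-1) ^ m * (\<integral>t. t ^ m \<partial>mu)" for m
        unfolding pm by simp
      then show "complex_of_real (\<integral>t. t ^ m \<partial>?nu) = qip q vac ((?X ^^ m) vac)" for m
        using mu odd_X[of m] by (cases "even m") (auto simp: X.spectral_def)
    qed simp
    from X.T_moment[OF vac_in_fock this, of n]
    have "qip q vac ((T ^^ n) vac) = of_real (\<integral>t. \<gamma> t ^ n \<partial>?nu)" by (simp add: T_def)
    also have "(\<integral>t. \<gamma> t ^ n \<partial>?nu) = (\<integral>t. \<gamma> (- t) ^ n \<partial>mu)"
      by (subst integral_distr) auto
    also have "\<dots> = - (\<integral>t. \<gamma> t ^ n \<partial>mu)"
      using n by (simp add: \<gamma>_def flip_above_uminus)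
    also have "complex_of_real \<dots> = - qip q vac ((T ^^ n) vac)"
      using X.T_moment[OF vac_in_fock mu, of n] by (simp add: T_def)
    finally show ?thesis by simp
  qed
  have "qip q vac ((T ^^ n) vac) = qip q vac ((?X ^^ n) vac)" for n
    using even_moment[OF vac_in_fock, of n] odd_X[of n] odd_T[of n] by (cases "even n") auto
  then have same: "same_distribution q ?X T"
    by (simp add: same_distribution_def vac_distribution_def spectral_measure_def)
  have fcalc: "is_fcalc q ?X \<gamma> T"
    unfolding is_fcalc_def
  proof (intro conjI ballI allI impI)
    show "T v \<in> fock q" if "v \<in> fock q" for v using that by (rule T.X_in)
    show "T (\<lambda>w. a * u w + b * v w) = (\<lambda>w. a * T u w + b * T v w)"
      if "u \<in> fock q" "v \<in> fock q" for u v a b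
      using T.X_lincomb[OF that, of a b] by (simp add: lincomb_def)
    show "qip q z (T z) = complex_of_real (\<integral>t. \<gamma> t \<partial>mu)"
      if "z \<in> fock q" "spectral_measure q ?X z mu" for z mu
      using X.T_moment[OF that(1), of mu 1] that(2) by (simp add: spectral_eq T_def)
  qed
  have "\<bar>\<gamma> t\<bar> \<le> R" for t using R(1) by (simp add: \<gamma>_def flip_above_def)
  then have bounded: "bounded (range \<gamma>)" by (auto simp: bounded_iff)

  have papp_f0: "f0_only (X.papp p v)" if "f0_only v" for p v
  proof (induction p)
    case 0
    then show ?case by (simp add: X.papp_0 f0_only_def)
  next
    case (pCons a p)
    then show ?case using that by (simp add: X.papp_pCons f0_only_lincomb f0_only_Xop)
  qed
  have T_f0: "f0_only (T v)" if "v \<in> fock q" "f0_only v" for v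
    unfolding f0_only_def
  proof (intro allI impI)
    fix w :: "bool list" assume "True \<in> set w"
    then have "X.papp p v w = 0" for p using papp_f0[OF that(2), of p] by (simp add: f0_only_def)
    then show "T v w = 0"
      using X.T_limit(2)[OF that(1), of w] by (simp add: T_def LIMSEQ_const_iff)
  qed
  have papp_tensor: "X.papp p (tensor_f1 v) = tensor_f1 (X.papp p v)" for p v
  proof (induction p)
    case 0
    then show ?case by (simp add: X.papp_0 tensor_f1_def)
  next
    case (pCons a p)
    then show ?case by (simp add: X.papp_pCons tensor_f1_lincomb Xop_tensor_f1)
  qed
  \<comment> \<open>Every approximating polynomial commutes with \<open>tensor_f1\<close>, and
    coefficientwise limits preserve this.\<close>
  have T_tensor: "T (cre True vac) = tensor_f1 (T vac)"
  proof
    fix w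
    have "(\<lambda>n. X.papp (threshold_poly R K n) (cre True vac) w) \<longlonglongrightarrow> T (cre True vac) w"
      unfolding T_def by (intro X.T_limit cre_fock vac_in_fock)
    moreover have "(\<lambda>n. tensor_f1 (X.papp (threshold_poly R K n) vac) w) \<longlonglongrightarrow> tensor_f1 (T vac) w"
      unfolding tensor_f1_def T_def using X.T_limit(2)[OF vac_in_fock] by auto
    ultimately show "T (cre True vac) w = tensor_f1 (T vac) w"
      unfolding cre_vac_eq_tensor_f1 papp_tensor by (rule LIMSEQ_unique)
  qed
  have X_tensor: "?X (cre True vac) = tensor_f1 (?X vac)"
    unfolding cre_vac_eq_tensor_f1 by (rule Xop_tensor_f1)
  let ?SX = "\<lambda>v w. ?X v w + Xop q True v w" and ?ST = "\<lambda>v w. T v w + Xop q True v w"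
  \<comment> \<open>All other terms are even moments at the vacuum or at \<open>f\<^sub>1\<close>,
    equal for \<open>T\<close> and \<open>X\<^sub>0\<close>, or do not involve either
    operator.\<close>
  have diff: "Re (qip q vac ((?ST ^^ 4) vac)) - Re (qip q vac ((?SX ^^ 4) vac))
      = 2 * (\<Sum>n. q ^ n * dsq n (T vac)) - 2 * (\<Sum>n. q ^ n * dsq n (?X vac))"
    using even_moment[OF vac_in_fock, of 2] even_moment[OF vac_in_fock, of 4]
      even_moment[OF cre_fock(1)[OF vac_in_fock, of True], of 2]
    by (simp add: fourth_moment[OF T.sym_op_axioms T_f0 T_tensor]
        fourth_moment[OF symX f0_only_Xop X_tensor])
  have X_sum: "(\<Sum>n. q ^ n * dsq n (?X vac)) = q"
  proof -
    have "vac [] = 1" by (simp add: vac_def)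
    then have deg: "qip_deg q (?X vac) (?X vac) n = (if n = 1 then 1 else 0)" for n
      by (cases n) (simp_all add: Xop_vac qip_deg_cre_0 qip_deg_cre ann_cre_vac qip_deg_vac)
    have "(\<Sum>n. q ^ n * dsq n (?X vac)) = (\<Sum>n\<in>{1}. q ^ n * dsq n (?X vac))"
      by (rule suminf_finite) (auto simp: deg)
    then show ?thesis by (simp add: deg)
  qed
  have T_sum: "(\<Sum>n. q ^ n * dsq n (T vac)) < q"
  proof (rule weighted_dsq_less)
    show "T vac \<in> fock q" using vac_in_fock by (rule T.X_in)
    have "qip q (T vac) (T vac) = qip q vac ((T ^^ 2) vac)"
      using T.X_sym[OF vac_in_fock T.X_in[OF vac_in_fock]] by (simp add: numeral_2_eq_2)
    also have "\<dots> = 1"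
      using even_moment[OF vac_in_fock, of 2] by (simp add: qip_vac Xop_vac_moments)
    finally show "F.nsq (T vac) = 1" by (simp add: F.nsq_def)
    have f0: "f0_only (T vac)" using vac_in_fock f0_only_vac by (rule T_f0)
    show "dsq 0 (T vac) = 0"
      using odd_T[of 1] by (simp add: dsq_0_1[OF f0] qip_vac)
    obtain mu where mu: "X.spectral vac mu" using X.spectral_exists[OF vac_in_fock] by blast
    \<comment> \<open>The degree-one part of \<open>T \<Omega>\<close> is a multiple of
      \<open>f\<^sub>0\<close>, and its coefficient is
      \<open>\<langle>X\<^sub>0 \<Omega>, T \<Omega>\<rangle>\<close>.\<close>
    have "T vac [False] = qip q vac (?X (T vac))"
      by (simp add: qip_vac Xop_replicate_0)
    also have "\<dots> = of_real (\<integral>t. t * \<gamma> t \<partial>mu)"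
      using X.X_T_moment[OF vac_in_fock mu] X.X_sym[OF vac_in_fock T.X_in[OF vac_in_fock]]
      by (simp add: T_def)
    finally have "cmod (T vac [False]) < 1"
      using flip_not_extremal[OF symX, of mu] mu by (simp add: spectral_eq \<gamma>_def)
    then show "dsq 1 (T vac) < 1"
      by (simp add: dsq_0_1(2)[OF f0] power_less_one_iff del: One_nat_def)
  qed
  have "\<not> same_distribution q ?SX ?ST"
  proof
    assume *: "same_distribution q ?SX ?ST"
    \<comment> \<open>\<open>same_distribution\<close> quantifies over measures and would hold
      vacuously if neither operator had one. A measure for \<open>X\<^sub>0 + X\<^sub>1\<close> must
      therefore be exhibited before unequal moments give a contradiction.\<close>
    interpret SX: sym_op "fock q" "qip q" ?SX "2 * (R + R)"
      by (intro sym_op_add symX symX1)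
    obtain mu where "SX.spectral vac mu" using SX.spectral_exists[OF vac_in_fock] by blast
    then have "vac_distribution q ?SX mu"
      by (simp add: vac_distribution_def spectral_measure_def SX.spectral_def)
    moreover from this have "vac_distribution q ?ST mu"
      using * by (simp add: same_distribution_def)
    ultimately have "qip q vac ((?SX ^^ 4) vac) = qip q vac ((?ST ^^ 4) vac)"
      unfolding vac_distribution_def spectral_measure_def by metis
    then show False using diff X_sum T_sum by simp
  qed
  then show ?thesis
    using fcalc same bounded flip_above_borel[of ?s R] unfolding \<gamma>_def[symmetric] by blast
qed

end
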